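(* Let $K$ be a $p$-adic field and let $\ell$ be a prime, possibly equal to $p$. Let $\Lambda_A\subset (K^{\times})^g$ and $\Lambda_B\subset (K^{\times})^h$ be lattices and let $A:=\mathbb{G}_{m,K}^g/\Lambda_A$ and $B:=\mathbb{G}_{m,K}^h/\Lambda_B$ be the associated abeloid varieties. Let $Q_A$ and $Q_B$ be period matrices for $\Lambda_A$ and $\Lambda_B$. Then there exist isomorphisms of $\mathbb{Z}_\ell$-modules \begin{align*} \mathrm{Hom}_{G_K}(T_\ell(A),T_\ell(B))&\cong\{M\in\mathrm{Mat}_{g\times h}(\mathbb{Z}_\ell)\mid \gamma_\ell(\Lambda_A)\odot M\subseteq\gamma_\ell(\Lambda_B)\}\\ &\cong\{M\in\mathrm{Mat}_{g\times h}(\mathbb{Z}_\ell)\mid \exists N\in\mathrm{Mat}_{g\times h}(\mathbb{Z}_\ell):\ \gamma_\ell(Q_A)\odot M=N\odot\gamma_\ell(Q_B)\}\\ &\cong\{M\in\mathrm{Mat}_{g\times h}(\mathbb{Z}_\ell)\mid (\mathrm{ord}_p(Q_A)^{-1}\odot\gamma_\ell(Q_A))\odot M=M\odot(\mathrm{ord}_p(Q_B)^{-1}\odot\gamma_\ell(Q_B))\}. \end{align*} Here $\gamma_\ell:K^\times\to\widehat{K^\times}^{\ell}$ denotes the $\ell$-adic completion.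
   Context: A $p$-adic field is a finite extension of $\mathbb{Q}_p$; $G_K=\mathrm{Gal}(\overline K/K)$; $\nu_p$ is the valuation on $K$ with $\nu_p(p)=1$. Let $q_1,\dots,q_g\in (K^\times)^g$ be vectors, $q_i=(q_{i,1},\dots,q_{i,g})$, with $\nu_p(q_{i,j})>1$ for all $i,j$, and let $Q=(q_{i,j})$ be the $g\times g$-matrix whose rows are the $q_i$. Put $\mathrm{ord}_p(Q)=(\nu_p(q_{i,j}))\in\mathrm{Mat}_{g\times g}(\mathbb{Q})$. The subgroup $\Lambda=q_1^{\mathbb{Z}}\cdots q_g^{\mathbb{Z}}$ of $(K^\times)^g$ is called a lattice if $\mathrm{ord}_p(Q)$ is invertible; the matrix $Q$ associated to a choice of basis of $\Lambda$ is called a period matrix. The associated abeloid variety is the rigid analytic variety $\mathbb{G}_{m,K}^g/\Lambda$ over $K$. For an abeloid variety $A=\mathbb{G}_{m,K}^g/\Lambda$ one has $A(\overline K)\cong(\overline K^\times)^g/\Lambda$, and its $\ell$-adic Tate module is $T_\ell(A)=\varprojlim_n A(\overline K)[\ell^n]$ with its $G_K$-action. $\mathrm{Hom}_{G_K}$ denotes $G_K$-equivariant homomorphisms. The $\ell$-adic completion is $\gamma_\ell:K^\times\to\widehat{K^\times}^{\ell}:=\varprojlim_n K^\times/(K^{\times})^{\ell^n}$, applied entrywise to vectors and matrices. If $R$ is a commutative ring and $\mathcal{A}$ is an $R$-module (possibly written multiplicatively), $\odot$ denotes the matrix products, from either side, of matrices with entries in $R$ with matrices with entries in $\mathcal{A}$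 (for example, $(x_1,\dots,x_g)\odot(m_{ij})$ has $i$-th entry $\prod_j x_j^{m_{ji}}$).
   Formalization: In the first set, γ_ℓ(Λ) is taken as the Z_ℓ-submodule generated by the image of Λ (with the bare image the set need not be a Z_ℓ-module); the third equation, with rational entries of ord_p(Q)^{-1}, is read in the completion of K^× tensored with Q_ℓ. *)

theory Defs
  imports
    "HOL-Analysis.Analysis"
    "HOL-Algebra.Module"
    "HOL-Algebra.Algebraic_Closure_Type"
    "HOL-Computational_Algebra.Fraction_Field"
begin

class prime_card = assumes prime_card: "Factorial_Ring.prime (CARD('a))"

section \<open>The rings of p-adic integers and p-adic numbers\<close>

text \<open>
  The prime is the cardinality of the index type. An element of the inverse limit of the rings
  of integers modulo powers of the prime is the sequence of its least nonnegative residues.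
\<close>

typedef 'p padic_int = "{x :: nat \<Rightarrow> int. \<forall>n.
    x n \<in> {0..<int CARD('p::prime_card) ^ n} \<and> x (Suc n) mod int CARD('p) ^ n = x n}"
  morphisms residue Abs_padic_int
  by (rule exI[of _ "\<lambda>_. 0"]) (use prime_gt_0_nat[OF prime_card[where 'a='p]] in auto)

setup_lifting type_definition_padic_int

lemma card_gt_1: "int CARD('p::prime_card) > 1"
  using prime_gt_1_nat[OF prime_card[where 'a='p]] by simp

lemma mod_Suc_mod:
  fixes P :: int
  shows "(x mod P ^ Suc n) mod P ^ n = x mod P ^ n"
  by (rule mod_mod_cancel) (simp add: le_imp_power_dvd)

instantiation padic_int :: (prime_card) comm_ring_1
begin

lift_definition zero_padic_int :: "'a padic_int" is "\<lambda>_. 0"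
  using card_gt_1[where 'p='a] by auto

lift_definition one_padic_int :: "'a padic_int" is "\<lambda>n. 1 mod int CARD('a) ^ n"
  using card_gt_1[where 'p='a] by (auto simp: mod_Suc_mod simp del: power_Suc)

lift_definition plus_padic_int :: "'a padic_int \<Rightarrow> 'a padic_int \<Rightarrow> 'a padic_int"
  is "\<lambda>x y n. (x n + y n) mod int CARD('a) ^ n"
  using card_gt_1[where 'p='a] by (auto simp: mod_Suc_mod simp del: power_Suc) (metis mod_add_eq)

lift_definition times_padic_int :: "'a padic_int \<Rightarrow> 'a padic_int \<Rightarrow> 'a padic_int"
  is "\<lambda>x y n. (x n * y n) mod int CARD('a) ^ n"
  using card_gt_1[where 'p='a] by (auto simp: mod_Suc_mod simp del: power_Suc) (metis mod_mult_eq)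

lift_definition uminus_padic_int :: "'a padic_int \<Rightarrow> 'a padic_int"
  is "\<lambda>x n. (- x n) mod int CARD('a) ^ n"
  using card_gt_1[where 'p='a] by (auto simp: mod_Suc_mod simp del: power_Suc) (metis mod_minus_eq)

lift_definition minus_padic_int :: "'a padic_int \<Rightarrow> 'a padic_int \<Rightarrow> 'a padic_int"
  is "\<lambda>x y n. (x n - y n) mod int CARD('a) ^ n"
  using card_gt_1[where 'p='a] by (auto simp: mod_Suc_mod simp del: power_Suc) (metis mod_diff_eq)

instance
proof
  fix a b c :: "'a padic_int"
  show "a * b * c = a * (b * c)"
    by transfer (auto simp: mod_simps algebra_simps)
  show "a * b = b * a"
    by transfer (auto simp: mod_simps algebra_simps)
  show "1 * a = a"
    by transfer (auto simp: mod_simps)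
  show "a + b + c = a + (b + c)"
    by transfer (auto simp: mod_simps algebra_simps)
  show "a + b = b + a"
    by transfer (auto simp: mod_simps algebra_simps)
  show "0 + a = a"
    by transfer auto
  show "- a + a = 0"
    by transfer (auto simp: mod_simps)
  show "a - b = a + - b"
    by transfer (auto simp: mod_simps)
  show "(a + b) * c = a * c + b * c"
    by transfer (auto simp: mod_simps algebra_simps)
  show "(0::'a padic_int) \<noteq> 1"
    using card_gt_1[where 'p='a] by transfer (auto simp: fun_eq_iff intro!: exI[of _ 1])
qed

end

lemma residue_mod_le:
  fixes x :: "'p::prime_card padic_int"
  assumes "m \<le> n"
  shows "residue x n mod int CARD('p) ^ m = residue x m"
  using assms
proof (induction n rule: dec_induct)
  case base
  show ?case using residue[of x] by auto
next
  case (step n)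
  have "residue x (Suc n) mod int CARD('p) ^ m
      = residue x (Suc n) mod int CARD('p) ^ n mod int CARD('p) ^ m"
    using step by (simp add: mod_mod_cancel le_imp_power_dvd)
  also have "residue x (Suc n) mod int CARD('p) ^ n = residue x n"
    using residue[of x] by auto
  finally show ?case using step by simp
qed

instance padic_int :: (prime_card) idom
proof
  fix a b :: "'a padic_int"
  assume "a \<noteq> 0" "b \<noteq> 0"
  let ?P = "int CARD('a)"
  from \<open>a \<noteq> 0\<close> obtain m where m: "residue a m \<noteq> 0"
    by transfer (auto simp: fun_eq_iff)
  from \<open>b \<noteq> 0\<close> obtain k where k: "residue b k \<noteq> 0"
    by transfer (auto simp: fun_eq_iff)
  define u v where "u = residue a (m + k)" and "v = residue b (m + k)"
  have P: "Factorial_Ring.prime ?P" using prime_card[where 'a='a] by simp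
  have u: "\<not> ?P ^ m dvd u" and v: "\<not> ?P ^ k dvd v"
    using m k residue_mod_le[of m "m + k" a] residue_mod_le[of k "m + k" b]
    by (auto simp: u_def v_def)
  hence nz: "u \<noteq> 0" "v \<noteq> 0" by auto
  have "multiplicity ?P u < m" "multiplicity ?P v < k"
    using u v nz P by (meson multiplicity_dvd' not_less)+
  hence "multiplicity ?P (u * v) < m + k"
    using nz P by (simp add: prime_elem_multiplicity_mult_distrib)
  hence "\<not> ?P ^ (m + k) dvd u * v"
    using nz P power_dvd_iff_le_multiplicity
    by (metis mult_eq_0_iff not_less not_prime_unit)
  hence "residue (a * b) (m + k) \<noteq> 0"
    by (simp add: times_padic_int.rep_eq u_def v_def dvd_eq_mod_eq_0)
  thus "a * b \<noteq> 0"
    by (auto simp: zero_padic_int.rep_eq)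
qed

lemma residue_of_nat:
  "residue (of_nat k :: 'p::prime_card padic_int) n = int k mod int CARD('p) ^ n"
  by (induction k)
     (simp_all add: zero_padic_int.rep_eq one_padic_int.rep_eq plus_padic_int.rep_eq mod_simps)

instance padic_int :: (prime_card) ring_char_0
proof
  show "inj (of_nat :: nat \<Rightarrow> 'a padic_int)"
  proof (rule injI)
    fix i j :: nat
    assume eq: "(of_nat i :: 'a padic_int) = of_nat j"
    have "i + j < 2 ^ (i + j)" by (rule less_exp)
    also have "\<dots> \<le> CARD('a) ^ (i + j)"
      using card_gt_1[where 'p='a] by (intro power_mono) auto
    finally have "int i < int CARD('a) ^ (i + j)" "int j < int CARD('a) ^ (i + j)"
      by (simp_all flip: of_nat_power)
    thus "i = j"
      using arg_cong[OF eq, of "\<lambda>x. residue x (i + j)"] by (simp add: residue_of_nat)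
  qed
qed

lemma of_nat_fract: "(of_nat n :: 'a::idom fract) = Fract (of_nat n) 1"
  by (induction n) (simp_all add: Zero_fract_def One_fract_def)

instance fract :: ("{idom,ring_char_0}") field_char_0
  by standard (auto simp: inj_def of_nat_fract eq_fract)

type_synonym 'p padic = "'p padic_int fract"

abbreviation padic_of_int :: "'p::prime_card padic_int \<Rightarrow> 'p padic"
  where "padic_of_int a \<equiv> Fract a 1"

definition padic_int_val :: "'p::prime_card padic_int \<Rightarrow> nat"
  where "padic_int_val a = (GREATEST n. residue a n = 0)"

section \<open>p-adic fields\<close>

text \<open>
  Via \<open>\<iota>\<close>, the field \<open>'k\<close> is a finite extension of the field of p-adic numbers, and \<open>\<nu>\<close> is the
  valuation extending the p-adic one, so that \<open>\<nu> p = 1\<close>. The value \<open>\<nu> 0\<close> is unspecified. Since \<open>\<nu>\<close> is a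
  homomorphism on nonzero elements, it suffices to prescribe it on the p-adic integers;
  prescribing only \<open>\<nu> p = 1\<close> would not determine it, as no continuity is assumed.
\<close>

locale padic_field =
  fixes \<iota> :: "'p::prime_card padic \<Rightarrow> 'k::field" and \<nu> :: "'k \<Rightarrow> rat"
  assumes \<iota>_add: "\<iota> (a + b) = \<iota> a + \<iota> b"
    and \<iota>_mult: "\<iota> (a * b) = \<iota> a * \<iota> b"
    and \<iota>_one: "\<iota> 1 = 1"
    and finite_ext: "\<exists>B. finite B \<and> module.span (\<lambda>c x. \<iota> c * x) B = UNIV"
    and \<nu>_mult: "x \<noteq> 0 \<Longrightarrow> y \<noteq> 0 \<Longrightarrow> \<nu> (x * y) = \<nu> x + \<nu> y"
    and \<nu>_add: "x \<noteq> 0 \<Longrightarrow> y \<noteq> 0 \<Longrightarrow> x + y \<noteq> 0 \<Longrightarrow> min (\<nu> x) (\<nu> y) \<le> \<nu> (x + y)"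
    and \<nu>_\<iota>: "c \<noteq> 0 \<Longrightarrow> \<nu> (\<iota> (padic_of_int c)) = of_nat (padic_int_val c)"

definition absolute_galois :: "('k::field alg_closure \<Rightarrow> 'k alg_closure) set"
  where "absolute_galois = {\<sigma>. bij \<sigma>
    \<and> (\<forall>x y. \<sigma> (x + y) = \<sigma> x + \<sigma> y) \<and> (\<forall>x y. \<sigma> (x * y) = \<sigma> x * \<sigma> y)
    \<and> (\<forall>x. \<sigma> (to_ac x) = to_ac x)}"

section \<open>The completion of the multiplicative group\<close>

definition mult_grp :: "'k::field monoid"
  where "mult_grp = \<lparr>carrier = - {0}, monoid.mult = (*), one = 1\<rparr>"

definition powers :: "nat \<Rightarrow> 'k::field set"
  where "powers m = (\<lambda>y. y ^ m) ` (- {0})"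

lemma comm_group_mult_grp: "comm_group (mult_grp :: 'k::field monoid)"
proof (rule comm_groupI)
  show "\<exists>y\<in>carrier mult_grp. y \<otimes>\<^bsub>mult_grp\<^esub> x = \<one>\<^bsub>mult_grp\<^esub>"
    if "x \<in> carrier mult_grp" for x :: 'k
    using that by (intro bexI[of _ "inverse x"]) (auto simp: mult_grp_def)
qed (auto simp: mult_grp_def algebra_simps)

lemma normal_powers: "powers m \<lhd> (mult_grp :: 'k::field monoid)"
proof -
  interpret G: comm_group "mult_grp :: 'k monoid" by (rule comm_group_mult_grp)
  have inv: "inv\<^bsub>mult_grp\<^esub> x = inverse x" if "x \<noteq> 0" for x :: 'k
    by (rule G.inv_equality) (use that in \<open>auto simp: mult_grp_def\<close>)
  have "subgroup (powers m) (mult_grp :: 'k monoid)"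
  proof (rule G.subgroupI)
    show "inv\<^bsub>mult_grp\<^esub> a \<in> powers m" if "a \<in> powers m" for a :: 'k
    proof -
      from that obtain y where y: "y \<noteq> 0" "a = y ^ m" by (auto simp: powers_def)
      hence "inv\<^bsub>mult_grp\<^esub> a = inverse y ^ m" by (simp add: inv power_inverse)
      thus ?thesis using y by (auto simp: powers_def)
    qed
    show "a \<otimes>\<^bsub>mult_grp\<^esub> b \<in> powers m" if "a \<in> powers m" "b \<in> powers m" for a b :: 'k
    proof -
      from that obtain y z where "y \<noteq> 0" "a = y ^ m" "z \<noteq> 0" "b = z ^ m"
        by (auto simp: powers_def)
      hence "a \<otimes>\<^bsub>mult_grp\<^esub> b = (y * z) ^ m" "y * z \<noteq> 0"
        by (auto simp: mult_grp_def power_mult_distrib)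
      thus ?thesis unfolding powers_def by blast
    qed
  next
    have "1 ^ m \<in> powers m" by (auto simp: powers_def simp del: power_one)
    thus "powers m \<noteq> {}" by blast
  qed (auto simp: powers_def mult_grp_def)
  thus ?thesis by (rule G.subgroup_imp_normal)
qed


lemma comm_group_quot: "comm_group (mult_grp Mod powers m :: 'k::field set monoid)"
proof -
  interpret G: comm_group "mult_grp :: 'k monoid" by (rule comm_group_mult_grp)
  show ?thesis
    by (rule G.abelian_FactGroup) (rule normal_imp_subgroup[OF normal_powers])
qed

definition pow_coset :: "nat \<Rightarrow> 'k::field \<Rightarrow> 'k set"
  where "pow_coset m a = powers m #>\<^bsub>mult_grp\<^esub> a"

lemma carrier_quot: "carrier (mult_grp Mod powers m) = pow_coset m ` (- {0::'k::field})"
  by (simp add: carrier_FactGroup pow_coset_def mult_grp_def)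

lemma pow_coset_altdef: "pow_coset m a = {y ^ m * a | y. y \<noteq> 0}"
  by (auto simp: pow_coset_def r_coset_def powers_def mult_grp_def)

lemma pow_coset_eqI: "y \<noteq> 0 \<Longrightarrow> b = y ^ m * a \<Longrightarrow> pow_coset m a = pow_coset m b"
  unfolding pow_coset_altdef
proof (intro equalityI subsetI, goal_cases)
  case (1 x)
  then obtain z where "z \<noteq> 0" "x = z ^ m * a" by auto
  with 1 show ?case by (auto intro!: exI[of _ "z / y"] simp: field_simps)
next
  case (2 x)
  then obtain z where "z \<noteq> 0" "x = z ^ m * b" by auto
  with 2 show ?case by (auto intro!: exI[of _ "z * y"] simp: field_simps)
qed

lemma pow_coset_self: "a \<in> pow_coset m a"
  by (auto simp: pow_coset_altdef intro!: exI[of _ 1])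

lemma pow_coset_subset: "m dvd m' \<Longrightarrow> pow_coset m' a \<subseteq> pow_coset m a"
  by (auto simp: pow_coset_altdef power_mult ac_simps elim!: dvdE)
     (metis power_eq_0_iff power_mult mult.commute)

lemma pow_coset_Suc_subset: "pow_coset (l ^ Suc n) a \<subseteq> pow_coset (l ^ n) a"
  by (rule pow_coset_subset) simp

lemma pow_coset_in_carrier:
  "a \<noteq> 0 \<Longrightarrow> pow_coset m a \<in> carrier (mult_grp Mod powers m)"
  by (auto simp: carrier_quot)

lemma pow_coset_subset_iff:
  assumes "m dvd m'"
  shows "pow_coset m' a \<subseteq> pow_coset m b \<longleftrightarrow> pow_coset m a = pow_coset m b"
proof
  assume "pow_coset m' a \<subseteq> pow_coset m b"
  hence "a \<in> pow_coset m b" using pow_coset_self by blast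
  then obtain y where "y \<noteq> 0" "a = y ^ m * b" by (auto simp: pow_coset_altdef)
  thus "pow_coset m a = pow_coset m b" using pow_coset_eqI by metis
qed (use pow_coset_subset[OF assms] in blast)

lemma pow_coset_mult:
  "a \<noteq> 0 \<Longrightarrow> b \<noteq> 0 \<Longrightarrow>
    pow_coset m a \<otimes>\<^bsub>mult_grp Mod powers m\<^esub> pow_coset m b = pow_coset m (a * b :: 'k::field)"
  using normal.rcos_sum[OF normal_powers, of a b m]
  by (simp add: pow_coset_def mult_grp_def)

lemma one_quot: "\<one>\<^bsub>mult_grp Mod powers m\<^esub> = pow_coset m (1::'k::field)"
  by (auto simp: pow_coset_altdef powers_def)

lemma pow_coset_pow:
  "a \<noteq> 0 \<Longrightarrow> pow_coset m a [^]\<^bsub>mult_grp Mod powers m\<^esub> k = pow_coset m (a ^ k :: 'k::field)"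
proof (induction k)
  case 0
  then show ?case by (simp add: one_quot del: one_FactGroup)
next
  case (Suc k)
  then show ?case by (simp add: pow_coset_mult mult.commute del: mult_FactGroup)
qed

lemma pow_coset_inv:
  "a \<noteq> 0 \<Longrightarrow> inv\<^bsub>mult_grp Mod powers m\<^esub> (pow_coset m a) = pow_coset m (inverse a :: 'k::field)"
proof -
  assume a: "a \<noteq> 0"
  interpret comm_group "mult_grp Mod powers m :: 'k set monoid" by (rule comm_group_quot)
  show ?thesis
    by (rule inv_equality)
       (use a in \<open>auto simp: pow_coset_mult carrier_quot one_quot
          simp del: mult_FactGroup one_FactGroup\<close>)
qed

text \<open>
  The inverse limit of the quotients of the multiplicative group by its \<open>l ^ n\<close>-th powers, where
  \<open>l\<close> is the cardinality of \<open>'l\<close>. The transition map sends a coset to the unique coset containing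
  it, whence the inclusions. The resulting abelian group is written additively.
\<close>

typedef (overloaded) ('k, 'l) mult_completion = "{x :: nat \<Rightarrow> 'k::field set. \<forall>n.
    x n \<in> carrier (mult_grp Mod powers (CARD('l::prime_card) ^ n)) \<and> x (Suc n) \<subseteq> x n}"
  morphisms component Abs_mult_completion
  by (rule exI[of _ "\<lambda>n. pow_coset (CARD('l) ^ n) 1"])
     (simp add: pow_coset_in_carrier pow_coset_Suc_subset del: power_Suc)

setup_lifting type_definition_mult_completion

lemma compatible_cases:
  fixes x :: "nat \<Rightarrow> 'k::field set"
  assumes "\<And>n. x n \<in> carrier (mult_grp Mod powers (L ^ n)) \<and> x (Suc n) \<subseteq> x n"
  obtains c where "c \<noteq> 0" "x n = pow_coset (L ^ n) c" "x (Suc n) = pow_coset (L ^ Suc n) c"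
proof -
  from assms obtain c d where *: "c \<noteq> 0" "d \<noteq> 0" "x n = pow_coset (L ^ n) d"
      "x (Suc n) = pow_coset (L ^ Suc n) c" 
    unfolding carrier_quot by (metis ComplD imageE singletonI)
  moreover have "x (Suc n) \<subseteq> x n" using assms by blast
  ultimately have "pow_coset (L ^ n) c = pow_coset (L ^ n) d"
    by (subst pow_coset_subset_iff[symmetric, of _ "L ^ Suc n"]) auto
  with * show ?thesis using that by metis
qed

lemma pow_coset_mod:
  assumes "a \<noteq> 0" "i mod m = j mod m"
  shows "pow_coset m (a ^ i) = pow_coset m (a ^ j :: 'k::field)"
proof -
  have *: "pow_coset m (a ^ (k mod m)) = pow_coset m (a ^ k)" for k
  proof (rule pow_coset_eqI)
    have "a ^ k = a ^ (m * (k div m) + k mod m)" by simp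
    thus "a ^ k = (a ^ (k div m)) ^ m * a ^ (k mod m)"
      unfolding power_add by (simp add: power_mult[symmetric] mult.commute)
  qed (use assms in auto)
  show ?thesis using *[of i] *[of j] assms by simp
qed

instantiation mult_completion :: (field, prime_card) ab_group_add
begin

lift_definition zero_mult_completion :: "('a, 'b) mult_completion"
  is "\<lambda>n. \<one>\<^bsub>mult_grp Mod powers (CARD('b) ^ n)\<^esub>"
  by (simp add: one_quot pow_coset_in_carrier pow_coset_Suc_subset del: one_FactGroup power_Suc)

lift_definition plus_mult_completion ::
  "('a, 'b) mult_completion \<Rightarrow> ('a, 'b) mult_completion \<Rightarrow> ('a, 'b) mult_completion"
  is "\<lambda>x y n. x n \<otimes>\<^bsub>mult_grp Mod powers (CARD('b) ^ n)\<^esub> y n"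
proof goal_cases
  case (1 x y n)
  obtain c where c: "c \<noteq> 0" "x n = pow_coset (CARD('b) ^ n) c"
    "x (Suc n) = pow_coset (CARD('b) ^ Suc n) c" by (rule compatible_cases[OF 1(1)])
  obtain d where d: "d \<noteq> 0" "y n = pow_coset (CARD('b) ^ n) d"
    "y (Suc n) = pow_coset (CARD('b) ^ Suc n) d" by (rule compatible_cases[OF 1(2)])
  show ?case using c d
    by (simp add: pow_coset_mult pow_coset_in_carrier pow_coset_Suc_subset
        del: mult_FactGroup power_Suc)
qed

lift_definition uminus_mult_completion ::
  "('a, 'b) mult_completion \<Rightarrow> ('a, 'b) mult_completion"
  is "\<lambda>x n. inv\<^bsub>mult_grp Mod powers (CARD('b) ^ n)\<^esub> (x n)"
proof goal_cases
  case (1 x n)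
  obtain c where c: "c \<noteq> 0" "x n = pow_coset (CARD('b) ^ n) c"
    "x (Suc n) = pow_coset (CARD('b) ^ Suc n) c" by (rule compatible_cases[OF 1])
  show ?case using c
    by (simp add: pow_coset_inv pow_coset_in_carrier pow_coset_Suc_subset del: power_Suc)
qed

definition minus_mult_completion ::
  "('a, 'b) mult_completion \<Rightarrow> ('a, 'b) mult_completion \<Rightarrow> ('a, 'b) mult_completion"
  where "minus_mult_completion x y = x + - y"

instance
proof
  fix a b c :: "('a, 'b) mult_completion"
  note G = comm_group_quot[where 'k='a]
  note Gr = comm_group.axioms(2)[OF G] and Gm = comm_group.axioms(1)[OF G]
  note Gmm = comm_monoid.axioms(1)[OF Gm]
  show "a + b + c = a + (b + c)"
    by transfer (simp add: monoid.m_assoc[OF Gmm] del: mult_FactGroup)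
  show "a + b = b + a"
    by transfer (simp add: comm_monoid.m_comm[OF Gm] del: mult_FactGroup)
  show "0 + a = a"
    by transfer (simp add: monoid.l_one[OF Gmm] del: mult_FactGroup one_FactGroup)
  show "- a + a = 0"
    by transfer (simp add: group.l_inv[OF Gr] del: mult_FactGroup one_FactGroup)
  show "a - b = a + - b"
    by (simp add: minus_mult_completion_def)
qed

end

lift_definition cscale ::
  "'l padic_int \<Rightarrow> ('k::field, 'l::prime_card) mult_completion \<Rightarrow> ('k, 'l) mult_completion"
  is "\<lambda>a x n. x n [^]\<^bsub>mult_grp Mod powers (CARD('l) ^ n)\<^esub> nat (a n)"
proof goal_cases
  case (1 a x n)
  obtain c where c: "c \<noteq> 0" "x n = pow_coset (CARD('l) ^ n) c"
    "x (Suc n) = pow_coset (CARD('l) ^ Suc n) c" by (rule compatible_cases[OF 1(2)])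
  have a: "a n = a (Suc n) mod int CARD('l) ^ n" "a (Suc n) \<ge> 0" using 1(1) by auto
  have "nat (a n) mod CARD('l) ^ n = nat (a (Suc n)) mod CARD('l) ^ n"
    using a by (simp add: nat_mod_distrib nat_power_eq)
  from pow_coset_mod[OF c(1) this] show ?case using c
    by (simp add: pow_coset_pow pow_coset_in_carrier pow_coset_Suc_subset del: power_Suc)
qed

lemma module_cscale: "Modules.module
  (cscale :: 'l padic_int \<Rightarrow> ('k::field, 'l::prime_card) mult_completion \<Rightarrow> _)"
proof
  fix a b :: "'l padic_int" and x y :: "('k, 'l) mult_completion"
  let ?L = "CARD('l)"
  have ex: "\<exists>c. c \<noteq> 0 \<and> component x n = pow_coset (?L ^ n) c"
    for n and x :: "('k, 'l) mult_completion"
  proof -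
    have "component x n \<in> carrier (mult_grp Mod powers (?L ^ n))" using component[of x] by blast
    thus ?thesis unfolding carrier_quot by auto
  qed
  have eqI: "u = v" if "\<And>n. component u n = component v n" for u v :: "('k, 'l) mult_completion"
    using that by (auto simp: component_inject[symmetric])
  have res: "0 \<le> residue a n" for a :: "'l padic_int" and n
    using residue[of a] by auto
  note [simp] = cscale.rep_eq plus_mult_completion.rep_eq pow_coset_mult pow_coset_pow
  note [simp del] = mult_FactGroup
  have m1: "nat (residue (a + b) n) mod ?L ^ n = (nat (residue a n) + nat (residue b n)) mod ?L ^ n" for n
    using res[of a n] res[of b n]
    by (simp add: plus_padic_int.rep_eq nat_mod_distrib nat_power_eq nat_add_distrib)
  have m2: "nat (residue (a * b) n) mod ?L ^ n = (nat (residue b n) * nat (residue a n)) mod ?L ^ n" for n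
    using res[of a n] res[of b n]
    by (simp add: times_padic_int.rep_eq nat_mod_distrib nat_power_eq nat_mult_distrib mult.commute)
  have m3: "nat (residue (1 :: 'l padic_int) n) mod ?L ^ n = 1 mod ?L ^ n" for n
    by (simp add: one_padic_int.rep_eq nat_mod_distrib nat_power_eq)
  show "cscale a (x + y) = cscale a x + cscale a y"
  proof (rule eqI)
    fix n show "component (cscale a (x + y)) n = component (cscale a x + cscale a y) n"
    proof -
      obtain c where c: "c \<noteq> 0" "component x n = pow_coset (?L ^ n) c" using ex[of x n] by blast
      obtain d where d: "d \<noteq> 0" "component y n = pow_coset (?L ^ n) d" using ex[of y n] by blast
      show ?thesis by (simp add: c d power_mult_distrib)
    qed
  qed
  show "cscale (a + b) x = cscale a x + cscale b x"
  proof (rule eqI)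
    fix n show "component (cscale (a + b) x) n = component (cscale a x + cscale b x) n"
    proof -
      obtain c where c: "c \<noteq> 0" "component x n = pow_coset (?L ^ n) c" using ex[of x n] by blast
      show ?thesis using pow_coset_mod[OF c(1) m1[of n]] by (simp add: c power_add)
    qed
  qed
  show "cscale a (cscale b x) = cscale (a * b) x"
  proof (rule eqI)
    fix n show "component (cscale a (cscale b x)) n = component (cscale (a * b) x) n"
    proof -
      obtain c where c: "c \<noteq> 0" "component x n = pow_coset (?L ^ n) c" using ex[of x n] by blast
      show ?thesis using pow_coset_mod[OF c(1) m2[of n]] by (simp add: c power_mult)
    qed
  qed
  show "cscale 1 x = x"
  proof (rule eqI)
    fix n show "component (cscale 1 x) n = component x n"
    proof -
      obtain c where c: "c \<noteq> 0" "component x n = pow_coset (?L ^ n) c" using ex[of x n] by blast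
      show ?thesis using pow_coset_mod[OF c(1) m3[of n]] by (simp add: c)
    qed
  qed
qed

text \<open>The canonical map \<open>\<gamma>\<close> to the completion; its value at \<open>0\<close> is a dummy.\<close>

lift_definition compl_map :: "'k::field \<Rightarrow> ('k, 'l::prime_card) mult_completion"
  is "\<lambda>a n. powers (CARD('l) ^ n) #>\<^bsub>mult_grp\<^esub> (if a = 0 then 1 else a)"
  by (simp flip: pow_coset_def add: pow_coset_in_carrier pow_coset_Suc_subset del: power_Suc)

interpretation cscale: Modules.module
  "cscale :: 'l padic_int \<Rightarrow> ('k::field, 'l::prime_card) mult_completion \<Rightarrow> _"
  by (rule module_cscale)

lifting_forget padic_int.lifting
lifting_forget mult_completion.lifting

text \<open>
  The tensor product of the completion with the field of \<open>l\<close>-adic numbers over the ring of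
  \<open>l\<close>-adic integers, as a localisation: the pair \<open>(x, a)\<close> stands for \<open>x / a\<close>.
\<close>

definition loc_rel :: "('k::field, 'l::prime_card) mult_completion \<times> 'l padic_int \<Rightarrow>
    ('k, 'l) mult_completion \<times> 'l padic_int \<Rightarrow> bool"
  where "loc_rel = (\<lambda>(x, a) (y, b). a \<noteq> 0 \<and> b \<noteq> 0 \<and>
    (\<exists>c. c \<noteq> 0 \<and> cscale (c * b) x = cscale (c * a) y))"

lemma loc_relI:
  "a \<noteq> 0 \<Longrightarrow> b \<noteq> 0 \<Longrightarrow> c \<noteq> 0 \<Longrightarrow> cscale (c * b) x = cscale (c * a) y \<Longrightarrow> loc_rel (x, a) (y, b)"
  by (auto simp: loc_rel_def)

lemma loc_rel_refl_iff: "loc_rel p p \<longleftrightarrow> snd p \<noteq> 0"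
  by (auto simp: loc_rel_def split: prod.splits intro!: exI[of _ 1])

lemma part_equivp_loc_rel: "part_equivp loc_rel"
proof (rule part_equivpI)
  show "\<exists>x. loc_rel x x"
    by (rule exI[of _ "(0, 1)"]) (simp add: loc_rel_refl_iff)
  show "symp loc_rel"
    by (auto simp: symp_def loc_rel_def dest: sym)
  show "transp loc_rel"
  proof (rule transpI, clarify)
    fix x y z :: "('k::field, 'l::prime_card) mult_completion" and a b d :: "'l padic_int"
    assume "loc_rel (x, a) (y, b)" "loc_rel (y, b) (z, d)"
    then obtain c e where *: "a \<noteq> 0" "b \<noteq> 0" "d \<noteq> 0" "c \<noteq> 0" "e \<noteq> 0"
        "cscale (c * b) x = cscale (c * a) y" "cscale (e * d) y = cscale (e * b) z"
      by (auto simp: loc_rel_def)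
    have "cscale (c * e * b * d) x = cscale (e * d) (cscale (c * b) x)"
      by (simp add: mult_ac)
    also have "\<dots> = cscale (c * a) (cscale (e * d) y)"
      unfolding *(6) by (simp add: mult_ac)
    also have "\<dots> = cscale (c * e * b * a) z"
      unfolding *(7) by (simp add: mult_ac)
    finally show "loc_rel (x, a) (z, d)"
      using * by (intro loc_relI[of _ _ "c * e * b"]) auto
  qed
qed

quotient_type (overloaded) ('k, 'l) mult_completion_Q =
  "('k::field, 'l::prime_card) mult_completion \<times> 'l padic_int" / partial: loc_rel
  by (rule part_equivp_loc_rel)

instantiation mult_completion_Q :: (field, prime_card) ab_group_add
begin

lift_definition zero_mult_completion_Q :: "('a, 'b) mult_completion_Q" is "(0, 1)"
  by (simp add: loc_rel_refl_iff)

lift_definition plus_mult_completion_Q ::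
  "('a, 'b) mult_completion_Q \<Rightarrow> ('a, 'b) mult_completion_Q \<Rightarrow> ('a, 'b) mult_completion_Q"
  is "\<lambda>(x, a) (y, b). (cscale b x + cscale a y, a * b)"
proof clarify
  fix x x' y y' :: "('a, 'b) mult_completion" and a a' b b' :: "'b padic_int"
  assume "loc_rel (x, a) (x', a')" "loc_rel (y, b) (y', b')"
  then obtain c d where *: "a \<noteq> 0" "b \<noteq> 0" "a' \<noteq> 0" "b' \<noteq> 0" "c \<noteq> 0" "d \<noteq> 0"
      "cscale (c * a') x = cscale (c * a) x'" "cscale (d * b') y = cscale (d * b) y'"
    by (auto simp: loc_rel_def)
  have "cscale (c * d * (a' * b')) (cscale b x + cscale a y)
      = cscale (d * b * b') (cscale (c * a') x) + cscale (c * a * a') (cscale (d * b') y)"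
    by (simp add: cscale.scale_right_distrib mult_ac)
  also have "\<dots> = cscale (c * d * (a * b)) (cscale b' x' + cscale a' y')"
    unfolding *(7,8) by (simp add: cscale.scale_right_distrib mult_ac)
  finally show "loc_rel (cscale b x + cscale a y, a * b) (cscale b' x' + cscale a' y', a' * b')"
    using * by (intro loc_relI[of _ _ "c * d"]) auto
qed

lift_definition uminus_mult_completion_Q ::
  "('a, 'b) mult_completion_Q \<Rightarrow> ('a, 'b) mult_completion_Q"
  is "\<lambda>(x, a). (- x, a)"
  by (auto simp: loc_rel_def)

definition minus_mult_completion_Q ::
  "('a, 'b) mult_completion_Q \<Rightarrow> ('a, 'b) mult_completion_Q \<Rightarrow> ('a, 'b) mult_completion_Q"
  where "minus_mult_completion_Q x y = x + - y"

instance
proof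
  fix x y z :: "('a, 'b) mult_completion_Q"
  note [simp] = cscale.scale_right_distrib mult_ac add_ac
  show "x + y + z = x + (y + z)"
    by transfer (auto simp: loc_rel_refl_iff intro!: loc_relI[of _ _ 1])
  show "x + y = y + x"
    by transfer (auto simp: loc_rel_refl_iff intro!: loc_relI[of _ _ 1])
  show "0 + x = x"
    by transfer (auto simp: loc_rel_refl_iff intro!: loc_relI[of _ _ 1])
  show "- x + x = 0"
    by transfer (auto simp: loc_rel_refl_iff intro!: loc_relI[of _ _ 1])
  show "x - y = x + - y"
    by (simp add: minus_mult_completion_Q_def)
qed

end

lift_definition frac_scale ::
  "'l padic_int \<Rightarrow> 'l padic_int \<Rightarrow>
    ('k::field, 'l::prime_card) mult_completion_Q \<Rightarrow> ('k, 'l) mult_completion_Q"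
  is "\<lambda>a b (x, c). if b = 0 then (0, 1) else (cscale a x, b * c)"
proof (clarsimp simp: loc_rel_refl_iff)
  fix x x' :: "('k, 'l) mult_completion" and a b c c' :: "'l padic_int"
  assume "b \<noteq> 0" "loc_rel (x, c) (x', c')"
  then obtain d where *: "b \<noteq> 0" "c \<noteq> 0" "c' \<noteq> 0" "d \<noteq> 0"
      "cscale (d * c') x = cscale (d * c) x'"
    by (auto simp: loc_rel_def)
  have "cscale (d * (b * c')) (cscale a x) = cscale (a * b) (cscale (d * c') x)"
    by (simp add: mult_ac)
  also have "\<dots> = cscale (d * (b * c)) (cscale a x')"
    unfolding *(5) by (simp add: mult_ac)
  finally show "loc_rel (cscale a x, b * c) (cscale a x', b * c')"
    using * by (intro loc_relI[of _ _ d]) auto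
qed

definition qscale ::
  "'l padic \<Rightarrow> ('k::field, 'l::prime_card) mult_completion_Q \<Rightarrow> ('k, 'l) mult_completion_Q"
  where "qscale q y = (case SOME (a, b). b \<noteq> 0 \<and> q = Fract a b of (a, b) \<Rightarrow> frac_scale a b y)"

lemma frac_scale_cong:
  fixes y :: "('k::field, 'l::prime_card) mult_completion_Q"
  assumes "b \<noteq> 0" "b' \<noteq> 0" "a * b' = a' * b"
  shows "frac_scale a b y = frac_scale a' b' y"
  using assms
proof (transfer, clarsimp simp: loc_rel_refl_iff)
  fix x :: "('k, 'l) mult_completion" and c a b a' b' :: "'l padic_int"
  assume *: "b \<noteq> 0" "b' \<noteq> 0" "a * b' = a' * b" "c \<noteq> 0"
  have "cscale (1 * (b' * c)) (cscale a x) = cscale ((a * b') * c) x" by (simp add: mult_ac)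
  also have "\<dots> = cscale (1 * (b * c)) (cscale a' x)" unfolding *(3) by (simp add: mult_ac)
  finally show "loc_rel (cscale a x, b * c) (cscale a' x, b' * c)"
    using * by (intro loc_relI[of _ _ 1]) auto
qed

lemma qscale_Fract:
  assumes "b \<noteq> 0"
  shows "qscale (Fract a b) y = frac_scale a b y"
proof -
  obtain a' b' where eq: "(SOME (a', b'). b' \<noteq> 0 \<and> Fract a b = Fract a' b') = (a', b')"
    by (meson surj_pair)
  have "case SOME (a', b'). b' \<noteq> 0 \<and> Fract a b = Fract a' b' of
      (a', b') \<Rightarrow> b' \<noteq> 0 \<and> Fract a b = Fract a' b'"
    by (rule someI[of _ "(a, b)"]) (use assms in auto)
  hence "b' \<noteq> 0" "Fract a b = Fract a' b'" unfolding eq by auto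
  hence "frac_scale a b y = frac_scale a' b' y"
    using assms by (intro frac_scale_cong) (auto simp: eq_fract)
  thus ?thesis by (simp add: qscale_def eq)
qed

lemma module_qscale: "Modules.module
  (qscale :: 'l padic \<Rightarrow> ('k::field, 'l::prime_card) mult_completion_Q \<Rightarrow> _)"
proof
  fix q r :: "'l padic" and x y :: "('k, 'l) mult_completion_Q"
  note [simp] = cscale.scale_right_distrib cscale.scale_left_distrib mult_ac add_ac
  obtain a b where q: "b \<noteq> 0" "q = Fract a b" by (cases q) auto
  obtain c d where r: "d \<noteq> 0" "r = Fract c d" by (cases r) auto
  have 1: "frac_scale a b (x + y) = frac_scale a b x + frac_scale a b y"
    using q(1) by transfer (auto simp: loc_rel_refl_iff intro!: loc_relI[of _ _ 1])
  have 2: "frac_scale (a * d + c * b) (b * d) x = frac_scale a b x + frac_scale c d x"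
    using q(1) r(1) by transfer (auto simp: loc_rel_refl_iff intro!: loc_relI[of _ _ 1])
  have 3: "frac_scale a b (frac_scale c d x) = frac_scale (a * c) (b * d) x"
    using q(1) r(1) by transfer (auto simp: loc_rel_refl_iff intro!: loc_relI[of _ _ 1])
  have 4: "frac_scale 1 1 x = x"
    by transfer (auto simp: loc_rel_refl_iff intro!: loc_relI[of _ _ 1])
  note [simp del] = mult_ac add_ac
  show "qscale q (x + y) = qscale q x + qscale q y"
    using 1 q by (simp add: qscale_Fract)
  show "qscale (q + r) x = qscale q x + qscale r x"
    using 2 q r by (simp add: qscale_Fract)
  show "qscale q (qscale r x) = qscale (q * r) x"
    using 3 q r by (simp add: qscale_Fract)
  show "qscale 1 x = x"
    using 4 by (simp add: One_fract_def qscale_Fract)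
qed

lift_definition to_Q ::
  "('k::field, 'l::prime_card) mult_completion \<Rightarrow> ('k, 'l) mult_completion_Q" is "\<lambda>x. (x, 1)"
  by (simp add: loc_rel_refl_iff)

section \<open>Matrices with entries in a module\<close>

definition vmap :: "('a \<Rightarrow> 'b) \<Rightarrow> 'a ^ 'n \<Rightarrow> 'b ^ 'n"
  where "vmap f v = (\<chi> i. f (v $ i))"

definition mmap :: "('a \<Rightarrow> 'b) \<Rightarrow> 'a ^ 'n ^ 'm \<Rightarrow> 'b ^ 'n ^ 'm"
  where "mmap f A = (\<chi> i j. f (A $ i $ j))"

text \<open>
  The products \<open>\<odot>\<close>, where \<open>s\<close> is the scalar multiplication of the module. As modules are written
  additively, the products of powers in the multiplicative notation become sums.
\<close>

definition vec_mat :: "('r \<Rightarrow> 'm \<Rightarrow> 'm::comm_monoid_add) \<Rightarrow> 'm ^ 'n \<Rightarrow> 'r ^ 'o ^ 'n \<Rightarrow> 'm ^ 'o"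
  where "vec_mat s x M = (\<chi> j. \<Sum>k\<in>UNIV. s (M $ k $ j) (x $ k))"

definition mat_rmult ::
  "('r \<Rightarrow> 'm \<Rightarrow> 'm::comm_monoid_add) \<Rightarrow> 'm ^ 'n ^ 'q \<Rightarrow> 'r ^ 'o ^ 'n \<Rightarrow> 'm ^ 'o ^ 'q"
  where "mat_rmult s U M = (\<chi> i j. \<Sum>k\<in>UNIV. s (M $ k $ j) (U $ i $ k))"

definition mat_lmult ::
  "('r \<Rightarrow> 'm \<Rightarrow> 'm::comm_monoid_add) \<Rightarrow> 'r ^ 'n ^ 'q \<Rightarrow> 'm ^ 'o ^ 'n \<Rightarrow> 'm ^ 'o ^ 'q"
  where "mat_lmult s N U = (\<chi> i j. \<Sum>k\<in>UNIV. s (N $ i $ k) (U $ k $ j))"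

section \<open>Lattices and period matrices\<close>

definition row_prod :: "'k::field ^ 'g ^ 'r \<Rightarrow> ('r \<Rightarrow> int) \<Rightarrow> 'k ^ 'g"
  where "row_prod Q n = (\<chi> j. \<Prod>i\<in>UNIV. (Q $ i $ j) powi n i)"

definition is_lattice :: "('k::field \<Rightarrow> rat) \<Rightarrow> ('k ^ 'g) set \<Rightarrow> bool"
  where "is_lattice \<nu> \<Lambda> \<longleftrightarrow> (\<exists>Q :: 'k ^ 'g ^ 'g. (\<forall>i j. Q $ i $ j \<noteq> 0 \<and> \<nu> (Q $ i $ j) > 1) \<and>
    invertible (mmap \<nu> Q) \<and> \<Lambda> = range (row_prod Q))"

text \<open>Bijectivity says that the rows form a basis of the free abelian group \<open>\<Lambda>\<close>.\<close>

definition is_period_matrix :: "('k::field ^ 'g) set \<Rightarrow> 'k ^ 'g ^ 'g \<Rightarrow> bool"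
  where "is_period_matrix \<Lambda> Q \<longleftrightarrow> (\<forall>i j. Q $ i $ j \<noteq> 0) \<and> bij_betw (row_prod Q) UNIV \<Lambda>"

text \<open>
  The \<open>l\<close>-adic completion of a lattice inside that of the ambient torus: the module over the
  \<open>l\<close>-adic integers generated by the image of the lattice under \<open>\<gamma>\<close>. The bare image is only a
  finitely generated abelian group, not a module over the \<open>l\<close>-adic integers.
\<close>

definition completed_lattice ::
  "('k::field ^ 'g) set \<Rightarrow> (('k, 'l::prime_card) mult_completion ^ 'g) set"
  where "completed_lattice \<Lambda> = module.span (\<lambda>a. vmap (cscale a)) (vmap compl_map ` \<Lambda>)"

text \<open>The matrix \<open>ord(Q)\<^sup>-\<^sup>1 \<odot> \<gamma>(Q)\<close>, whose entries need rational scalars.\<close>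

definition normalized_period ::
  "('k::field \<Rightarrow> rat) \<Rightarrow> 'k ^ 'g ^ 'g \<Rightarrow> ('k, 'l::prime_card) mult_completion_Q ^ 'g ^ 'g"
  where "normalized_period \<nu> Q =
    mat_lmult qscale (mmap of_rat (matrix_inv (mmap \<nu> Q))) (mmap (\<lambda>q. to_Q (compl_map q)) Q)"

section \<open>Tate modules\<close>

definition torus :: "('f::field ^ 'g) monoid"
  where "torus = \<lparr>carrier = {x. \<forall>i. x $ i \<noteq> 0}, monoid.mult = (*), one = 1\<rparr>"

text \<open>
  An abeloid variety enters only through the Galois module of its points over the algebraic
  closure, which is the quotient of the torus by the lattice.
\<close>

definition abeloid_points :: "('k::field ^ 'g) set \<Rightarrow> ('k alg_closure ^ 'g) set monoid"
  where "abeloid_points \<Lambda> = torus Mod (vmap to_ac ` \<Lambda>)"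

text \<open>
  Records for modules extend those for rings; their multiplication and unit are irrelevant.
  The transition maps of the Tate module are multiplication by \<open>l\<close>, and \<open>residue a n\<close> gives the
  action of \<open>a\<close> on the \<open>l ^ n\<close>-torsion.
\<close>

definition tate_module ::
  "('k::field ^ 'g) set \<Rightarrow> ('l::prime_card padic_int, nat \<Rightarrow> ('k alg_closure ^ 'g) set) module"
  where "tate_module \<Lambda> = (let A = abeloid_points \<Lambda> in
   \<lparr>carrier = {x. \<forall>n. x n \<in> carrier A \<and> x n [^]\<^bsub>A\<^esub> (CARD('l) ^ n) = \<one>\<^bsub>A\<^esub>
       \<and> x (Suc n) [^]\<^bsub>A\<^esub> CARD('l) = x n},
    monoid.mult = undefined, one = undefined,
    zero = (\<lambda>n. \<one>\<^bsub>A\<^esub>),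
    add = (\<lambda>x y n. x n \<otimes>\<^bsub>A\<^esub> y n),
    smult = (\<lambda>a x n. x n [^]\<^bsub>A\<^esub> nat (residue a n))\<rparr>)"

definition galois_act :: "('k::field alg_closure \<Rightarrow> 'k alg_closure) \<Rightarrow>
    (nat \<Rightarrow> ('k alg_closure ^ 'g) set) \<Rightarrow> (nat \<Rightarrow> ('k alg_closure ^ 'g) set)"
  where "galois_act \<sigma> x = (\<lambda>n. vmap \<sigma> ` x n)"

definition hom_galois :: "('k::field ^ 'g) set \<Rightarrow> ('k ^ 'h) set \<Rightarrow>
    ('l::prime_card padic_int,
     (nat \<Rightarrow> ('k alg_closure ^ 'g) set) \<Rightarrow> (nat \<Rightarrow> ('k alg_closure ^ 'h) set)) module"
  where "hom_galois \<Lambda>\<^sub>A \<Lambda>\<^sub>B = (let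
     T = (tate_module \<Lambda>\<^sub>A :: ('l padic_int, _) module);
     T' = (tate_module \<Lambda>\<^sub>B :: ('l padic_int, _) module) in
   \<lparr>carrier = {f \<in> carrier T \<rightarrow>\<^sub>E carrier T'.
       (\<forall>x\<in>carrier T. \<forall>y\<in>carrier T. f (x \<oplus>\<^bsub>T\<^esub> y) = f x \<oplus>\<^bsub>T'\<^esub> f y) \<and>
       (\<forall>a. \<forall>x\<in>carrier T. f (a \<odot>\<^bsub>T\<^esub> x) = a \<odot>\<^bsub>T'\<^esub> f x) \<and>
       (\<forall>\<sigma>\<in>absolute_galois. \<forall>x\<in>carrier T. f (galois_act \<sigma> x) = galois_act \<sigma> (f x))},
    monoid.mult = undefined, one = undefined,
    zero = (\<lambda>x\<in>carrier T. \<zero>\<^bsub>T'\<^esub>),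
    add = (\<lambda>f f'. \<lambda>x\<in>carrier T. f x \<oplus>\<^bsub>T'\<^esub> f' x),
    smult = (\<lambda>a f. \<lambda>x\<in>carrier T. a \<odot>\<^bsub>T'\<^esub> f x)\<rparr>)"

definition matrix_module :: "('r::comm_ring_1 ^ 'h ^ 'g) set \<Rightarrow> ('r, 'r ^ 'h ^ 'g) module"
  where "matrix_module S =
   \<lparr>carrier = S, monoid.mult = undefined, one = undefined, zero = 0, add = (+),
    smult = (\<lambda>a. mmap ((*) a))\<rparr>"

definition module_iso :: "('r, 'm) module \<Rightarrow> ('r::comm_ring_1, 'n) module \<Rightarrow> bool"  (infix \<open>\<cong>\<^sub>M\<close> 50)
  where "M \<cong>\<^sub>M N \<longleftrightarrow> Module.module (ring_of_type_algebra :: 'r ring) M \<and>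
    Module.module (ring_of_type_algebra :: 'r ring) N \<and>
    (\<exists>f. bij_betw f (carrier M) (carrier N) \<and>
      (\<forall>x\<in>carrier M. \<forall>y\<in>carrier M. f (x \<oplus>\<^bsub>M\<^esub> y) = f x \<oplus>\<^bsub>N\<^esub> f y) \<and>
      (\<forall>a. \<forall>x\<in>carrier M. f (a \<odot>\<^bsub>M\<^esub> x) = a \<odot>\<^bsub>N\<^esub> f x))"

end

theory Submission
  imports Defs
begin

hide_const (open) up_ring.coeff up_ring.monom Polynomials.degree Polynomials.lead_coeff Coset.order

text \<open>
  Choose a compatible system \<open>\<zeta>\<close> of primitive roots of unity and compatible systems of roots of the
  entries of the period matrices. They yield a basis of \<open>T\<^sub>l(A)\<close>, in which an automorphism acts by the
  cyclotomic character \<open>\<chi>\<close> on the Tate module of the torus, trivially on the quotient, and by the matrix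
  \<open>\<kappa>\<close> of Kummer cocycles in between. As a p-adic field contains only finitely many roots of unity of
  \<open>l\<close>-power order, \<open>\<chi> \<noteq> 1\<close>; hence an equivariant homomorphism is block triangular with diagonal blocks
  \<open>M\<close> and \<open>N\<close> and one more block \<open>R\<close>, and equivariance reads \<open>\<kappa>\<^sub>A M - N \<kappa>\<^sub>B = (\<chi> - 1) R\<close>. By Kummer theory, some
  \<open>R\<close> exists iff \<open>\<gamma>(Q\<^sub>A) M = N \<gamma>(Q\<^sub>B)\<close>. Taking valuations gives \<open>ord(Q\<^sub>A) M = N ord(Q\<^sub>B)\<close>, so that
  \<open>N\<close> (and then \<open>R\<close>) is determined by \<open>M\<close>.

  Substituting \<open>N = ord(Q\<^sub>A) M ord(Q\<^sub>B)\<^sup>-\<^sup>1\<close> shows that the second module of matrices is contained in the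
  third. The inclusion can be strict, since the third forgets torsion and denominators, but every
  element of the third has a nonzero multiple in the second. Over a discrete valuation ring, two such
  submodules of a free module of finite rank are isomorphic, by comparing echelon bases.
\<close>

section \<open>Extending automorphisms to the algebraic closure\<close>

text \<open>Galois theory enters through one existence statement: every element outside the base
  field is moved by some automorphism. No topology on the Galois group is used. In Kummer theory the
  solutions \<open>R\<close> modulo the powers of \<open>l\<close> need not form a compatible
  sequence, because the values of \<open>\<chi> - 1\<close> may be zero divisors modulo
  \<open>l ^ n\<close>. A single automorphism \<open>\<tau>\<close> with
  \<open>\<chi> \<tau> \<noteq> 1\<close> replaces a compactness argument, since its equation can be
  solved for \<open>R\<close> by division; it also gives the triangular shape and the uniqueness of
  \<open>R\<close>. Finiteness of the extension is used only in the form that any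
  \<open>d + 1\<close> elements are linearly dependent. This yields a common denominator of all
  valuations, needed because a rational valuation need not make sense as an \<open>l\<close>-adic
  integer. It also yields nonzero polynomials of degree at most \<open>d\<close> modulo the maximal
  ideal, which bound the roots of unity without forming a residue field.\<close>

text \<open>
  Graphs of homomorphisms over the base field from a subring of the algebraic closure to the closure.
  By algebraicity such a subring is a field, so the graphs need not be closed under inverses.
\<close>

definition partial_hom :: "('k::field alg_closure \<times> 'k alg_closure) set \<Rightarrow> bool"
  where "partial_hom G \<longleftrightarrow> (\<forall>c. (to_ac c, to_ac c) \<in> G) \<and>
    (\<forall>a b c d. (a, b) \<in> G \<longrightarrow> (c, d) \<in> G \<longrightarrow> (a + c, b + d) \<in> G \<and> (a * c, b * d) \<in> G) \<and>
    (\<forall>b. (0, b) \<in> G \<longrightarrow> b = 0)"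

definition poly_rel :: "('a \<times> 'b) set \<Rightarrow> 'a::zero poly \<Rightarrow> 'b::zero poly \<Rightarrow> bool"
  where "poly_rel G p q \<longleftrightarrow> (\<forall>i. (coeff p i, coeff q i) \<in> G)"

text \<open>The candidate graph of the extension that sends \<alpha> to \<beta>. It is single-valued
  only if every relation satisfied by \<alpha> is carried to one satisfied by \<beta>.\<close>

definition adjoin :: "('a::comm_semiring_0 \<times> 'b::comm_semiring_0) set \<Rightarrow> 'a \<Rightarrow> 'b \<Rightarrow> ('a \<times> 'b) set"
  where "adjoin G \<alpha> \<beta> = {(poly p \<alpha>, poly q \<beta>) | p q. poly_rel G p q}"

lemma poly_rel_pCons: "poly_rel G (pCons a p) (pCons b q) \<longleftrightarrow> (a, b) \<in> G \<and> poly_rel G p q"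
  by (auto simp: poly_rel_def coeff_pCons split: nat.splits)

context
  fixes G :: "('k::field alg_closure \<times> 'k alg_closure) set"
  assumes G: "partial_hom G"
begin

lemma partial_hom_const: "(to_ac k, to_ac k) \<in> G"
  and partial_hom_add: "(a, b) \<in> G \<Longrightarrow> (c, d) \<in> G \<Longrightarrow> (a + c, b + d) \<in> G"
  and partial_hom_mult: "(a, b) \<in> G \<Longrightarrow> (c, d) \<in> G \<Longrightarrow> (a * c, b * d) \<in> G"
  and partial_hom_zero: "(0, b) \<in> G \<Longrightarrow> b = 0"
  using G by (auto simp: partial_hom_def)

lemma partial_hom_0: "(0, 0) \<in> G" and partial_hom_1: "(1, 1) \<in> G"
  using partial_hom_const[of 0] partial_hom_const[of 1] by simp_all

lemma partial_hom_diff: "(a, b) \<in> G \<Longrightarrow> (c, d) \<in> G \<Longrightarrow> (a - c, b - d) \<in> G"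
  using partial_hom_add[of a b "-1 * c" "-1 * d"] partial_hom_mult[of "-1" "-1" c d]
    partial_hom_const[of "-1"] by simp

lemma partial_hom_fun: "(a, b) \<in> G \<Longrightarrow> (a, b') \<in> G \<Longrightarrow> b = b'"
  using partial_hom_diff[of a b a b'] partial_hom_zero[of "b - b'"] by simp

lemma partial_hom_sum:
  "(\<And>i. i \<in> I \<Longrightarrow> (f i, g i) \<in> G) \<Longrightarrow> (sum f I, sum g I) \<in> G"
  by (induction I rule: infinite_finite_induct) (auto intro: partial_hom_0 partial_hom_add)

lemma partial_hom_poly:
  "poly_rel G p q \<Longrightarrow> (a, b) \<in> G \<Longrightarrow> (poly p a, poly q b) \<in> G"
  by (induction p q rule: poly_induct2)
     (auto simp: poly_rel_pCons intro: partial_hom_0 partial_hom_add partial_hom_mult)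

lemma poly_rel_const: "poly_rel G (map_poly to_ac p) (map_poly to_ac p)"
  by (simp add: poly_rel_def coeff_map_poly partial_hom_const)

text \<open>Cancelling powers of the variable from a polynomial that annihilates \<open>a\<close>
  leaves one with constant term \<open>c \<noteq> 0\<close>. It expresses \<open>inverse a\<close>
  as a polynomial in \<open>a\<close> over the base field, so the inverse already lies in the
  domain.\<close>

lemma partial_hom_inverse:
  assumes ab: "(a, b) \<in> G" and "a \<noteq> 0"
  shows "(inverse a, inverse b) \<in> G"
proof -
  obtain p :: "'k poly" where p: "p \<noteq> 0" "poly (map_poly to_ac p) a = 0"
    using alg_closure_algebraic by blast
  have map0: "map_poly to_ac (r * s) = map_poly to_ac r * map_poly to_ac (s :: 'k poly)" for r s
    by (rule poly_eqI) (simp add: coeff_map_poly coeff_mult to_ac_sum)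
  obtain r s where s: "p = [:0, 1:] ^ order 0 p * s" "\<not> [:0, 1:] dvd s"
    using order_decomp[OF p(1), of 0] by auto
  have "map_poly to_ac ([:0, 1:] ^ n :: 'k poly) = [:0, 1:] ^ n" for n
    by (induction n) (simp_all add: map0 map_poly_pCons)
  hence pow: "poly (map_poly to_ac ([:0, 1:] ^ n)) a = a ^ n" for n by (simp add: poly_power)
  hence "poly (map_poly to_ac s) a = 0"
    using p(2) \<open>a \<noteq> 0\<close> by (subst (asm) s(1)) (simp add: map0 pow)
  moreover obtain c r where cr: "s = pCons c r" by (cases s)
  moreover from s(2) cr have "c \<noteq> 0"
    using poly_eq_0_iff_dvd[of s 0] by simp
  ultimately have "to_ac c + a * poly (map_poly to_ac r) a = 0"
    by (simp add: map_poly_pCons)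
  hence ca: "a * poly (map_poly to_ac r) a = - to_ac c" by (simp add: eq_neg_iff_add_eq_0 add.commute)
  define d where "d = to_ac (- inverse c) * poly (map_poly to_ac r) b"
  have "(to_ac (- inverse c) * poly (map_poly to_ac r) a, d) \<in> G"
    unfolding d_def using ab by (intro partial_hom_mult partial_hom_const partial_hom_poly poly_rel_const)
  moreover have "to_ac (- inverse c) * poly (map_poly to_ac r) a = inverse a"
    using ca \<open>a \<noteq> 0\<close> \<open>c \<noteq> 0\<close> by (simp add: field_simps)
  ultimately have d: "(inverse a, d) \<in> G" by simp
  from partial_hom_mult[OF ab this] \<open>a \<noteq> 0\<close> have "(1, b * d) \<in> G" by simp
  with partial_hom_1 have "b * d = 1" using partial_hom_fun by blast
  with d show ?thesis by (metis inverse_unique)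
qed

lemma partial_hom_eq_0_iff: "(a, b) \<in> G \<Longrightarrow> a = 0 \<longleftrightarrow> b = 0"
proof
  assume ab: "(a, b) \<in> G" and "b = 0"
  show "a = 0"
  proof (rule ccontr)
    assume "a \<noteq> 0"
    from partial_hom_mult[OF ab partial_hom_inverse[OF ab this]] this \<open>b = 0\<close>
    have "(1, 0) \<in> G" by simp
    with partial_hom_1 partial_hom_fun show False by (metis zero_neq_one)
  qed
qed (use partial_hom_zero in blast)

lemma poly_rel_degree:
  assumes "poly_rel G p q"
  shows "degree p = degree q"
proof -
  have "coeff p i = 0 \<longleftrightarrow> coeff q i = 0" for i
    using assms partial_hom_eq_0_iff by (simp add: poly_rel_def)
  thus ?thesis by (intro antisym degree_le allI impI) (metis coeff_eq_0)+
qed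

lemma poly_rel_diff: "poly_rel G p q \<Longrightarrow> poly_rel G p' q' \<Longrightarrow> poly_rel G (p - p') (q - q')"
  by (simp add: poly_rel_def partial_hom_diff)

lemma poly_rel_mult: "poly_rel G p q \<Longrightarrow> poly_rel G p' q' \<Longrightarrow> poly_rel G (p * p') (q * q')"
  by (auto simp: poly_rel_def coeff_mult intro!: partial_hom_sum partial_hom_mult)

lemma poly_rel_monom: "(a, b) \<in> G \<Longrightarrow> poly_rel G (monom a k) (monom b k)"
  by (simp add: poly_rel_def partial_hom_0)

text \<open>
  The polynomial \<open>m\<close> is the minimal polynomial of \<open>\<alpha>\<close> over the domain of \<open>G\<close>, and \<open>m'\<close> is its image.
\<close>

lemma partial_hom_adjoin:
  assumes m: "poly_rel G m m'" "m \<noteq> 0" "poly m' \<beta> = 0"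
    and min: "\<And>p q. poly_rel G p q \<Longrightarrow> p \<noteq> 0 \<Longrightarrow> poly p \<alpha> = 0 \<Longrightarrow> degree m \<le> degree p"
    and root: "poly m \<alpha> = 0"
  shows "partial_hom (adjoin G \<alpha> \<beta>)"
proof -
  \<comment> \<open>Division with remainder by \<open>m\<close>, one leading term at a time, is
    mirrored by division by \<open>m'\<close> on the image side. Minimality of \<open>m\<close>
    ensures that every nonzero relation has large enough degree for another step.\<close>
  have zero: "poly p \<alpha> = 0 \<Longrightarrow> poly q \<beta> = 0" if "poly_rel G p q" for p q
    using that
  proof (induction "degree p" arbitrary: p q rule: less_induct)
    case less
    show ?case
    proof (cases "p = 0")
      case True
      with less.prems have "q = 0"
        by (intro poly_eqI) (auto simp: poly_rel_def intro: partial_hom_zero)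
      thus ?thesis by simp
    next
      case False
      define k where "k = degree p - degree m"
      have deg: "degree m \<le> degree p" using min[OF less.prems(2) False less.prems(1)] .
      define c where "c = lead_coeff p / lead_coeff m"
      define c' where "c' = coeff q (degree p) / coeff m' (degree m)"
      have cc: "(c, c') \<in> G"
        using less.prems(2) m unfolding c_def c'_def divide_inverse
        by (intro partial_hom_mult partial_hom_inverse) (auto simp: poly_rel_def)
      define p2 where "p2 = p - monom c k * m"
      define q2 where "q2 = q - monom c' k * m'"
      have rel: "poly_rel G p2 q2" unfolding p2_def q2_def
        by (intro poly_rel_diff poly_rel_mult poly_rel_monom less.prems m cc)
      have p20: "poly p2 \<alpha> = 0" using less.prems root by (simp add: p2_def)
      have "poly q2 \<beta> = 0"
      proof (cases "p2 = 0")
        case True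
        with rel have "q2 = 0"
          by (intro poly_eqI) (auto simp: poly_rel_def intro: partial_hom_zero)
        thus ?thesis by simp
      next
        case p2: False
        have "c \<noteq> 0" using False m by (simp add: c_def)
        hence "degree (monom c k * m) = degree p"
          using m deg by (simp add: degree_mult_eq degree_monom_eq k_def monom_eq_0_iff)
        moreover have "coeff (monom c k * m) (degree p) = lead_coeff p"
          using deg m by (simp add: coeff_monom_mult k_def c_def)
        ultimately have "degree p2 \<le> degree p" "coeff p2 (degree p) = 0"
          unfolding p2_def by (auto intro: degree_diff_le)
        hence "degree p2 < degree p"
          using p2 by (metis eq_zero_or_degree_less)
        thus ?thesis using less.hyps p20 rel by blast
      qed
      thus ?thesis using m by (simp add: q2_def)
    qed
  qed
  show ?thesis
    unfolding partial_hom_def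
  proof (intro conjI allI impI)
    show "(to_ac c, to_ac c) \<in> adjoin G \<alpha> \<beta>" for c
      unfolding adjoin_def
      by (intro CollectI exI[of _ "monom (to_ac c) 0"] conjI poly_rel_monom partial_hom_const)
         (simp add: poly_monom)
  next
    fix a b c d assume "(a, b) \<in> adjoin G \<alpha> \<beta>" "(c, d) \<in> adjoin G \<alpha> \<beta>"
    then obtain p q p' q' where *: "poly_rel G p q" "poly_rel G p' q'"
      "a = poly p \<alpha>" "b = poly q \<beta>" "c = poly p' \<alpha>" "d = poly q' \<beta>"
      by (auto simp: adjoin_def)
    from * have "poly_rel G (p + p') (q + q')" by (simp add: poly_rel_def partial_hom_add)
    with * show "(a + c, b + d) \<in> adjoin G \<alpha> \<beta>"
      unfolding adjoin_def by (metis (mono_tags, lifting) mem_Collect_eq poly_add)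
    from * have "poly_rel G (p * p') (q * q')" by (simp add: poly_rel_mult)
    with * show "(a * c, b * d) \<in> adjoin G \<alpha> \<beta>"
      unfolding adjoin_def by (metis (mono_tags, lifting) mem_Collect_eq poly_mult)
  next
    fix b assume "(0, b) \<in> adjoin G \<alpha> \<beta>"
    thus "b = 0" using zero by (auto simp: adjoin_def)
  qed
qed

lemma subset_adjoin: "G \<subseteq> adjoin G \<alpha> \<beta>"
proof clarify
  fix a b assume "(a, b) \<in> G"
  hence "poly_rel G (monom a 0) (monom b 0)" by (rule poly_rel_monom)
  thus "(a, b) \<in> adjoin G \<alpha> \<beta>" unfolding adjoin_def by (force simp: poly_monom)
qed

lemma in_adjoin: "(\<alpha>, \<beta>) \<in> adjoin G \<alpha> \<beta>"
proof -
  have "poly_rel G (monom 1 1) (monom 1 1)" by (intro poly_rel_monom partial_hom_1)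
  thus ?thesis unfolding adjoin_def by (force simp: poly_monom)
qed

lemma minimal_poly_rel:
  "\<exists>m m'. poly_rel G m m' \<and> m \<noteq> 0 \<and> poly m \<alpha> = 0 \<and>
    (\<forall>p q. poly_rel G p q \<longrightarrow> p \<noteq> 0 \<longrightarrow> poly p \<alpha> = 0 \<longrightarrow> degree m \<le> degree p)"
proof -
  define S where "S = {p. p \<noteq> 0 \<and> poly p \<alpha> = 0 \<and> (\<exists>q. poly_rel G p q)}"
  obtain p :: "'k poly" where "p \<noteq> 0" "poly (map_poly to_ac p) \<alpha> = 0"
    using alg_closure_algebraic by blast
  hence "map_poly to_ac p \<in> S"
    using poly_rel_const[of p] by (auto simp: S_def map_poly_eq_0_iff)
  then obtain m where "m \<in> S" "\<And>p. p \<in> S \<Longrightarrow> degree m \<le> degree p"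
    using arg_min_nat_lemma[of "\<lambda>p. p \<in> S" _ degree] by metis
  thus ?thesis unfolding S_def by blast
qed

end

text \<open>A maximal graph, given by Zorn's lemma, is total: any \<open>a\<close> can be adjoined
  by sending it to a root of the image of its minimal polynomial, and such a root exists because the
  closure is algebraically closed.\<close>

lemma ex_automorphism_extending:
  fixes G :: "('k::field alg_closure \<times> 'k alg_closure) set"
  assumes G: "partial_hom G"
  obtains \<sigma> where "\<sigma> \<in> absolute_galois" "\<And>a b. (a, b) \<in> G \<Longrightarrow> \<sigma> a = b"
proof -
  define S where "S = {H. partial_hom H \<and> G \<subseteq> H}"
  have "\<exists>H\<in>S. \<forall>Y\<in>S. H \<subseteq> Y \<longrightarrow> Y = H"
  proof (rule subset_Zorn_nonempty)
    show "S \<noteq> {}" using G by (auto simp: S_def)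
  next
    fix C assume C: "C \<noteq> {}" "subset.chain S C"
    have mem: "\<exists>H\<in>C. x \<in> H \<and> y \<in> H" if "x \<in> \<Union>C" "y \<in> \<Union>C" for x y
    proof -
      from that obtain H H' where "H \<in> C" "x \<in> H" "H' \<in> C" "y \<in> H'" by blast
      moreover from this C(2) have "H \<subseteq> H' \<or> H' \<subseteq> H" unfolding subset_chain_def by blast
      ultimately show ?thesis by blast
    qed
    have hom: "partial_hom H" if "H \<in> C" for H
      using that C(2) by (auto simp: subset_chain_def S_def)
    show "\<Union>C \<in> S"
      unfolding S_def partial_hom_def
    proof (intro CollectI conjI allI impI)
      show "(to_ac c, to_ac c) \<in> \<Union>C" for c
        using C(1) hom partial_hom_const by blast
      show "G \<subseteq> \<Union>C" using C by (fastforce simp: subset_chain_def S_def)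
    next
      fix a b c d assume "(a, b) \<in> \<Union>C" "(c, d) \<in> \<Union>C"
      with mem obtain H where "H \<in> C" "(a, b) \<in> H" "(c, d) \<in> H" by blast
      with hom show "(a + c, b + d) \<in> \<Union>C" "(a * c, b * d) \<in> \<Union>C"
        using partial_hom_add partial_hom_mult by blast+
    next
      fix b assume "(0, b) \<in> \<Union>C" thus "b = 0" using hom partial_hom_zero by blast
    qed
  qed
  then obtain H where "H \<in> S" and mx: "\<forall>Y\<in>S. H \<subseteq> Y \<longrightarrow> Y = H" by blast
  hence H: "partial_hom H" "G \<subseteq> H" by (auto simp: S_def)
  have max: "Y = H" if "partial_hom Y" "H \<subseteq> Y" for Y
    using mx that H by (auto simp: S_def)
  have total: "\<exists>b. (a, b) \<in> H" for a
  proof -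
    obtain m m' where m: "poly_rel H m m'" "m \<noteq> 0" "poly m a = 0"
      "\<And>p q. poly_rel H p q \<Longrightarrow> p \<noteq> 0 \<Longrightarrow> poly p a = 0 \<Longrightarrow> degree m \<le> degree p"
      using minimal_poly_rel[OF H(1), of a] by metis
    have "degree m > 0" using m(2,3) by (metis degree_eq_zeroE gr0I pCons_eq_0_iff poly_const_conv)
    hence "degree m' > 0" using poly_rel_degree[OF H(1) m(1)] by simp
    then obtain b where b: "poly m' b = 0" using alg_closed_imp_poly_has_root by blast
    hence "partial_hom (adjoin H a b)"
      by (rule partial_hom_adjoin[OF H(1) m(1,2) _ m(4,3)])
    hence "adjoin H a b = H"
      by (rule max) (rule subset_adjoin[OF H(1)])
    thus ?thesis using in_adjoin[OF H(1)] by metis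
  qed
  define \<sigma> where "\<sigma> a = (THE b. (a, b) \<in> H)" for a
  have \<sigma>: "(a, \<sigma> a) \<in> H" for a
    unfolding \<sigma>_def using total partial_hom_fun[OF H(1)] by (metis (mono_tags, lifting) theI)
  have \<sigma>_eqI: "(a, b) \<in> H \<Longrightarrow> \<sigma> a = b" for a b
    using \<sigma> partial_hom_fun[OF H(1)] by blast
  have add: "\<sigma> (x + y) = \<sigma> x + \<sigma> y" and mult: "\<sigma> (x * y) = \<sigma> x * \<sigma> y"
    and const: "\<sigma> (to_ac c) = to_ac c" for x y c
    using H(1) \<sigma> by (auto intro!: \<sigma>_eqI simp: partial_hom_add partial_hom_mult partial_hom_const)
  have inj: "inj \<sigma>"
  proof (rule injI)
    fix x y assume "\<sigma> x = \<sigma> y"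
    moreover have "\<sigma> (x - y) = \<sigma> x - \<sigma> y"
      using H(1) \<sigma> by (auto intro!: \<sigma>_eqI simp: partial_hom_diff)
    ultimately have "(x - y, 0) \<in> H" using \<sigma> by (metis diff_self)
    thus "x = y" using partial_hom_eq_0_iff[OF H(1), of "x - y" 0] by simp
  qed
  \<comment> \<open>Each \<open>y\<close> lies in the finite root set of a polynomial over the base
    field. This set is mapped into itself, and an injective self-map of a finite set is
    onto.\<close>
  have "surj \<sigma>"
  proof -
    have "y \<in> range \<sigma>" for y
    proof -
      obtain p :: "'k poly" where p: "p \<noteq> 0" "poly (map_poly to_ac p) y = 0"
        using alg_closure_algebraic by blast
      define R where "R = {x. poly (map_poly to_ac p) x = 0}"
      have "finite R" unfolding R_def
        using p by (intro poly_roots_finite) (simp add: map_poly_eq_0_iff)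
      moreover have "\<sigma> ` R \<subseteq> R"
      proof -
        have "poly (map_poly to_ac p) (\<sigma> x) = \<sigma> (poly (map_poly to_ac p) x)" for x
          by (rule sym) (intro \<sigma>_eqI partial_hom_poly poly_rel_const H \<sigma>)
        moreover have "\<sigma> 0 = 0" using const[of 0] by simp
        ultimately show ?thesis by (auto simp: R_def)
      qed
      ultimately have "\<sigma> ` R = R" using inj by (meson endo_inj_surj inj_on_subset subset_UNIV)
      moreover have "y \<in> R" using p by (simp add: R_def)
      ultimately show ?thesis by blast
    qed
    thus ?thesis by blast
  qed
  with inj add mult const have "\<sigma> \<in> absolute_galois"
    by (simp add: absolute_galois_def bij_def)
  with that H(2) \<sigma>_eqI show ?thesis by blast
qed

text \<open>In characteristic zero the minimal polynomial of \<open>x\<close> is separable, and it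
  is not linear because \<open>x\<close> is not in the base field. So it has a second root, to which
  \<open>x\<close> can be sent.\<close>

lemma absolute_galois_moves:
  fixes x :: "'k::field alg_closure"
  assumes char: "\<And>n. n > 0 \<Longrightarrow> (of_nat n :: 'k) \<noteq> 0" and x: "x \<notin> range to_ac"
  obtains \<sigma> where "\<sigma> \<in> absolute_galois" "\<sigma> x \<noteq> x"
proof -
  define G :: "('k alg_closure \<times> 'k alg_closure) set" where "G = range (\<lambda>c. (to_ac c, to_ac c))"
  have G: "partial_hom G"
    by (auto simp: partial_hom_def G_def simp flip: to_ac_add to_ac_mult)
  have rel_eq: "poly_rel G p q \<longleftrightarrow> p = q \<and> (\<forall>i. coeff p i \<in> range to_ac)" for p q
  proof -
    have "(a, b) \<in> G \<longleftrightarrow> a = b \<and> a \<in> range to_ac" for a b by (auto simp: G_def)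
    thus ?thesis by (auto simp: poly_rel_def poly_eq_iff)
  qed
  obtain m m' where m: "poly_rel G m m'" "m \<noteq> 0" "poly m x = 0"
    "\<And>p q. poly_rel G p q \<Longrightarrow> p \<noteq> 0 \<Longrightarrow> poly p x = 0 \<Longrightarrow> degree m \<le> degree p"
    using minimal_poly_rel[OF G, of x] by metis
  have m': "m' = m" using m(1) rel_eq by simp
  have coeffs: "coeff m i \<in> range to_ac" for i using m(1) rel_eq by blast
  have deg: "degree m > 0" using m(2,3) by (metis degree_eq_zeroE gr0I pCons_eq_0_iff poly_const_conv)
  \<comment> \<open>Otherwise the derivative, nonzero in characteristic zero, would be a relation of
    smaller degree than the minimal polynomial. So \<open>x\<close> is a simple root.\<close>
  have "poly (pderiv m) x \<noteq> 0"
  proof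
    assume "poly (pderiv m) x = 0"
    moreover have "poly_rel G (pderiv m) (pderiv m)"
    proof -
      have "coeff (pderiv m) i \<in> range to_ac" for i
        using coeffs[of "Suc i"] by (auto simp: coeff_pderiv simp flip: to_ac_of_nat to_ac_mult to_ac_add to_ac_1)
      thus ?thesis by (simp add: rel_eq)
    qed
    moreover have "pderiv m \<noteq> 0"
    proof -
      have "coeff (pderiv m) (degree m - 1) = of_nat (degree m) * lead_coeff m"
        using deg by (simp add: coeff_pderiv)
      moreover have "(of_nat (degree m) :: 'k alg_closure) \<noteq> 0"
        using char[OF deg] by (metis to_ac_eq_0_iff to_ac_of_nat)
      ultimately show ?thesis using m(2) by (metis coeff_0 leading_coeff_neq_0 mult_eq_0_iff)
    qed
    ultimately have "degree m \<le> degree (pderiv m)" using m(4) by blast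
    moreover have "degree (pderiv m) \<le> degree m - 1" by (intro degree_le) (auto simp: coeff_pderiv coeff_eq_0)
    ultimately show False using deg by linarith
  qed
  moreover obtain n where n: "m = [:- x, 1:] * n" using m(3) poly_eq_0_iff_dvd by (metis dvdE)
  moreover have "poly (pderiv m) x = poly n x"
    by (simp only: n pderiv_mult) (simp add: pderiv_pCons)
  ultimately have nx: "poly n x \<noteq> 0" by simp
  \<comment> \<open>If \<open>m\<close> were linear, its coefficients would place \<open>x\<close>
    in the base field.\<close>
  have "degree n > 0"
  proof (rule ccontr)
    assume "\<not> degree n > 0"
    then obtain c where c: "n = [:c:]" by (metis degree_eq_zeroE gr0I)
    have "coeff m 0 = - x * c" "coeff m 1 = c" by (simp_all add: n c)
    with coeffs[of 0] coeffs[of 1] obtain u v where uv: "- x * c = to_ac u" "c = to_ac v" by auto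
    have "c \<noteq> 0" using nx c by auto
    moreover have "x * to_ac v = - to_ac u" using uv by (metis minus_minus mult_minus_left)
    ultimately have "x = to_ac (- u / v)" using uv by (simp add: field_simps)
    with x show False by blast
  qed
  then obtain y where y: "poly n y = 0" using alg_closed_imp_poly_has_root by blast
  have "partial_hom (adjoin G x y)"
    by (rule partial_hom_adjoin[OF G m(1,2) _ m(4,3)]) (simp_all add: m' n y)
  then obtain \<sigma> where "\<sigma> \<in> absolute_galois" "\<sigma> x = y"
    using ex_automorphism_extending in_adjoin[OF G] by metis
  moreover have "y \<noteq> x" using y nx by auto
  ultimately show ?thesis using that by metis
qed

section \<open>The rings of p-adic integers\<close>

lemma residue_bounds:
  fixes a :: "'p::prime_card padic_int"
  shows "0 \<le> residue a n" "residue a n < int CARD('p) ^ n"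
  using residue[of a] by auto

lemma residue_mod_power [simp]:
  fixes a :: "'p::prime_card padic_int"
  shows "residue a n mod int CARD('p) ^ n = residue a n"
  using residue_bounds[of a n] by simp

lemma padic_int_eqI: "(\<And>n. residue a n = residue b n) \<Longrightarrow> a = b"
  by (auto simp flip: residue_inject)

lemma residue_zero [simp]: "residue 0 n = 0"
  by (simp add: zero_padic_int.rep_eq)

lemma dvd_residue_diff:
  fixes a :: "'p::prime_card padic_int"
  assumes "m \<le> n"
  shows "int CARD('p) ^ m dvd residue a n - residue a m"
  using residue_mod_le[OF assms, of a] by (metis mod_eq_dvd_iff residue_mod_power)

text \<open>The \<open>w n\<close> are arbitrary integer representatives, because quotients and
  exponents constructed below do not come out reduced.\<close>

lemma ex_padic_int:
  assumes "\<And>n. int CARD('p::prime_card) ^ n dvd w (Suc n) - w n"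
  shows "\<exists>x :: 'p padic_int. \<forall>n. residue x n = w n mod int CARD('p) ^ n"
proof (intro exI allI)
  have *: "w (Suc n) mod int CARD('p) ^ Suc n mod int CARD('p) ^ n = w n mod int CARD('p) ^ n" for n
    using assms[of n] by (simp add: mod_Suc_mod mod_eq_dvd_iff del: power_Suc)
  show "residue (Abs_padic_int (\<lambda>n. w n mod int CARD('p) ^ n) :: 'p padic_int) n
      = w n mod int CARD('p) ^ n" for n
    by (subst Abs_padic_int_inverse) (use * card_gt_1[where 'p='p] in auto)
qed

lemma residue_eq_0_antimono:
  fixes a :: "'p::prime_card padic_int"
  shows "m \<le> n \<Longrightarrow> residue a n = 0 \<Longrightarrow> residue a m = 0"
  using residue_mod_le[of m n a] by simp

text \<open>This makes \<open>padic_int_val\<close> the valuation: the set under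
  \<open>GREATEST\<close> is downward closed, contains \<open>0\<close>, and is bounded because a
  nonzero element has a nonzero residue.\<close>

lemma residue_eq_0_iff:
  fixes a :: "'p::prime_card padic_int"
  assumes "a \<noteq> 0"
  shows "residue a n = 0 \<longleftrightarrow> n \<le> padic_int_val a"
proof -
  obtain m where m: "residue a m \<noteq> 0"
    using assms padic_int_eqI[of a 0] by auto
  have bound: "n \<le> m" if "residue a n = 0" for n
    using that m residue_eq_0_antimono[of m n a] by linarith
  have "residue a 0 = 0" using residue_bounds[of a 0] by simp
  hence "residue a (padic_int_val a) = 0"
    unfolding padic_int_val_def by (rule GreatestI_nat[where b = m]) (use bound in auto)
  moreover have "n \<le> padic_int_val a" if "residue a n = 0"
    unfolding padic_int_val_def by (rule Greatest_le_nat[where b = m]) (use bound that in auto)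
  ultimately show ?thesis using residue_eq_0_antimono[of n _ a] by blast
qed

lemma prime_card_int: "Factorial_Ring.prime (int CARD('p::prime_card))"
  using prime_card[where 'a='p] by simp

text \<open>Divide the residues by the common power of the prime and invert the remaining unit.\<close>

lemma padic_int_dvdI:
  fixes a b :: "'p::prime_card padic_int"
  assumes b: "b \<noteq> 0" and a: "residue a (padic_int_val b) = 0"
  shows "b dvd a"
proof -
  define P where "P = int CARD('p)"
  define v where "v = padic_int_val b"
  have P: "P > 1" "Factorial_Ring.prime P"
    using card_gt_1[where 'p='p] prime_card_int[where 'p='p] by (simp_all add: P_def)
  \<comment> \<open>The index is \<open>Suc n + v\<close> rather than \<open>n + v\<close> so that
    even \<open>B 0\<close> sees the first nonzero digit of \<open>b\<close> and is therefore prime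
    to \<open>P\<close>.\<close>
  define A where "A n = residue a (Suc n + v) div P ^ v" for n
  define B where "B n = residue b (Suc n + v) div P ^ v" for n
  have div: "P ^ v dvd residue c n" if "residue c v = 0" "v \<le> n" for c :: "'p padic_int" and n
    using dvd_residue_diff[OF that(2), of c] that(1) by (simp add: P_def)
  have b0: "residue b v = 0" using b residue_eq_0_iff[of b v] by (simp add: v_def)
  have A: "residue a (Suc n + v) = P ^ v * A n" for n
    using div[of a "Suc n + v"] a by (simp add: A_def v_def)
  have B: "residue b (Suc n + v) = P ^ v * B n" for n
    using div[of b "Suc n + v"] b0 by (simp add: B_def)
  have cancel: "P ^ Suc n dvd i - j" if "P ^ (Suc n + v) dvd P ^ v * i - P ^ v * j" for n i j
  proof -
    have "P ^ v * P ^ Suc n dvd P ^ v * (i - j)"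
      using that by (simp only: power_add right_diff_distrib mult.commute[of "P ^ Suc n"])
    thus ?thesis using P by (simp del: power_Suc)
  qed
  have A': "P ^ Suc n dvd A (Suc n) - A n" for n
    by (rule cancel, unfold A[symmetric] B[symmetric], unfold P_def, rule dvd_residue_diff) simp
  have B': "P ^ Suc n dvd B (Suc n) - B n" for n
    by (rule cancel, unfold A[symmetric] B[symmetric], unfold P_def, rule dvd_residue_diff) simp
  have "\<not> P dvd B n" for n
  proof
    assume "P dvd B n"
    hence "P ^ Suc v dvd residue b (Suc n + v)"
      unfolding B by (simp add: mult.commute[of P])
    moreover have "P ^ Suc v dvd residue b (Suc n + v) - residue b (Suc v)"
      unfolding P_def by (rule dvd_residue_diff) simp
    ultimately have "P ^ Suc v dvd residue b (Suc v)" by (meson dvd_diffD dvd_diff_commute dvd_diff_right_iff)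
    hence "residue b (Suc v) = 0"
      using residue_bounds[of b "Suc v"] zdvd_not_zless[of "residue b (Suc v)" "P ^ Suc v"] unfolding P_def by linarith
    thus False using residue_eq_0_iff[OF b, of "Suc v"] by (simp add: v_def)
  qed
  hence cop: "coprime (P ^ k) (B n)" for k n
    using P(2) by (simp add: prime_imp_coprime)
  have "\<exists>q. P ^ Suc n dvd q * B n - A n" for n
  proof -
    obtain x y where "x * P ^ Suc n + y * B n = 1"
      using cop[of "Suc n" n] bezout_int[of "P ^ Suc n" "B n"] by (metis coprime_iff_gcd_eq_1)
    hence yB: "y * B n = 1 - x * P ^ Suc n" by linarith
    have "A n * y * B n - A n = - (A n * x) * P ^ Suc n"
      unfolding mult.assoc[of "A n"] yB by (simp add: algebra_simps)
    thus ?thesis by (metis dvd_triv_right)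
  qed
  then obtain q where q: "P ^ Suc n dvd q n * B n - A n" for n by metis
  \<comment> \<open>As \<open>B n\<close> is prime to \<open>P\<close>, the congruence determines
    the approximate quotient \<open>q n\<close> modulo \<open>P ^ Suc n\<close>. Hence successive
    ones agree and glue to an exact quotient.\<close>
  have "P ^ n dvd q (Suc n) - q n" for n
  proof -
    have q': "P ^ Suc n dvd q (Suc n) * B (Suc n) - A (Suc n)"
      using q[of "Suc n"] by (rule dvd_trans[rotated]) simp
    have "P ^ Suc n dvd (q (Suc n) * B (Suc n) - A (Suc n)) - (q n * B n - A n)
        + (A (Suc n) - A n) - q (Suc n) * (B (Suc n) - B n)"
      by (rule dvd_diff[OF dvd_add[OF dvd_diff[OF q' q] A'] dvd_mult[OF B']])
    also have "\<dots> = (q (Suc n) - q n) * B n" by (simp add: algebra_simps)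
    finally have "P ^ Suc n dvd q (Suc n) - q n"
      using cop[of "Suc n" n] by (simp add: coprime_dvd_mult_left_iff del: power_Suc)
    thus ?thesis by (rule dvd_trans[rotated]) simp
  qed
  then obtain x :: "'p padic_int" where x: "\<And>n. residue x n = q n mod P ^ n"
    using ex_padic_int[where 'p='p and w = q] unfolding P_def by blast
  have "a = b * x"
  proof (rule padic_int_eqI)
    fix n
    have "P ^ n dvd (P ^ v * (q n * B n - A n)) + (residue a (Suc n + v) - residue a n)
        - q n * (residue b (Suc n + v) - residue b n)"
      unfolding P_def
      by (rule dvd_diff[OF dvd_add[OF dvd_mult dvd_residue_diff] dvd_mult[OF dvd_residue_diff]])
         (use q[of n] in \<open>auto simp: P_def dest: dvd_mult_right\<close>)
    also have "\<dots> = residue b n * q n - residue a n"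
      by (simp only: A B) (simp add: algebra_simps)
    finally show "residue a n = residue (b * x) n"
      by (simp add: times_padic_int.rep_eq x mod_simps flip: P_def)
         (metis P_def mod_eq_dvd_iff residue_mod_power)
  qed
  thus ?thesis by simp
qed

section \<open>Valuation of a p-adic field\<close>

context padic_field
begin

section \<open>Elementary properties of the embedding and the valuation\<close>

lemma \<iota>_0 [simp]: "\<iota> 0 = 0"
  using \<iota>_add[of 0 0] add_left_cancel[of "\<iota> 0" "\<iota> 0" 0] by simp

lemma \<iota>_eq_0_iff [simp]: "\<iota> a = 0 \<longleftrightarrow> a = 0"
proof
  assume "\<iota> a = 0"
  show "a = 0"
  proof (rule ccontr)
    assume "a \<noteq> 0"
    hence "\<iota> (a * inverse a) = 1" by (simp add: \<iota>_one)
    with \<open>\<iota> a = 0\<close> show False by (simp only: \<iota>_mult mult_zero_left zero_neq_one)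
  qed
qed simp

lemma \<iota>_of_nat [simp]: "\<iota> (of_nat n) = of_nat n"
  by (induction n) (simp_all add: \<iota>_add \<iota>_one)

lemma of_nat_neq_0: "n > 0 \<Longrightarrow> (of_nat n :: 'k) \<noteq> 0"
  using \<iota>_eq_0_iff[of "of_nat n"] by simp

lemma \<nu>_1 [simp]: "\<nu> 1 = 0"
  using \<nu>_mult[of 1 1] by simp

lemma \<nu>_minus [simp]: "\<nu> (- x) = \<nu> x"
proof (cases "x = 0")
  case False
  have "\<nu> (- 1) = 0" using \<nu>_mult[of "- 1" "- 1"] by simp
  thus ?thesis using \<nu>_mult[of "- 1" x] False by simp
qed simp

lemma \<nu>_power: "x \<noteq> 0 \<Longrightarrow> \<nu> (x ^ n) = of_nat n * \<nu> x"
  by (induction n) (simp_all add: \<nu>_mult algebra_simps)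

lemma \<nu>_inverse: "x \<noteq> 0 \<Longrightarrow> \<nu> (inverse x) = - \<nu> x"
  using \<nu>_mult[of x "inverse x"] by simp

lemma \<nu>_power_int: "x \<noteq> 0 \<Longrightarrow> \<nu> (x powi n) = of_int n * \<nu> x"
  by (cases "n \<ge> 0") (simp_all add: power_int_def \<nu>_power \<nu>_inverse power_inverse)

lemma \<nu>_prod: "(\<And>i. i \<in> I \<Longrightarrow> f i \<noteq> 0) \<Longrightarrow> \<nu> (prod f I) = (\<Sum>i\<in>I. \<nu> (f i))"
  by (induction I rule: infinite_finite_induct) (simp_all add: \<nu>_mult)

lemma \<nu>_root_of_unity:
  assumes "x ^ m = 1" "m > 0"
  shows "x \<noteq> 0" "\<nu> x = 0"
proof -
  show "x \<noteq> 0" using assms by (auto simp: power_0_left)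
  with \<nu>_power[of x m] assms show "\<nu> x = 0" by simp
qed

section \<open>The valuation ring and its maximal ideal\<close>

definition int_ring :: "'k set" where "int_ring = {x. x = 0 \<or> \<nu> x \<ge> 0}"
definition max_ideal :: "'k set" where "max_ideal = {x. x = 0 \<or> \<nu> x > 0}"

text \<open>The alternatives with zero emulate an infinite value of the valuation at
  \<open>0\<close>, which is left unspecified.\<close>

lemma ultrametric:
  assumes "x = 0 \<or> r \<le> \<nu> x" "y = 0 \<or> r \<le> \<nu> y"
  shows "x + y = 0 \<or> r \<le> \<nu> (x + y)"
proof (cases "x = 0 \<or> y = 0 \<or> x + y = 0")
  case False
  thus ?thesis using \<nu>_add[of x y] assms by (auto simp: min_le_iff_disj)
qed (use assms in auto)

lemma ultrametric_strict:
  assumes "x = 0 \<or> r < \<nu> x" "y = 0 \<or> r < \<nu> y"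
  shows "x + y = 0 \<or> r < \<nu> (x + y)"
proof (cases "x = 0 \<or> y = 0 \<or> x + y = 0")
  case False
  thus ?thesis using \<nu>_add[of x y] assms by (auto simp: min_le_iff_disj)
qed (use assms in auto)

lemma ultrametric_sum_strict:
  "(\<And>i. i \<in> I \<Longrightarrow> f i = 0 \<or> r < \<nu> (f i)) \<Longrightarrow> sum f I = 0 \<or> r < \<nu> (sum f I)"
  by (induction I rule: infinite_finite_induct) (simp_all add: ultrametric_strict)

lemma int_ring_add: "x \<in> int_ring \<Longrightarrow> y \<in> int_ring \<Longrightarrow> x + y \<in> int_ring"
  using ultrametric[of x 0 y] by (auto simp: int_ring_def)

lemma int_ring_mult: "x \<in> int_ring \<Longrightarrow> y \<in> int_ring \<Longrightarrow> x * y \<in> int_ring"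
  using \<nu>_mult[of x y] by (cases "x = 0 \<or> y = 0") (auto simp: int_ring_def)

lemma int_ring_0 [simp]: "0 \<in> int_ring" and int_ring_1 [simp]: "1 \<in> int_ring"
  by (simp_all add: int_ring_def)

lemma int_ring_of_nat [simp]: "of_nat n \<in> int_ring"
  by (induction n) (simp_all add: int_ring_add)

lemma int_ring_minus [simp]: "- x \<in> int_ring \<longleftrightarrow> x \<in> int_ring"
  by (simp add: int_ring_def)

lemma int_ring_diff: "x \<in> int_ring \<Longrightarrow> y \<in> int_ring \<Longrightarrow> x - y \<in> int_ring"
  using int_ring_add[of x "- y"] by simp

lemma int_ring_power: "x \<in> int_ring \<Longrightarrow> x ^ n \<in> int_ring"
  by (induction n) (simp_all add: int_ring_mult)

lemma int_ring_poly: "(\<And>i. coeff f i \<in> int_ring) \<Longrightarrow> x \<in> int_ring \<Longrightarrow> poly f x \<in> int_ring"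
proof (induction f)
  case (pCons a f)
  have "coeff f i \<in> int_ring" for i using pCons.prems(1)[of "Suc i"] by simp
  moreover have "a \<in> int_ring" using pCons.prems(1)[of 0] by simp
  ultimately show ?case using pCons by (simp add: int_ring_add int_ring_mult)
qed simp

lemma max_ideal_0 [simp]: "0 \<in> max_ideal" and max_ideal_1 [simp]: "1 \<notin> max_ideal"
  by (simp_all add: max_ideal_def)

lemma max_ideal_add: "x \<in> max_ideal \<Longrightarrow> y \<in> max_ideal \<Longrightarrow> x + y \<in> max_ideal"
  using ultrametric_strict[of x 0 y] by (auto simp: max_ideal_def)

lemma max_ideal_minus [simp]: "- x \<in> max_ideal \<longleftrightarrow> x \<in> max_ideal"
  by (simp add: max_ideal_def)

lemma max_ideal_diff: "x \<in> max_ideal \<Longrightarrow> y \<in> max_ideal \<Longrightarrow> x - y \<in> max_ideal"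
  using max_ideal_add[of x "- y"] by simp

lemma max_ideal_sum: "(\<And>i. i \<in> I \<Longrightarrow> f i \<in> max_ideal) \<Longrightarrow> sum f I \<in> max_ideal"
  by (induction I rule: infinite_finite_induct) (simp_all add: max_ideal_add)

lemma max_ideal_mult: "x \<in> max_ideal \<Longrightarrow> y \<in> int_ring \<Longrightarrow> x * y \<in> max_ideal"
  using \<nu>_mult[of x y] by (cases "x = 0 \<or> y = 0") (auto simp: max_ideal_def int_ring_def)

lemma max_ideal_prime:
  "x * y \<in> max_ideal \<Longrightarrow> x \<in> int_ring \<Longrightarrow> y \<in> int_ring \<Longrightarrow> x \<in> max_ideal \<or> y \<in> max_ideal"
  using \<nu>_mult[of x y] by (cases "x = 0 \<or> y = 0") (auto simp: max_ideal_def int_ring_def)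

lemma max_ideal_power: "x ^ n \<in> max_ideal \<Longrightarrow> x \<in> int_ring \<Longrightarrow> x \<in> max_ideal"
  using max_ideal_prime int_ring_power by (induction n) auto

lemma max_ideal_power_diff_1:
  assumes "w - 1 \<in> max_ideal" "w \<in> int_ring"
  shows "w ^ i - 1 \<in> max_ideal"
proof (induction i)
  case (Suc i)
  have "w ^ Suc i - 1 = (w ^ i - 1) * w + (w - 1)" by (simp add: algebra_simps)
  also have "\<dots> \<in> max_ideal" by (intro max_ideal_add max_ideal_mult Suc assms)
  finally show ?case .
qed simp

text \<open>The residue characteristic is \<open>p\<close>: the valuation of a positive integer is
  its \<open>p\<close>-adic one, and it is positive exactly when the first residue vanishes.\<close>

lemma max_ideal_of_nat_iff: "of_nat k \<in> max_ideal \<longleftrightarrow> CARD('p) dvd k"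
proof (cases "k = 0")
  case False
  hence "(of_nat k :: 'p padic_int) \<noteq> 0" by simp
  from \<nu>_\<iota>[OF this] have "\<nu> (of_nat k) = of_nat (padic_int_val (of_nat k :: 'p padic_int))"
    by (simp flip: of_nat_fract)
  moreover have "CARD('p) dvd k \<longleftrightarrow> residue (of_nat k :: 'p padic_int) 1 = 0"
    by (simp add: residue_of_nat flip: of_nat_mod) (simp add: dvd_eq_mod_eq_0)
  ultimately show ?thesis
    using False of_nat_neq_0[of k] residue_eq_0_iff[OF \<open>(of_nat k :: 'p padic_int) \<noteq> 0\<close>, of 1]
    by (simp add: max_ideal_def Suc_le_eq)
qed simp

lemma \<nu>_\<iota>_integer: "c \<noteq> 0 \<Longrightarrow> \<nu> (\<iota> c) \<in> \<int>"
proof (cases c)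
  case (Fract a b)
  assume "c \<noteq> 0"
  with Fract have nz: "a \<noteq> 0" "b \<noteq> 0" by (auto simp: Zero_fract_def eq_fract)
  hence "padic_of_int a = c * padic_of_int b" by (simp add: Fract eq_fract)
  hence "\<iota> (padic_of_int a) = \<iota> c * \<iota> (padic_of_int b)" by (simp only: \<iota>_mult)
  moreover have "\<iota> (padic_of_int b) \<noteq> 0" using nz by (simp add: Zero_fract_def eq_fract)
  ultimately have "of_nat (padic_int_val a) = \<nu> (\<iota> c) + of_nat (padic_int_val b)"
    using nz \<nu>_\<iota>[of a] \<nu>_\<iota>[of b] \<nu>_mult[of "\<iota> c" "\<iota> (padic_of_int b)"] \<open>c \<noteq> 0\<close> by simp
  hence "\<nu> (\<iota> c) = of_nat (padic_int_val a) - of_nat (padic_int_val b)" by simp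
  thus ?thesis by simp
qed

text \<open>A \<open>p\<close>-adic number of nonnegative valuation is a \<open>p\<close>-adic
  integer, since numerator and denominator divide. Its first residue then represents it modulo the
  maximal ideal.\<close>

lemma \<iota>_reduce:
  assumes "\<iota> c \<in> int_ring"
  obtains n where "n < CARD('p)" "\<iota> c - of_nat n \<in> max_ideal"
proof (cases "c = 0")
  case True
  thus ?thesis using that[of 0] card_gt_1[where 'p='p] by simp
next
  case False
  obtain a b where c: "c = Fract a b" "b \<noteq> 0" by (cases c) auto
  with False have "a \<noteq> 0" by (auto simp: Zero_fract_def eq_fract)
  have "padic_of_int a = c * padic_of_int b" using c by (simp add: eq_fract)
  hence "\<iota> (padic_of_int a) = \<iota> c * \<iota> (padic_of_int b)" by (simp only: \<iota>_mult)
  moreover have "\<iota> (padic_of_int b) \<noteq> 0" using c by (simp add: Zero_fract_def eq_fract)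
  ultimately have "of_nat (padic_int_val a) = \<nu> (\<iota> c) + of_nat (padic_int_val b)"
    using c \<open>a \<noteq> 0\<close> \<nu>_\<iota>[of a] \<nu>_\<iota>[of b] \<nu>_mult[of "\<iota> c" "\<iota> (padic_of_int b)"] False by simp
  moreover have "\<nu> (\<iota> c) \<ge> 0" using assms False by (simp add: int_ring_def)
  ultimately have "padic_int_val b \<le> padic_int_val a" by simp
  hence "b dvd a" using c \<open>a \<noteq> 0\<close> residue_eq_0_iff by (intro padic_int_dvdI) auto
  then obtain q where "a = b * q" ..
  hence cq: "c = padic_of_int q" using c by (simp add: eq_fract)
  define n where "n = nat (residue q 1)"
  have n: "int n = residue q 1" using residue_bounds[of q 1] by (simp add: n_def)
  show ?thesis
  proof (rule that)
    show "n < CARD('p)" using n residue_bounds(2)[of q 1] by simp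
    define r where "r = q - of_nat n"
    have "residue r 1 = 0"
      using n residue_bounds[of q 1] by (simp add: r_def minus_padic_int.rep_eq residue_of_nat)
    moreover have "\<iota> c - of_nat n = \<iota> (padic_of_int r)"
    proof -
      have "padic_of_int q = padic_of_int r + of_nat n"
        by (simp add: r_def of_nat_fract)
      thus ?thesis by (simp add: cq \<iota>_add)
    qed
    ultimately show "\<iota> c - of_nat n \<in> max_ideal"
      using \<nu>_\<iota>[of r] residue_eq_0_iff[of r 1]
      by (cases "r = 0") (auto simp: max_ideal_def Zero_fract_def[symmetric] eq_fract)
  qed
qed

section \<open>Consequences of the finiteness of the extension: discreteness and scarcity of roots
  of unity\<close>

lemma ex_linear_dependence:
  obtains d where "\<And>x :: nat \<Rightarrow> 'k. \<exists>c. (\<exists>i\<le>d. c i \<noteq> 0) \<and> (\<Sum>i\<le>d. \<iota> (c i) * x i) = 0"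
proof -
  interpret V: vector_space "\<lambda>c x. \<iota> c * x"
    by unfold_locales (simp_all add: \<iota>_add \<iota>_mult \<iota>_one algebra_simps)
  obtain B where B: "finite B" "V.span B = UNIV" using finite_ext by blast
  have "\<exists>c. (\<exists>i\<le>card B. c i \<noteq> 0) \<and> (\<Sum>i\<le>card B. \<iota> (c i) * x i) = 0" for x :: "nat \<Rightarrow> 'k"
  proof (cases "inj_on x {..card B}")
    case True
    have "V.dependent (x ` {..card B})"
    proof (rule ccontr)
      assume "V.independent (x ` {..card B})"
      hence "card (x ` {..card B}) \<le> card B" using V.independent_span_bound B by blast
      thus False using True by (simp add: card_image)
    qed
    then obtain u v where "v \<in> x ` {..card B}" "u v \<noteq> 0" "(\<Sum>v\<in>x ` {..card B}. \<iota> (u v) * v) = 0"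
      by (subst (asm) V.dependent_finite) auto
    thus ?thesis using True by (intro exI[of _ "u \<circ> x"]) (auto simp: sum.reindex)
  next
    case False
    \<comment> \<open>A family with a repetition is dependent even if its set of values is not; the
      relation is the difference of the two equal terms.\<close>
    then obtain i j where ij: "i \<le> card B" "j \<le> card B" "i \<noteq> j" "x i = x j"
      by (auto simp: inj_on_def)
    define c where "c k = (if k = i then 1 else if k = j then - 1 else (0 :: 'p padic))" for k
    have "(\<Sum>k\<le>card B. \<iota> (c k) * x k) = (\<Sum>k\<in>{i, j}. \<iota> (c k) * x k)"
      by (rule sum.mono_neutral_right) (use ij in \<open>auto simp: c_def\<close>)
    also have "\<dots> = 0" using ij by (simp add: c_def \<iota>_one)
    finally show ?thesis using ij by (intro exI[of _ c]) (auto simp: c_def)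
  qed
  thus ?thesis using that by blast
qed

text \<open>In a relation among the powers of \<open>x\<close> up to degree \<open>d\<close>, a
  unique term of least valuation could not cancel, so two terms share it. Then
  \<open>(i - j) * \<nu> x\<close> is a difference of integral valuations of \<open>p\<close>-adic
  numbers, and the absolute value of \<open>i - j\<close> divides \<open>fact d\<close>.\<close>

lemma valuation_discrete:
  obtains D :: nat where "D > 0" "\<And>x. x \<noteq> 0 \<Longrightarrow> of_nat D * \<nu> x \<in> \<int>"
proof -
  obtain d where d: "\<And>x :: nat \<Rightarrow> 'k. \<exists>c. (\<exists>i\<le>d. c i \<noteq> 0) \<and> (\<Sum>i\<le>d. \<iota> (c i) * x i) = 0"
    using ex_linear_dependence by blast
  have "of_nat (fact d) * \<nu> x \<in> \<int>" if x: "x \<noteq> 0" for x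
  proof -
    obtain c where c: "\<exists>i\<le>d. c i \<noteq> 0" "(\<Sum>i\<le>d. \<iota> (c i) * x ^ i) = 0"
      using d[of "\<lambda>i. x ^ i"] by blast
    define t where "t i = \<iota> (c i) * x ^ i" for i
    define I where "I = {i. i \<le> d \<and> c i \<noteq> 0}"
    have I: "finite I" "I \<noteq> {}" using c(1) by (auto simp: I_def)
    have t: "t i \<noteq> 0 \<longleftrightarrow> c i \<noteq> 0" for i using x by (simp add: t_def)
    define i where "i = arg_min_on (\<lambda>i. \<nu> (t i)) I"
    have i: "i \<in> I" "\<And>j. j \<in> I \<Longrightarrow> \<nu> (t i) \<le> \<nu> (t j)"
      using arg_min_if_finite[OF I] arg_min_least[OF I] by (auto simp: i_def)
    have "\<exists>j\<in>I. j \<noteq> i \<and> \<nu> (t j) = \<nu> (t i)"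
    proof (rule ccontr)
      assume "\<not> ?thesis"
      hence "t j = 0 \<or> \<nu> (t i) < \<nu> (t j)" if "j \<in> {..d} - {i}" for j
        using that i(2)[of j] t[of j] by (cases "c j = 0") (auto simp: I_def less_le)
      hence "(\<Sum>j\<in>{..d} - {i}. t j) = 0 \<or> \<nu> (t i) < \<nu> (\<Sum>j\<in>{..d} - {i}. t j)"
        by (rule ultrametric_sum_strict)
      moreover have "(\<Sum>j\<in>{..d} - {i}. t j) = - t i"
        using c(2) i(1) by (simp add: sum_diff1 I_def flip: t_def)
      ultimately show False using i(1) t[of i] by (auto simp: I_def)
    qed
    then obtain j where j: "j \<in> I" "j \<noteq> i" "\<nu> (t j) = \<nu> (t i)" by blast
    have \<nu>t: "\<nu> (t k) = \<nu> (\<iota> (c k)) + of_nat k * \<nu> x" if "k \<in> I" for k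
      using that x by (simp add: t_def I_def \<nu>_mult \<nu>_power)
    define k where "k = int i - int j"
    have k: "k \<noteq> 0" "nat \<bar>k\<bar> \<le> d" "nat \<bar>k\<bar> > 0" using i(1) j(1,2) by (auto simp: k_def I_def)
    have "of_int k * \<nu> x = \<nu> (\<iota> (c j)) - \<nu> (\<iota> (c i))"
      using \<nu>t[OF i(1)] \<nu>t[OF j(1)] j(3) by (simp add: k_def algebra_simps)
    also have "\<dots> \<in> \<int>" using i(1) j(1) by (intro Ints_diff \<nu>_\<iota>_integer) (auto simp: I_def)
    finally have int: "of_int k * \<nu> x \<in> \<int>" .
    have "nat \<bar>k\<bar> dvd fact d" using k by (intro dvd_fact) auto
    hence "k dvd int (fact d)" by (metis abs_dvd_iff int_dvd_int_iff int_nat_eq abs_ge_zero)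
    then obtain m where "int (fact d) = k * m" ..
    hence "of_nat (fact d) = (of_int k * of_int m :: rat)" by (metis of_int_mult of_int_of_nat_eq)
    hence "of_nat (fact d) * \<nu> x = of_int m * (of_int k * \<nu> x)" by simp
    thus ?thesis using int by (metis Ints_mult Ints_of_int)
  qed
  thus ?thesis using that[of "fact d"] by simp
qed

lemma coeff_synthetic_div_int_ring:
  "(\<And>i. coeff f i \<in> int_ring) \<Longrightarrow> r \<in> int_ring \<Longrightarrow> coeff (synthetic_div f r) i \<in> int_ring"
proof (induction f arbitrary: i)
  case (pCons a f)
  have *: "coeff f i \<in> int_ring" for i using pCons.prems(1)[of "Suc i"] by simp
  show ?case
    using pCons.IH[OF * pCons.prems(2)] int_ring_poly[OF * pCons.prems(2)]
    by (auto simp: coeff_pCons split: nat.splits)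
qed simp

text \<open>Over the residue field this says that a polynomial with more roots than its degree
  vanishes. Working with representatives, a root is split off by synthetic division, and differences
  of distinct points may be cancelled because the maximal ideal is prime.\<close>

lemma poly_roots_mod_max_ideal:
  assumes "degree f \<le> n" "\<And>i. coeff f i \<in> int_ring" "card S = Suc n" "S \<subseteq> int_ring"
    and "\<And>x. x \<in> S \<Longrightarrow> poly f x \<in> max_ideal"
    and "\<And>x y. x \<in> S \<Longrightarrow> y \<in> S \<Longrightarrow> x \<noteq> y \<Longrightarrow> x - y \<notin> max_ideal"
  shows "coeff f i \<in> max_ideal"
  using assms
proof (induction n arbitrary: f S i)
  case 0
  then obtain a where "f = [:a:]" by (metis degree_eq_zeroE le_zero_eq)
  moreover obtain r where "r \<in> S" using 0 by (metis card_eq_SucD insertI1)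
  ultimately show ?case using 0(5)[of r] by (simp add: coeff_pCons split: nat.splits)
next
  case (Suc n)
  obtain r S' where S': "S = insert r S'" "r \<notin> S'" "card S' = Suc n"
    using Suc.prems(3) by (metis card_eq_SucD)
  have r: "r \<in> int_ring" "poly f r \<in> max_ideal" using Suc.prems S' by auto
  define g where "g = synthetic_div f r"
  have fg: "f = pCons (poly f r) g - Polynomial.smult r g"
    using synthetic_div_correct[of f r] by (simp add: g_def algebra_simps)
  have fx: "poly f x = poly f r + (x - r) * poly g x" for x
    by (subst fg) (simp add: algebra_simps)
  have gO: "coeff g i \<in> int_ring" for i
    unfolding g_def using Suc.prems(2) r(1) by (rule coeff_synthetic_div_int_ring)
  have "coeff g i \<in> max_ideal" for i
  proof (rule Suc.IH)
    show "degree g \<le> n" using Suc.prems(1) by (simp add: g_def degree_synthetic_div)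
    show "poly g x \<in> max_ideal" if "x \<in> S'" for x
    proof -
      have "(x - r) * poly g x \<in> max_ideal"
        using max_ideal_diff[OF Suc.prems(5)[of x] r(2)] that S' by (simp add: fx[of x])
      moreover have "x - r \<notin> max_ideal" using Suc.prems(6)[of x r] that S' by auto
      moreover have "x \<in> int_ring" using Suc.prems(4) that S' by auto
      ultimately show ?thesis
        using max_ideal_prime int_ring_diff[OF _ r(1)] int_ring_poly[OF gO] by blast
    qed
  qed (use Suc.prems S' gO in auto)
  moreover from this have "coeff (pCons (poly f r) g) i \<in> max_ideal" for i
    using r(2) by (auto simp: coeff_pCons split: nat.splits)
  ultimately show ?case
    by (subst fg) (auto simp: mult.commute[of r] intro!: max_ideal_diff max_ideal_mult r(1))
qed

text \<open>Scaling a linear dependence so that a coefficient of minimal valuation becomes \<open>1\<close> allows reducing it.\<close>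

lemma ex_reduced_polynomial:
  obtains d where "\<And>x. x \<in> int_ring \<Longrightarrow> \<exists>e \<in> {..d} \<rightarrow>\<^sub>E {..<CARD('p)}.
    (\<exists>i\<le>d. of_nat (e i) \<notin> max_ideal) \<and> (\<Sum>i\<le>d. of_nat (e i) * x ^ i) \<in> max_ideal"
proof -
  obtain d where d: "\<And>x :: nat \<Rightarrow> 'k. \<exists>c. (\<exists>i\<le>d. c i \<noteq> 0) \<and> (\<Sum>i\<le>d. \<iota> (c i) * x i) = 0"
    using ex_linear_dependence by blast
  have "\<exists>e \<in> {..d} \<rightarrow>\<^sub>E {..<CARD('p)}. (\<exists>i\<le>d. of_nat (e i) \<notin> max_ideal) \<and>
      (\<Sum>i\<le>d. of_nat (e i) * x ^ i) \<in> max_ideal" if x: "x \<in> int_ring" for x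
  proof -
    obtain c where c: "\<exists>i\<le>d. c i \<noteq> 0" "(\<Sum>i\<le>d. \<iota> (c i) * x ^ i) = 0"
      using d[of "\<lambda>i. x ^ i"] by blast
    define I where "I = {i. i \<le> d \<and> c i \<noteq> 0}"
    have I: "finite I" "I \<noteq> {}" using c(1) by (auto simp: I_def)
    define j where "j = arg_min_on (\<lambda>i. \<nu> (\<iota> (c i))) I"
    have j: "j \<in> I" "\<And>i. i \<in> I \<Longrightarrow> \<nu> (\<iota> (c j)) \<le> \<nu> (\<iota> (c i))"
      using arg_min_if_finite[OF I] arg_min_least[OF I] by (auto simp: j_def)
    have cj: "c j \<noteq> 0" "j \<le> d" using j(1) by (auto simp: I_def)
    define b where "b i = c i / c j" for i
    have bO: "\<iota> (b i) \<in> int_ring" if "i \<le> d" for i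
    proof (cases "c i = 0")
      case False
      have "\<iota> (c i) = \<iota> (b i) * \<iota> (c j)" using cj by (simp add: b_def flip: \<iota>_mult)
      hence "\<nu> (\<iota> (c i)) = \<nu> (\<iota> (b i)) + \<nu> (\<iota> (c j))"
        using False cj by (simp add: \<nu>_mult b_def)
      thus ?thesis using j(2)[of i] that False by (simp add: int_ring_def I_def)
    qed (simp add: b_def)
    have "\<exists>n. i \<le> d \<longrightarrow> n < CARD('p) \<and> \<iota> (b i) - of_nat n \<in> max_ideal" for i
      using \<iota>_reduce[OF bO] by metis
    then obtain n where n: "\<And>i. i \<le> d \<Longrightarrow> n i < CARD('p) \<and> \<iota> (b i) - of_nat (n i) \<in> max_ideal"
      by metis
    have "of_nat (n j) \<notin> max_ideal"
    proof
      assume "of_nat (n j) \<in> max_ideal"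
      with n[of j] cj have "\<iota> (b j) - of_nat (n j) + of_nat (n j) \<in> max_ideal"
        by (intro max_ideal_add) auto
      thus False using cj by (simp add: b_def \<iota>_one)
    qed
    moreover have "(\<Sum>i\<le>d. of_nat (n i) * x ^ i) \<in> max_ideal"
    proof -
      have "\<iota> (c j) * (\<Sum>i\<le>d. \<iota> (b i) * x ^ i) = 0"
        using c(2) cj by (simp add: b_def sum_distrib_left mult.assoc[symmetric] flip: \<iota>_mult)
      hence 0: "(\<Sum>i\<le>d. \<iota> (b i) * x ^ i) = 0" using cj by simp
      have "(\<Sum>i\<le>d. (\<iota> (b i) - of_nat (n i)) * x ^ i) \<in> max_ideal"
        using n x by (intro max_ideal_sum max_ideal_mult int_ring_power) auto
      with 0 show ?thesis by (simp add: left_diff_distrib sum_subtractf)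
    qed
    ultimately show ?thesis
      using n cj by (intro bexI[of _ "restrict n {..d}"]) auto
  qed
  thus ?thesis using that by blast
qed

text \<open>
  If \<open>l \<noteq> p\<close>, the \<open>z n\<close> are pairwise incongruent modulo the maximal ideal, but by pigeonhole infinitely
  many of them are roots of one nonzero polynomial modulo it. If \<open>l = p\<close>, then \<open>z (n + 1) - 1\<close> properly
  divides \<open>z n - 1\<close>, whereas the valuation is discrete.
\<close>

lemma no_infinite_root_tower:
  assumes l: "Factorial_Ring.prime l" and z0: "z 0 = 1" and z1: "z 1 \<noteq> (1 :: 'k)"
    and z: "\<And>n. z (Suc n) ^ l = z n"
  shows False
proof -
  have l1: "l > 1" using l prime_gt_1_nat by blast
  have zpow: "z (m + n) ^ (l ^ n) = z m" for m n
    by (induction n) (simp_all add: power_mult z)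
  have root: "z n ^ (l ^ n) = 1" for n using zpow[of 0 n] z0 by simp
  have nz: "z n \<noteq> 0" and \<nu>z: "\<nu> (z n) = 0" for n
    using \<nu>_root_of_unity[OF root[of n]] l1 by auto
  have zO: "z n \<in> int_ring" for n by (simp add: int_ring_def \<nu>z)
  have z_neq: "z m \<noteq> z n" if "m < n" for m n
  proof
    assume eq: "z m = z n"
    define k where "k = n - 1 - m"
    have "z n ^ (l ^ (n - 1)) = z 1" using zpow[of 1 "n - 1"] that by simp
    moreover have "z m ^ (l ^ (n - 1)) = (z m ^ (l ^ m)) ^ (l ^ k)"
      using that by (simp add: k_def power_mult[symmetric] power_add[symmetric])
    ultimately show False using eq root[of m] z1 by simp
  qed
  show False
  proof (cases "l = CARD('p)")
    case False
    have not_p: "\<not> CARD('p) dvd l ^ n" for n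
      using False l prime_card[where 'a='p] by (metis prime_dvd_power primes_dvd_imp_eq)
    \<comment> \<open>If \<open>w\<close> were congruent to \<open>1\<close>, the geometric sum of
      \<open>l ^ n\<close> terms would be congruent to \<open>l ^ n\<close>. The sum is zero, so
      \<open>p\<close> would divide \<open>l ^ n\<close>.\<close>
    have unit: "w - 1 \<notin> max_ideal" if w: "w ^ (l ^ n) = 1" "w \<noteq> 1" for w n
    proof
      assume m: "w - 1 \<in> max_ideal"
      have wO: "w \<in> int_ring"
        using \<nu>_root_of_unity[OF w(1)] l1 by (simp add: int_ring_def)
      have "w ^ i - 1 \<in> max_ideal" for i
        using m wO by (rule max_ideal_power_diff_1)
      hence "(\<Sum>i<l ^ n. w ^ i - 1) \<in> max_ideal" by (intro max_ideal_sum)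
      moreover have "(\<Sum>i<l ^ n. w ^ i) = 0"
        using power_diff_1_eq[of w "l ^ n"] w by simp
      ultimately have "of_nat (l ^ n) \<in> max_ideal" by (simp add: sum_subtractf)
      thus False using not_p max_ideal_of_nat_iff by blast
    qed
    \<comment> \<open>The quotient \<open>z n / z m\<close> is a nontrivial root of unity of
      \<open>l\<close>-power order, to which \<open>unit\<close> applies; dividing by
      \<open>z m\<close> is harmless as its valuation is zero.\<close>
    have diff: "z m - z n \<notin> max_ideal" if "m < n" for m n
    proof
      assume "z m - z n \<in> max_ideal"
      hence "(z m - z n) * inverse (z m) \<in> max_ideal"
        using nz \<nu>z by (intro max_ideal_mult) (auto simp: int_ring_def \<nu>_inverse)
      moreover have "z n / z m - 1 = - ((z m - z n) * inverse (z m))"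
        using nz by (simp add: field_simps)
      ultimately have "z n / z m - 1 \<in> max_ideal" by (simp only: max_ideal_minus)
      moreover have "(z n / z m) ^ (l ^ n) = 1"
      proof -
        have "z m ^ (l ^ n) = (z m ^ (l ^ m)) ^ (l ^ (n - m))"
          using that by (simp add: power_mult[symmetric] power_add[symmetric])
        thus ?thesis using root by (simp add: power_divide)
      qed
      moreover have "z n / z m \<noteq> 1" using z_neq[OF that] nz by simp
      ultimately show False using unit by blast
    qed
    obtain d where "\<And>x. x \<in> int_ring \<Longrightarrow> \<exists>e \<in> {..d} \<rightarrow>\<^sub>E {..<CARD('p)}.
        (\<exists>i\<le>d. of_nat (e i) \<notin> max_ideal) \<and> (\<Sum>i\<le>d. of_nat (e i) * x ^ i) \<in> max_ideal"
      using ex_reduced_polynomial by blast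
    with zO have "\<forall>n. \<exists>e \<in> {..d} \<rightarrow>\<^sub>E {..<CARD('p)}. (\<exists>i\<le>d. of_nat (e i) \<notin> max_ideal) \<and>
        (\<Sum>i\<le>d. of_nat (e i) * z n ^ i) \<in> max_ideal" by blast
    then obtain e where e: "\<And>n. e n \<in> {..d} \<rightarrow>\<^sub>E {..<CARD('p)}"
      "\<And>n. \<exists>i\<le>d. of_nat (e n i) \<notin> max_ideal" "\<And>n. (\<Sum>i\<le>d. of_nat (e n i) * z n ^ i) \<in> max_ideal"
      by metis
    have "finite (range e)"
      by (rule finite_subset[of _ "{..d} \<rightarrow>\<^sub>E {..<CARD('p)}"]) (use e(1) in \<open>auto intro: finite_PiE\<close>)
    then obtain n0 where "infinite {n. e n = e n0}"
      using pigeonhole_infinite[of UNIV e] by auto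
    \<comment> \<open>One more index than the \<open>d\<close> roots that a nonzero polynomial of
      degree at most \<open>d\<close> may have modulo the maximal ideal.\<close>
    then obtain N where N: "finite N" "card N = Suc d" "N \<subseteq> {n. e n = e n0}"
      using infinite_arbitrarily_large by blast
    define f where "f = (\<Sum>i\<le>d. Polynomial.monom (of_nat (e n0 i) :: 'k) i)"
    have cf: "coeff f i = (if i \<le> d then of_nat (e n0 i) else 0)" for i
      by (auto simp: f_def coeff_sum if_distrib sum.delta cong: if_cong)
    have pf: "poly f x = (\<Sum>i\<le>d. of_nat (e n0 i) * x ^ i)" for x
      by (simp add: f_def poly_sum poly_monom)
    have inj: "inj_on z N" using z_neq by (metis inj_on_def linorder_neqE_nat)
    have "coeff f i \<in> max_ideal" for i
    proof (rule poly_roots_mod_max_ideal[of f d "z ` N"])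
      show "degree f \<le> d" by (rule degree_le) (simp add: cf)
      show "card (z ` N) = Suc d" using N inj by (simp add: card_image)
      show "poly f x \<in> max_ideal" if "x \<in> z ` N" for x
        using that N(3) e(3) by (auto simp: pf subset_iff) metis
      show "x - y \<notin> max_ideal" if "x \<in> z ` N" "y \<in> z ` N" "x \<noteq> y" for x y
        using that diff max_ideal_minus by (metis imageE linorder_neqE_nat minus_diff_eq)
    qed (use zO in \<open>auto simp: cf\<close>)
    with cf e(2)[of n0] show False by metis
  next
    case True
    define x where "x n = z n - 1" for n
    have p_max: "of_nat l \<in> max_ideal" by (simp add: max_ideal_of_nat_iff True)
    \<comment> \<open>The middle binomial coefficients are divisible by \<open>l = p\<close>, so
      \<open>x (Suc n) ^ l\<close> is congruent to \<open>x n\<close>, and the maximal ideal is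
      radical.\<close>
    have xm: "x n \<in> max_ideal" for n
    proof (induction n)
      case (Suc n)
      have xO: "x (Suc n) \<in> int_ring" using zO by (simp add: x_def int_ring_diff)
      let ?t = "\<lambda>k. of_nat (l choose k) * x (Suc n) ^ k"
      have "z n = (x (Suc n) + 1) ^ l" using z[of n] by (simp add: x_def)
      also have "\<dots> = (\<Sum>k\<le>l. ?t k)" by (simp add: binomial_ring)
      also have "\<dots> = ?t l + (\<Sum>k<l. ?t k)" by (simp add: lessThan_Suc_atMost[symmetric])
      also have "(\<Sum>k<l. ?t k) = ?t 0 + (\<Sum>k\<in>{1..<l}. ?t k)"
        using l1 by (simp add: lessThan_atLeast0 sum.atLeast_Suc_lessThan)
      finally have "x (Suc n) ^ l = x n - (\<Sum>k\<in>{1..<l}. ?t k)" by (simp add: x_def algebra_simps)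
      also have "\<dots> \<in> max_ideal"
      proof (intro max_ideal_diff Suc max_ideal_sum)
        fix k assume "k \<in> {1..<l}"
        hence "l dvd l choose k" using l by (intro dvd_choose_prime) auto
        thus "?t k \<in> max_ideal"
          using xO True by (intro max_ideal_mult int_ring_power) (auto simp: max_ideal_of_nat_iff)
      qed
      finally show ?case using xO max_ideal_power by blast
    qed (simp add: x_def z0)
    have x_nz: "x n \<noteq> 0" if "n \<ge> 1" for n using z_neq[of 0 n] that z0 by (simp add: x_def)
    obtain D where D: "D > 0" "\<And>x. x \<noteq> 0 \<Longrightarrow> of_nat D * \<nu> x \<in> \<int>"
      using valuation_discrete by blast
    have D_le: "1 \<le> of_nat D * \<nu> y" if "y \<in> max_ideal" "y \<noteq> 0" for y
    proof -
      obtain k :: int where k: "of_nat D * \<nu> y = of_int k" using D(2)[OF \<open>y \<noteq> 0\<close>] by (auto elim: Ints_cases)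
      have "of_nat D * \<nu> y > 0" using that D(1) by (simp add: max_ideal_def)
      thus ?thesis using k by simp
    qed
    \<comment> \<open>The cofactor \<open>s\<close> of \<open>x (Suc n)\<close> in
      \<open>x n\<close> is a sum of \<open>l\<close> terms congruent to \<open>1\<close>, hence
      congruent to \<open>l\<close>, which lies in the maximal ideal. Its scaled valuation is thus
      at least one. The case \<open>n = 0\<close> is excluded because
      \<open>x 0 = 0\<close>.\<close>
    have step: "of_nat D * \<nu> (x (Suc n)) + 1 \<le> of_nat D * \<nu> (x n)" if "n \<ge> 1" for n
    proof -
      define s where "s = (\<Sum>i<l. z (Suc n) ^ i)"
      have xs: "x n = x (Suc n) * s"
        using power_diff_1_eq[of "z (Suc n)" l] z[of n] by (simp add: x_def s_def)
      hence "s \<noteq> 0" using x_nz[OF that] by auto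
      have "z (Suc n) ^ i - 1 \<in> max_ideal" for i
        using xm[of "Suc n"] zO[of "Suc n"] unfolding x_def by (rule max_ideal_power_diff_1)
      hence "(\<Sum>i<l. z (Suc n) ^ i - 1) + of_nat l \<in> max_ideal"
        by (intro max_ideal_add max_ideal_sum p_max)
      hence "s \<in> max_ideal" by (simp add: s_def sum_subtractf)
      with D_le \<open>s \<noteq> 0\<close> xs x_nz show ?thesis by (simp add: \<nu>_mult algebra_simps)
    qed
    have bound: "of_nat n \<le> of_nat D * \<nu> (x 1)" for n
    proof -
      have "of_nat n + of_nat D * \<nu> (x (Suc n)) \<le> of_nat D * \<nu> (x 1)"
      proof (induction n)
        case (Suc n)
        thus ?case using step[of "Suc n"] by simp
      qed simp
      moreover have "1 \<le> of_nat D * \<nu> (x (Suc n))" by (intro D_le xm x_nz) simp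
      ultimately show ?thesis by linarith
    qed
    obtain n where "of_nat D * \<nu> (x 1) < of_nat n" using reals_Archimedean2 by blast
    with bound[of n] show False by simp
  qed
qed

end

section \<open>Kummer theory\<close>

lemma power_int_power_commute: "(x powi k) ^ n = ((x :: 'a::field) ^ n) powi k"
  by (simp add: power_int_def power_inverse mult.commute flip: power_mult)

lemma component_zero: "component (0 :: ('k::field, 'l::prime_card) mult_completion) n = pow_coset (CARD('l) ^ n) 1"
  by (simp add: zero_mult_completion.rep_eq one_quot del: one_FactGroup)

lemma component_cscale_compl_map:
  fixes a :: "'l::prime_card padic_int" and c :: "'k::field"
  assumes "c \<noteq> 0"
  shows "component (cscale a (compl_map c)) n = pow_coset (CARD('l) ^ n) (c powi residue a n)"
  using assms residue_bounds(1)[of a n]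
  by (simp add: cscale.rep_eq compl_map.rep_eq pow_coset_pow power_int_def flip: pow_coset_def)

lemma component_sum:
  fixes x :: "'i \<Rightarrow> ('k::field, 'l::prime_card) mult_completion"
  assumes "\<And>i. i \<in> I \<Longrightarrow> y i \<noteq> 0"
    "\<And>i. i \<in> I \<Longrightarrow> component (x i) n = pow_coset (CARD('l) ^ n) (y i)"
  shows "component (sum x I) n = pow_coset (CARD('l) ^ n) (prod y I)"
  using assms
proof (induction I rule: infinite_finite_induct)
  case (insert i I)
  moreover from insert have "prod y I \<noteq> 0" by (cases "finite I") auto
  ultimately show ?case
    by (simp add: plus_mult_completion.rep_eq pow_coset_mult del: mult_FactGroup)
qed (simp_all add: component_zero)

lemma pow_coset_eq_one_iff: "pow_coset m x = pow_coset m 1 \<longleftrightarrow> (\<exists>z. z \<noteq> 0 \<and> x = z ^ m)"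
proof
  assume "pow_coset m x = pow_coset m 1"
  hence "x \<in> pow_coset m 1" using pow_coset_self by blast
  thus "\<exists>z. z \<noteq> 0 \<and> x = z ^ m" by (auto simp: pow_coset_altdef)
next
  assume "\<exists>z. z \<noteq> 0 \<and> x = z ^ m"
  thus "pow_coset m x = pow_coset m 1" using pow_coset_eqI[of _ x m 1] by auto
qed

text \<open>A relation with \<open>l\<close>-adic exponents is reduced to honest powers in the base
  field: at level \<open>n\<close> only the exponents modulo \<open>l ^ n\<close> matter.\<close>

lemma sum_cscale_compl_map_eq_0_iff:
  fixes a :: "'i \<Rightarrow> 'l::prime_card padic_int" and c :: "'i \<Rightarrow> 'k::field"
  assumes "\<And>i. i \<in> I \<Longrightarrow> c i \<noteq> 0"
  shows "(\<Sum>i\<in>I. cscale (a i) (compl_map (c i))) = 0 \<longleftrightarrow>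
    (\<forall>n. \<exists>z. z \<noteq> 0 \<and> (\<Prod>i\<in>I. c i powi residue (a i) n) = z ^ (CARD('l) ^ n))"
proof -
  let ?s = "\<Sum>i\<in>I. cscale (a i) (compl_map (c i)) :: ('k, 'l) mult_completion"
  have "?s = 0 \<longleftrightarrow> (\<forall>n. component ?s n = component (0 :: ('k, 'l) mult_completion) n)"
    by (auto simp flip: component_inject simp: fun_eq_iff)
  moreover have "component ?s n = pow_coset (CARD('l) ^ n) (\<Prod>i\<in>I. c i powi residue (a i) n)" for n
    using assms by (intro component_sum component_cscale_compl_map) auto
  ultimately show ?thesis by (simp only: component_zero pow_coset_eq_one_iff)
qed

lemma residue_of_int:
  "residue (of_int k :: 'p::prime_card padic_int) n = k mod int CARD('p) ^ n"
  by (cases k rule: int_cases2)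
     (simp_all add: residue_of_nat uminus_padic_int.rep_eq mod_minus_eq)

lemma residue_sum:
  fixes f :: "'i \<Rightarrow> 'p::prime_card padic_int"
  shows "residue (sum f I) n = (\<Sum>i\<in>I. residue (f i) n) mod int CARD('p) ^ n"
  by (induction I rule: infinite_finite_induct)
     (simp_all add: plus_padic_int.rep_eq mod_simps)

lemma residue_mult_cong:
  "residue a n = residue b n \<Longrightarrow> residue (c * a) n = residue (c * b) n"
  by (simp add: times_padic_int.rep_eq)

text \<open>An \<open>l ^ n\<close>-th power has scaled valuation divisible by \<open>l ^ n\<close>,
  so the combination of valuations vanishes modulo every \<open>l ^ n\<close>. Scaling by
  \<open>D\<close> makes the valuations integers, which embed into the \<open>l\<close>-adic
  integers.\<close>

lemma (in padic_field) valuation_relation: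
  fixes a :: "'i \<Rightarrow> 'l::prime_card padic_int"
  assumes c: "\<And>i. i \<in> I \<Longrightarrow> c i \<noteq> 0"
    and D: "\<And>x. x \<noteq> 0 \<Longrightarrow> of_nat D * \<nu> x = of_int (v x)"
    and 0: "(\<Sum>i\<in>I. cscale (a i) (compl_map (c i))) = 0"
  shows "(\<Sum>i\<in>I. a i * of_int (v (c i))) = 0"
proof (rule padic_int_eqI)
  fix n
  obtain z where z: "z \<noteq> 0" "(\<Prod>i\<in>I. c i powi residue (a i) n) = z ^ (CARD('l) ^ n)"
    using 0 sum_cscale_compl_map_eq_0_iff[of I c a] c by blast
  have "of_int (\<Sum>i\<in>I. residue (a i) n * v (c i)) = of_nat D * \<nu> (\<Prod>i\<in>I. c i powi residue (a i) n)"
    using c by (simp add: \<nu>_prod \<nu>_power_int sum_distrib_left flip: D) (simp add: algebra_simps)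
  also have "\<dots> = of_int (int CARD('l) ^ n * v z)"
    using z(1) by (simp add: z(2) \<nu>_power flip: D)
  finally have "(\<Sum>i\<in>I. residue (a i) n * v (c i)) = int CARD('l) ^ n * v z"
    by (simp only: of_int_eq_iff)
  moreover have "residue (\<Sum>i\<in>I. a i * of_int (v (c i))) n
      = (\<Sum>i\<in>I. residue (a i) n * v (c i)) mod int CARD('l) ^ n"
    by (simp add: residue_sum times_padic_int.rep_eq residue_of_int mod_simps mod_sum_eq)
  ultimately show "residue (\<Sum>i\<in>I. a i * of_int (v (c i))) n = residue 0 n"
    by simp
qed

context
  fixes \<sigma> :: "'k::field alg_closure \<Rightarrow> 'k alg_closure"
  assumes \<sigma>: "\<sigma> \<in> absolute_galois"
begin

lemma galois_const [simp]: "\<sigma> (to_ac c) = to_ac c"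
  and galois_mult: "\<sigma> (x * y) = \<sigma> x * \<sigma> y"
  using \<sigma> by (auto simp: absolute_galois_def)

lemma galois_0: "\<sigma> 0 = 0" and galois_1: "\<sigma> 1 = 1"
  using galois_const[of 0] galois_const[of 1] by simp_all

lemma galois_power: "\<sigma> (x ^ n) = \<sigma> x ^ n"
  by (induction n) (simp_all add: galois_1 galois_mult)

lemma galois_inverse: "\<sigma> (inverse x) = inverse (\<sigma> x)"
proof (cases "x = 0")
  case False
  hence "\<sigma> x * \<sigma> (inverse x) = 1" by (simp add: galois_1 flip: galois_mult)
  thus ?thesis by (metis inverse_unique)
qed (simp add: galois_0)

lemma galois_power_int: "\<sigma> (x powi n) = \<sigma> x powi n"
  by (simp add: power_int_def galois_power galois_inverse)

lemma galois_prod: "\<sigma> (prod f I) = (\<Prod>i\<in>I. \<sigma> (f i))"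
  by (induction I rule: infinite_finite_induct) (simp_all add: galois_1 galois_mult)

end

text \<open>
  The sequence \<open>\<zeta>\<close> is a basis of the Tate module of the multiplicative group.
\<close>

locale kummer =
  fixes \<zeta> :: "nat \<Rightarrow> 'k::field alg_closure" and l_type :: "'l::prime_card itself"
  assumes char_0: "n > 0 \<Longrightarrow> (of_nat n :: 'k) \<noteq> 0"
    and \<zeta>_0: "\<zeta> 0 = 1" and \<zeta>_1: "\<zeta> 1 \<noteq> 1"
    and \<zeta>_Suc: "\<zeta> (Suc n) ^ CARD('l) = \<zeta> n"
    and \<zeta>_not_rational: "\<exists>n. \<zeta> n \<notin> range to_ac"
begin

section \<open>Roots of unity of \<open>l\<close>-power order\<close>

lemma tower_power:
  assumes "\<And>n. z (Suc n) ^ CARD('l) = z n"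
  shows "z n ^ (CARD('l) ^ n) = (z 0 :: 'k alg_closure)"
  by (induction n) (simp_all add: power_mult assms)

lemma l_gt_1: "CARD('l) > 1"
  using card_gt_1[where 'p='l] by simp

lemma \<zeta>_power: "\<zeta> n ^ (CARD('l) ^ n) = 1"
  using tower_power[of \<zeta>, OF \<zeta>_Suc] \<zeta>_0 by simp

lemma \<zeta>_nonzero [simp]: "\<zeta> n \<noteq> 0"
  using \<zeta>_power[of n] l_gt_1 by (metis power_0_left power_eq_0_iff gr_implies_not0 zero_neq_one)

lemma \<zeta>_Suc_power_int: "\<zeta> (Suc n) powi (int CARD('l) * k) = \<zeta> n powi k"
  by (simp add: power_int_mult \<zeta>_Suc)

lemma \<zeta>_power_int_eq_1: "int CARD('l) ^ n dvd k \<Longrightarrow> \<zeta> n powi k = 1"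
proof (elim dvdE)
  fix j assume "k = int CARD('l) ^ n * j"
  hence "\<zeta> n powi k = (\<zeta> n powi (int (CARD('l) ^ n))) powi j" by (simp only: power_int_mult of_nat_power)
  thus ?thesis by (simp only: power_int_of_nat \<zeta>_power power_int_1_left)
qed

text \<open>Primitivity of \<open>\<zeta> n\<close>. Inductively \<open>k\<close> is
  \<open>l ^ n\<close> times some \<open>j\<close>, and the condition at the next level becomes
  \<open>\<zeta> 1 powi j = 1\<close>. As \<open>\<zeta> 1\<close> has exact order \<open>l\<close>,
  the prime \<open>l\<close> divides \<open>j\<close>.\<close>

lemma \<zeta>_power_int_eq_1_iff: "\<zeta> n powi k = 1 \<longleftrightarrow> int CARD('l) ^ n dvd k"
proof
  show "\<zeta> n powi k = 1 \<Longrightarrow> int CARD('l) ^ n dvd k"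
  proof (induction n)
    case (Suc n)
    have "\<zeta> n powi k = (\<zeta> (Suc n) powi k) ^ CARD('l)"
      by (simp add: power_int_power_commute \<zeta>_Suc)
    with Suc have "int CARD('l) ^ n dvd k" by simp
    then obtain j where j: "k = int CARD('l) ^ n * j" ..
    have "\<zeta> (Suc n) powi (int CARD('l) ^ n * j) = \<zeta> 1 powi j" for j
    proof (induction n arbitrary: j)
      case (Suc n)
      have "\<zeta> (Suc (Suc n)) powi (int CARD('l) ^ Suc n * j)
          = \<zeta> (Suc (Suc n)) powi (int CARD('l) * (int CARD('l) ^ n * j))" by (simp add: mult.assoc)
      thus ?case using Suc by (simp only: \<zeta>_Suc_power_int)
    qed simp
    with Suc.prems j have 1: "\<zeta> 1 powi j = 1" by simp
    have "int CARD('l) dvd j"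
    proof (rule ccontr)
      assume "\<not> int CARD('l) dvd j"
      hence "coprime (int CARD('l)) j" using prime_card_int[where 'p='l] by (simp add: prime_imp_coprime)
      then obtain x y where "x * int CARD('l) + y * j = 1"
        using bezout_int[of "int CARD('l)" j] by (metis coprime_iff_gcd_eq_1)
      hence "\<zeta> 1 = \<zeta> 1 powi (x * int CARD('l) + y * j)" by simp
      also have "\<dots> = \<zeta> 1 powi (int CARD('l) ^ 1 * x) * (\<zeta> 1 powi j) powi y"
        by (simp add: power_int_add mult.commute[of x] mult.commute[of y] power_int_mult)
      also have "\<dots> = 1" using 1 by (simp add: \<zeta>_power_int_eq_1)
      finally show False using \<zeta>_1 by simp
    qed
    thus ?case unfolding j power_Suc2 by (intro mult_dvd_mono) simp_all
  qed simp
qed (rule \<zeta>_power_int_eq_1)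

lemma \<zeta>_power_int_eq_iff: "\<zeta> n powi i = \<zeta> n powi j \<longleftrightarrow> int CARD('l) ^ n dvd i - j"
  using \<zeta>_power_int_eq_1_iff[of n "i - j"] by (simp add: power_int_diff field_simps)

text \<open>The power of \<zeta> with \<open>l\<close>-adic exponent \<open>a\<close>; as
  \<open>a\<close> varies, this identifies the \<open>l\<close>-adic integers with the Tate module
  of the multiplicative group.\<close>

definition unity :: "'l padic_int \<Rightarrow> nat \<Rightarrow> 'k alg_closure"
  where "unity a n = \<zeta> n powi residue a n"

lemma unity_nonzero [simp]: "unity a n \<noteq> 0"
  by (simp add: unity_def power_int_eq_0_iff)

lemma unity_eq_iff: "unity a n = unity b n \<longleftrightarrow> residue a n = residue b n"
  unfolding unity_def \<zeta>_power_int_eq_iff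
  by (metis mod_eq_dvd_iff residue_mod_power)

lemma unity_eqI: "int CARD('l) ^ n dvd residue a n - k \<Longrightarrow> unity a n = \<zeta> n powi k"
  by (simp add: unity_def \<zeta>_power_int_eq_iff)

lemma unity_0 [simp]: "unity 0 n = 1"
  by (simp add: unity_def)

lemma unity_add: "unity (a + b) n = unity a n * unity b n"
  using unity_eqI[of n "a + b" "residue a n + residue b n"]
  by (simp add: plus_padic_int.rep_eq unity_def power_int_add mod_eq_dvd_iff[symmetric])

lemma unity_diff: "unity (a - b) n = unity a n / unity b n"
  using unity_add[of "a - b" b n] by (simp add: field_simps)

lemma unity_mult: "unity (a * b) n = unity b n powi residue a n"
proof -
  have "unity (a * b) n = \<zeta> n powi (residue b n * residue a n)"
    by (rule unity_eqI)
       (simp add: times_padic_int.rep_eq mod_eq_dvd_iff[symmetric] mult.commute[of "residue b n"])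
  thus ?thesis by (simp add: unity_def power_int_mult)
qed

lemma unity_sum: "unity (sum f I) n = (\<Prod>i\<in>I. unity (f i) n)"
  by (induction I rule: infinite_finite_induct) (simp_all add: unity_add)

lemma unity_power: "unity a n ^ (CARD('l) ^ n) = 1"
proof -
  have "unity a n ^ (CARD('l) ^ n) = (\<zeta> n ^ (CARD('l) ^ n)) powi residue a n"
    unfolding unity_def by (rule power_int_power_commute)
  thus ?thesis by (simp add: \<zeta>_power)
qed

text \<open>The powers of \<open>\<zeta> n\<close> already provide \<open>l ^ n\<close> distinct
  roots of a polynomial of degree \<open>l ^ n\<close>, so there are no others.\<close>

lemma root_of_unity:
  assumes "y ^ (CARD('l) ^ n) = 1"
  obtains k :: int where "y = \<zeta> n powi k"
proof -
  let ?N = "CARD('l) ^ n"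
  define p where "p = Polynomial.monom (1 :: 'k alg_closure) ?N - 1"
  have N: "?N > 0" using l_gt_1 by simp
  have "coeff p ?N = 1" using N by (simp add: p_def)
  hence p0: "p \<noteq> 0" by auto
  have "degree p \<le> ?N" unfolding p_def by (intro degree_diff_le) (simp_all add: degree_monom_le)
  hence "card {x. poly p x = 0} \<le> ?N" using card_poly_roots_bound[OF p0] by linarith
  moreover have inj: "inj_on (\<lambda>k. \<zeta> n powi int k) {..<?N}"
  proof (rule inj_onI)
    fix i j assume ij: "i \<in> {..<?N}" "j \<in> {..<?N}" "\<zeta> n powi int i = \<zeta> n powi int j"
    hence "int ?N dvd int i - int j" by (simp only: \<zeta>_power_int_eq_iff of_nat_power)
    hence "int i mod int ?N = int j mod int ?N" by (simp only: mod_eq_dvd_iff)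
    thus "i = j" using ij(1,2) by (simp del: of_nat_power)
  qed
  moreover have "(\<lambda>k. \<zeta> n powi int k) ` {..<?N} \<subseteq> {x. poly p x = 0}"
    by (auto simp: p_def poly_monom simp flip: power_mult) (metis \<zeta>_power mult.commute power_mult power_one)
  moreover have "finite {x. poly p x = 0}" by (rule poly_roots_finite[OF p0])
  ultimately have "(\<lambda>k. \<zeta> n powi int k) ` {..<?N} = {x. poly p x = 0}"
    by (intro card_subset_eq) (auto simp: card_image intro!: antisym card_mono dest: card_mono)
  moreover have "y \<in> {x. poly p x = 0}" using assms by (simp add: p_def poly_monom)
  ultimately obtain k where "y = \<zeta> n powi int k" by blast
  thus ?thesis using that by blast
qed

lemma root_of_unity':
  assumes "y ^ (CARD('l) ^ n) = 1"
  obtains a where "y = unity a n"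
proof -
  obtain k where "y = \<zeta> n powi k" using root_of_unity[OF assms] by blast
  also have "\<dots> = unity (of_int k) n"
    by (rule unity_eqI[symmetric]) (simp add: residue_of_int mod_eq_dvd_iff[symmetric])
  finally show ?thesis using that by blast
qed

text \<open>The exponents found at successive levels agree modulo \<open>l ^ n\<close> and glue.
  This is the source of both the cyclotomic character and the Kummer cocycles.\<close>

lemma ex_padic_log:
  assumes z: "z 0 = 1" "\<And>n. z (Suc n) ^ CARD('l) = z n"
  obtains a where "\<And>n. z n = unity a n"
proof -
  have "\<exists>k. z n = \<zeta> n powi k" for n
    using root_of_unity tower_power[of z, OF z(2)] z(1) by metis
  then obtain w where w: "\<And>n. z n = \<zeta> n powi w n" by metis
  have "int CARD('l) ^ n dvd w (Suc n) - w n" for n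
  proof -
    have "\<zeta> n powi w (Suc n) = z (Suc n) ^ CARD('l)"
      unfolding w by (simp add: power_int_power_commute \<zeta>_Suc)
    also have "\<dots> = \<zeta> n powi w n" using z(2) w by simp
    finally show ?thesis by (simp only: \<zeta>_power_int_eq_iff)
  qed
  then obtain a :: "'l padic_int" where a: "\<And>n. residue a n = w n mod int CARD('l) ^ n"
    using ex_padic_int[where 'p='l and w = w] by blast
  have "z n = unity a n" for n
    unfolding w by (rule unity_eqI[symmetric]) (simp add: a mod_eq_dvd_iff[symmetric])
  thus ?thesis using that by blast
qed

section \<open>The cyclotomic character and Kummer cocycles\<close>

definition cyclo :: "('k alg_closure \<Rightarrow> 'k alg_closure) \<Rightarrow> 'l padic_int"
  where "cyclo \<sigma> = (SOME a. \<forall>n. \<sigma> (\<zeta> n) = unity a n)"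

definition root_system :: "'k \<Rightarrow> (nat \<Rightarrow> 'k alg_closure) \<Rightarrow> bool"
  where "root_system c r \<longleftrightarrow> c \<noteq> 0 \<and> r 0 = to_ac c \<and> (\<forall>n. r (Suc n) ^ CARD('l) = r n)"

text \<open>For automorphisms the choice is unique, since the values \<open>unity a n\<close>
  determine \<open>a\<close>. Replacing \<open>r n\<close> by \<open>r n * unity c n\<close> adds
  the coboundary \<open>(cyclo \<sigma> - 1) * c\<close>, the ambiguity absorbed by \<open>R\<close>
  below.\<close>

definition kummer_cocycle ::
  "(nat \<Rightarrow> 'k alg_closure) \<Rightarrow> ('k alg_closure \<Rightarrow> 'k alg_closure) \<Rightarrow> 'l padic_int"
  where "kummer_cocycle r \<sigma> = (SOME a. \<forall>n. \<sigma> (r n) = r n * unity a n)"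

lemma ex_root_system:
  assumes "c \<noteq> 0"
  shows "\<exists>r. root_system c r"
proof -
  have "\<exists>y. y ^ CARD('l) = x" for x :: "'k alg_closure"
    using l_gt_1 by (intro nth_root_exists) simp
  then obtain f where f: "\<And>x :: 'k alg_closure. f x ^ CARD('l) = x" by metis
  have "root_system c (\<lambda>n. (f ^^ n) (to_ac c))"
    using assms f by (simp add: root_system_def)
  thus ?thesis by blast
qed

lemma root_system_power:
  assumes "root_system c r"
  shows "r n ^ (CARD('l) ^ n) = to_ac c"
  using assms tower_power[of r n] by (simp add: root_system_def)

lemma root_system_nonzero:
  assumes "root_system c r"
  shows "r n \<noteq> 0"
proof
  assume "r n = 0"
  hence "to_ac c = 0" using root_system_power[OF assms, of n] l_gt_1 by (simp add: power_0_left)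
  thus False using assms by (simp add: root_system_def)
qed

context
  fixes \<sigma> :: "'k alg_closure \<Rightarrow> 'k alg_closure"
  assumes \<sigma>: "\<sigma> \<in> absolute_galois"
begin

lemma galois_\<zeta>: "\<sigma> (\<zeta> n) = unity (cyclo \<sigma>) n"
proof -
  have "\<sigma> (\<zeta> 0) = 1" by (simp add: \<zeta>_0 galois_1[OF \<sigma>])
  moreover have "\<sigma> (\<zeta> (Suc n)) ^ CARD('l) = \<sigma> (\<zeta> n)" for n
    by (simp add: \<zeta>_Suc flip: galois_power[OF \<sigma>])
  ultimately obtain a where "\<And>n. \<sigma> (\<zeta> n) = unity a n"
    using ex_padic_log[of "\<lambda>n. \<sigma> (\<zeta> n)"] by blast
  hence "\<exists>a. \<forall>n. \<sigma> (\<zeta> n) = unity a n" by blast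
  hence "\<forall>n. \<sigma> (\<zeta> n) = unity (cyclo \<sigma>) n" unfolding cyclo_def by (rule someI_ex)
  thus ?thesis by blast
qed

lemma galois_unity: "\<sigma> (unity a n) = unity (cyclo \<sigma> * a) n"
proof -
  have "\<sigma> (unity a n) = unity (cyclo \<sigma>) n powi residue a n"
    by (simp add: unity_def[of a] galois_power_int[OF \<sigma>] galois_\<zeta>)
  thus ?thesis by (simp add: mult.commute[of "cyclo \<sigma>"] flip: unity_mult)
qed

lemma galois_root_system:
  assumes r: "root_system c r"
  shows "\<sigma> (r n) = r n * unity (kummer_cocycle r \<sigma>) n"
proof -
  note nz = root_system_nonzero[OF r]
  have "\<sigma> (r 0) / r 0 = 1"
    using r galois_const[OF \<sigma>] nz[of 0] by (simp add: root_system_def)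
  moreover have "(\<sigma> (r (Suc n)) / r (Suc n)) ^ CARD('l) = \<sigma> (r n) / r n" for n
    using r by (simp add: root_system_def power_divide flip: galois_power[OF \<sigma>])
  ultimately obtain a where "\<And>n. \<sigma> (r n) / r n = unity a n"
    using ex_padic_log[of "\<lambda>n. \<sigma> (r n) / r n"] by blast
  hence "\<exists>a. \<forall>n. \<sigma> (r n) = r n * unity a n" using nz by (auto simp: field_simps)
  hence "\<forall>n. \<sigma> (r n) = r n * unity (kummer_cocycle r \<sigma>) n"
    unfolding kummer_cocycle_def by (rule someI_ex)
  thus ?thesis by blast
qed

end

lemma ex_cyclo_neq_1: "\<exists>\<sigma>\<in>absolute_galois. cyclo \<sigma> \<noteq> 1"
proof -
  obtain n where "\<zeta> n \<notin> range to_ac" using \<zeta>_not_rational by blast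
  then obtain \<sigma> where \<sigma>: "\<sigma> \<in> absolute_galois" "\<sigma> (\<zeta> n) \<noteq> \<zeta> n"
    using absolute_galois_moves[OF char_0] by blast
  have "unity 1 n = \<zeta> n"
    using unity_eqI[of n 1 1] by (simp add: one_padic_int.rep_eq mod_eq_dvd_iff[symmetric])
  with \<sigma> galois_\<zeta> show ?thesis by metis
qed

text \<open>The element \<open>y n\<close> is an \<open>l ^ n\<close>-th root of the product of the
  \<open>c i\<close> with truncated exponents, and \<sigma> multiplies it by
  \<open>unity (t \<sigma>) n\<close>. The product is an \<open>l ^ n\<close>-th power in the base
  field iff \<open>y n\<close> becomes Galois invariant after division by a root of unity, that is,
  iff \<open>t\<close> is a coboundary modulo \<open>l ^ n\<close>.\<close>

theorem kummer_criterion: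
  assumes "finite I" and r: "\<And>i. i \<in> I \<Longrightarrow> root_system (c i) (r i)"
  shows "(\<Sum>i\<in>I. cscale (a i) (compl_map (c i))) = 0 \<longleftrightarrow>
    (\<exists>R. \<forall>\<sigma>\<in>absolute_galois. (\<Sum>i\<in>I. a i * kummer_cocycle (r i) \<sigma>) = (cyclo \<sigma> - 1) * R)"
    (is "?lhs \<longleftrightarrow> ?rhs")
proof -
  define t where "t \<sigma> = (\<Sum>i\<in>I. a i * kummer_cocycle (r i) \<sigma>)" for \<sigma>
  define y where "y n = (\<Prod>i\<in>I. r i n powi residue (a i) n)" for n
  have y_nz: "y n \<noteq> 0" for n
    using root_system_nonzero[OF r] \<open>finite I\<close> by (auto simp: y_def power_int_eq_0_iff)
  have y_pow: "y n ^ (CARD('l) ^ n) = to_ac (\<Prod>i\<in>I. c i powi residue (a i) n)" for n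
  proof -
    have "y n ^ (CARD('l) ^ n) = (\<Prod>i\<in>I. (r i n ^ (CARD('l) ^ n)) powi residue (a i) n)"
      by (simp add: y_def prod_power_distrib power_int_power_commute)
    also have "\<dots> = (\<Prod>i\<in>I. to_ac (c i powi residue (a i) n))"
      using root_system_power[OF r] by (intro prod.cong) (simp_all add: power_int_def)
    finally show ?thesis by (simp add: to_ac_prod)
  qed
  have y_galois: "\<sigma> (y n) = y n * unity (t \<sigma>) n" if "\<sigma> \<in> absolute_galois" for \<sigma> n
  proof -
    have "\<sigma> (y n) = (\<Prod>i\<in>I. (r i n * unity (kummer_cocycle (r i) \<sigma>) n) powi residue (a i) n)"
      by (simp add: y_def galois_prod[OF that] galois_power_int[OF that] galois_root_system[OF that r] cong: prod.cong)
    also have "\<dots> = y n * unity (t \<sigma>) n"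
      by (simp add: y_def t_def unity_sum unity_mult power_int_mult_distrib prod.distrib)
    finally show ?thesis .
  qed
  have c: "c i \<noteq> 0" if "i \<in> I" for i using r[OF that] by (simp add: root_system_def)
  have lhs: "?lhs \<longleftrightarrow> (\<forall>n. \<exists>z. z \<noteq> 0 \<and> (\<Prod>i\<in>I. c i powi residue (a i) n) = z ^ (CARD('l) ^ n))"
    by (rule sum_cscale_compl_map_eq_0_iff) (rule c)
  show ?thesis
  proof
    assume ?rhs
    then obtain R where R: "\<And>\<sigma>. \<sigma> \<in> absolute_galois \<Longrightarrow> t \<sigma> = (cyclo \<sigma> - 1) * R"
      unfolding t_def by blast
    have "\<exists>z. z \<noteq> 0 \<and> (\<Prod>i\<in>I. c i powi residue (a i) n) = z ^ (CARD('l) ^ n)" for n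
    proof -
      \<comment> \<open>Division by \<open>unity R n\<close> cancels the coboundary, so
        \<open>x\<close> is Galois invariant and hence lies in the base field.\<close>
      define x where "x = y n / unity R n"
      have "\<sigma> x = x" if "\<sigma> \<in> absolute_galois" for \<sigma>
      proof -
        have "\<sigma> x * \<sigma> (unity R n) = \<sigma> (y n)" by (simp add: x_def flip: galois_mult[OF that])
        hence "\<sigma> x * unity (cyclo \<sigma> * R) n = y n * unity (cyclo \<sigma> * R - R) n"
          using y_galois[OF that] galois_unity[OF that] R[OF that] by (simp add: algebra_simps)
        thus ?thesis by (simp add: unity_diff x_def field_simps)
      qed
      then obtain z where z: "x = to_ac z" using absolute_galois_moves[OF char_0, of x] by blast
      have "to_ac (z ^ (CARD('l) ^ n)) = to_ac (\<Prod>i\<in>I. c i powi residue (a i) n)"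
        by (simp add: z[symmetric] x_def power_divide y_pow unity_power)
      hence "(\<Prod>i\<in>I. c i powi residue (a i) n) = z ^ (CARD('l) ^ n)" by (simp only: to_ac_eq_iff)
      moreover have "z \<noteq> 0" using y_nz z by (auto simp: x_def)
      ultimately show ?thesis by blast
    qed
    thus ?lhs unfolding lhs by blast
  next
    assume ?lhs
    have "\<exists>R. \<forall>\<sigma>\<in>absolute_galois. residue ((cyclo \<sigma> - 1) * R) n = residue (t \<sigma>) n" for n
    proof -
      obtain z where z: "z \<noteq> 0" "(\<Prod>i\<in>I. c i powi residue (a i) n) = z ^ (CARD('l) ^ n)"
        using \<open>?lhs\<close> unfolding lhs by blast
      have "(y n / to_ac z) ^ (CARD('l) ^ n) = 1" using z by (simp add: power_divide y_pow)
      then obtain R where "y n / to_ac z = unity R n" by (rule root_of_unity')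
      hence R: "y n = to_ac z * unity R n" using z(1) by (simp add: field_simps)
      have "residue ((cyclo \<sigma> - 1) * R) n = residue (t \<sigma>) n" if "\<sigma> \<in> absolute_galois" for \<sigma>
      proof -
        have "to_ac z * unity R n * unity (t \<sigma>) n = to_ac z * unity (cyclo \<sigma> * R) n"
          using y_galois[OF that] R galois_mult[OF that] galois_const[OF that] galois_unity[OF that]
          by metis
        hence "unity ((cyclo \<sigma> - 1) * R) n = unity (t \<sigma>) n"
          using z(1) by (simp add: left_diff_distrib unity_diff field_simps)
        thus ?thesis by (simp add: unity_eq_iff)
      qed
      thus ?thesis by blast
    qed
    then obtain S where S: "\<And>n \<sigma>. \<sigma> \<in> absolute_galois \<Longrightarrow>
        residue ((cyclo \<sigma> - 1) * S n) n = residue (t \<sigma>) n" by metis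
    \<comment> \<open>The \<open>S n\<close> need not be compatible for varying \<open>n\<close>.
      Instead, the equation for one \<tau> with nontrivial character is solved exactly, and its
      solution is shown to work for every \<sigma>.\<close>
    obtain \<tau> where \<tau>: "\<tau> \<in> absolute_galois" "cyclo \<tau> \<noteq> 1" using ex_cyclo_neq_1 by blast
    define \<delta> where "\<delta> = cyclo \<tau> - 1"
    have \<delta>: "\<delta> \<noteq> 0" using \<tau> by (simp add: \<delta>_def)
    \<comment> \<open>Divisibility of \<open>t \<tau>\<close> by \<delta> is visible at the level
      given by the valuation of \<delta>, where \<delta> itself vanishes.\<close>
    have "residue (t \<tau>) (padic_int_val \<delta>) = 0"
      using S[OF \<tau>(1), of "padic_int_val \<delta>"] residue_eq_0_iff[OF \<delta>, of "padic_int_val \<delta>"]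
      by (simp add: times_padic_int.rep_eq flip: \<delta>_def)
    then obtain R where R: "t \<tau> = \<delta> * R" using padic_int_dvdI[OF \<delta>] by blast
    have "t \<sigma> = (cyclo \<sigma> - 1) * R" if \<sigma>: "\<sigma> \<in> absolute_galois" for \<sigma>
    proof -
      \<comment> \<open>Modulo \<open>l ^ n\<close> both \<open>t \<sigma>\<close> and
        \<open>t \<tau>\<close> are coboundaries of the same \<open>S n\<close>, so
        cross-multiplying their equations eliminates it.\<close>
      have "\<delta> * t \<sigma> = \<delta> * ((cyclo \<sigma> - 1) * R)"
      proof (rule padic_int_eqI)
        fix n
        have "residue (\<delta> * t \<sigma>) n = residue (\<delta> * ((cyclo \<sigma> - 1) * S n)) n"
          by (rule residue_mult_cong) (simp add: S[OF \<sigma>])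
        also have "\<delta> * ((cyclo \<sigma> - 1) * S n) = (cyclo \<sigma> - 1) * (\<delta> * S n)" by (simp add: ac_simps)
        also have "residue \<dots> n = residue ((cyclo \<sigma> - 1) * t \<tau>) n"
          by (rule residue_mult_cong) (simp add: S[OF \<tau>(1)] \<delta>_def)
        also have "(cyclo \<sigma> - 1) * t \<tau> = \<delta> * ((cyclo \<sigma> - 1) * R)" by (simp add: R ac_simps)
        finally show "residue (\<delta> * t \<sigma>) n = residue (\<delta> * ((cyclo \<sigma> - 1) * R)) n" .
      qed
      thus ?thesis using \<delta> by simp
    qed
    thus ?rhs unfolding t_def by blast
  qed
qed

end

text \<open>A root of the sum of the first \<open>l\<close> powers of the variable differs from
  \<open>1\<close> in characteristic zero and starts the tower. Arbitrary further
  \<open>l\<close>-th roots continue it, and \<open>no_infinite_root_tower\<close> prevents all of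
  them from lying in the base field.\<close>

lemma (in padic_field) ex_kummer:
  obtains \<zeta> where "kummer TYPE('l::prime_card) (\<zeta> :: nat \<Rightarrow> 'k alg_closure)"
proof -
  let ?l = "CARD('l)"
  have l: "?l > 1" using card_gt_1[where 'p='l] by simp
  have "\<exists>y. y ^ ?l = x" for x :: "'k alg_closure"
    using l by (intro nth_root_exists) simp
  then obtain f where f: "\<And>x :: 'k alg_closure. f x ^ ?l = x" by metis
  define p where "p = (\<Sum>i<?l. Polynomial.monom (1 :: 'k alg_closure) i)"
  have p: "poly p x = (\<Sum>i<?l. x ^ i)" for x by (simp add: p_def poly_sum poly_monom)
  have "coeff p (?l - 1) = 1" using l by (simp add: p_def coeff_sum)
  hence "?l - 1 \<le> degree p" by (intro le_degree) simp
  hence "degree p > 0" using l by simp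
  then obtain w where w: "poly p w = 0" using alg_closed_imp_poly_has_root by blast
  have w1: "w \<noteq> 1"
  proof
    assume "w = 1"
    hence "to_ac (of_nat ?l :: 'k) = 0" using w by (simp add: p)
    thus False using of_nat_neq_0[of ?l] l by (simp only: to_ac_eq_0_iff)
  qed
  have wl: "w ^ ?l = 1" using power_diff_1_eq[of w ?l] w by (simp add: p)
  define \<zeta> where "\<zeta> n = (case n of 0 \<Rightarrow> 1 | Suc m \<Rightarrow> (f ^^ m) w)" for n
  have \<zeta>: "\<zeta> 0 = 1" "\<zeta> 1 = w" "\<zeta> (Suc n) ^ ?l = \<zeta> n" for n
    using wl f by (auto simp: \<zeta>_def split: nat.splits)
  have "\<exists>n. \<zeta> n \<notin> range to_ac"
  proof (rule ccontr)
    assume "\<not> ?thesis"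
    hence "\<forall>n. \<exists>z. \<zeta> n = to_ac z" by blast
    then obtain z where z: "\<And>n. \<zeta> n = to_ac (z n)" by metis
    show False
    proof (rule no_infinite_root_tower[OF prime_card[where 'a='l]])
      show "z 0 = 1" "z 1 \<noteq> 1" using \<zeta>(1,2) w1 unfolding z by (metis to_ac_1 to_ac_eq_iff)+
      show "z (Suc n) ^ ?l = z n" for n using \<zeta>(3)[of n] unfolding z by (metis to_ac_eq_iff to_ac_power)
    qed
  qed
  hence "kummer TYPE('l) \<zeta>"
    using \<zeta> w1 of_nat_neq_0 by unfold_locales auto
  thus ?thesis using that by blast
qed

section \<open>A basis of the Tate module\<close>

lemma vmap_nth [simp]: "vmap f v $ i = f (v $ i)"
  by (simp add: vmap_def)

lemma row_prod_nth: "row_prod Q n $ j = (\<Prod>i\<in>UNIV. (Q $ i $ j) powi n i)"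
  by (simp add: row_prod_def)

lemma comm_group_torus: "comm_group (torus :: ('f::field ^ 'g) monoid)"
proof (rule comm_groupI)
  show "\<exists>y\<in>carrier torus. y \<otimes>\<^bsub>torus\<^esub> x = \<one>\<^bsub>torus\<^esub>"
    if "x \<in> carrier torus" for x :: "'f ^ 'g"
    using that by (intro bexI[of _ "\<chi> i. inverse (x $ i)"]) (auto simp: torus_def vec_eq_iff)
qed (auto simp: torus_def vec_eq_iff algebra_simps)

lemma to_ac_power_int: "to_ac (x powi n) = to_ac x powi n"
  by (simp add: power_int_def)

locale period_lattice = kummer \<zeta> l_type
  for \<zeta> :: "nat \<Rightarrow> 'k::field alg_closure" and l_type :: "'l::prime_card itself" +
  fixes \<Lambda> :: "('k ^ 'g) set" and Q :: "'k ^ 'g ^ 'g"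
    and r :: "'g \<Rightarrow> 'g \<Rightarrow> nat \<Rightarrow> 'k alg_closure"
  assumes period: "is_period_matrix \<Lambda> Q"
    and roots: "root_system (Q $ i $ j) (r i j)"
begin

section \<open>The lattice and its cosets over the algebraic closure\<close>

lemma entries_nonzero [simp]: "Q $ i $ j \<noteq> 0"
  and inj_row_prod: "inj (row_prod Q)"
  and \<Lambda>_eq: "\<Lambda> = range (row_prod Q)"
  using period by (auto simp: is_period_matrix_def bij_betw_def)

abbreviation lat where "lat \<equiv> vmap to_ac ` \<Lambda>"

abbreviation coset where "coset y \<equiv> lat #>\<^bsub>torus\<^esub> y"

lemma row_prod_add: "row_prod Q (\<lambda>i. m i + n i) = row_prod Q m * row_prod Q n"
  by (simp add: vec_eq_iff row_prod_nth power_int_add prod.distrib)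

lemma row_prod_neq_0: "row_prod Q n $ j \<noteq> 0"
  by (simp add: row_prod_nth power_int_eq_0_iff)

lemma row_prod_diff: "row_prod Q (\<lambda>i. m i - n i) $ j = row_prod Q m $ j / row_prod Q n $ j"
  using arg_cong[OF row_prod_add[of "\<lambda>i. m i - n i" n], of "\<lambda>v. v $ j"] row_prod_neq_0[of n j]
  by (simp add: field_simps)

lemma to_ac_row_prod: "to_ac (row_prod Q n $ j) = (\<Prod>i\<in>UNIV. to_ac (Q $ i $ j) powi n i)"
  by (simp add: row_prod_nth to_ac_prod to_ac_power_int)

lemma subgroup_lat: "subgroup lat torus"
proof -
  interpret T: comm_group "torus :: ('k alg_closure ^ 'g) monoid" by (rule comm_group_torus)
  show ?thesis
  proof (rule T.subgroupI)
    show "lat \<subseteq> carrier torus" by (auto simp: torus_def \<Lambda>_eq row_prod_neq_0)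
    show "lat \<noteq> {}" by (auto simp: \<Lambda>_eq)
  next
    fix a assume "a \<in> lat"
    then obtain n where n: "a = vmap to_ac (row_prod Q n)" by (auto simp: \<Lambda>_eq)
    have "row_prod Q (\<lambda>i. - n i) $ j * row_prod Q n $ j = 1" for j
      using row_prod_diff[of "\<lambda>i. 0" n j] by (simp add: row_prod_neq_0) (simp add: row_prod_nth)
    hence "inv\<^bsub>torus\<^esub> a = vmap to_ac (row_prod Q (\<lambda>i. - n i))"
      by (intro T.inv_equality) (simp_all add: n torus_def vec_eq_iff row_prod_neq_0 flip: to_ac_mult)
    thus "inv\<^bsub>torus\<^esub> a \<in> lat" by (auto simp: \<Lambda>_eq)
  next
    fix a b assume "a \<in> lat" "b \<in> lat"
    then obtain m n where "a = vmap to_ac (row_prod Q m)" "b = vmap to_ac (row_prod Q n)"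
      by (auto simp: \<Lambda>_eq)
    hence "a \<otimes>\<^bsub>torus\<^esub> b = vmap to_ac (row_prod Q (\<lambda>i. m i + n i))"
      by (simp add: torus_def vec_eq_iff row_prod_add)
    thus "a \<otimes>\<^bsub>torus\<^esub> b \<in> lat" by (auto simp: \<Lambda>_eq)
  qed
qed

lemma normal_lat: "lat \<lhd> torus"
proof -
  interpret T: comm_group "torus :: ('k alg_closure ^ 'g) monoid" by (rule comm_group_torus)
  show ?thesis by (rule T.subgroup_imp_normal) (rule subgroup_lat)
qed

lemma coset_eq_iff:
  assumes "y \<in> carrier torus" "z \<in> carrier torus"
  shows "coset y = coset z \<longleftrightarrow> (\<exists>h\<in>lat. y = h * z)"
proof -
  interpret T: comm_group "torus :: ('k alg_closure ^ 'g) monoid" by (rule comm_group_torus)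
  have "coset y = coset z \<longleftrightarrow> y \<in> coset z"
    using assms subgroup_lat T.rcos_self T.repr_independence by metis
  thus ?thesis by (auto simp: r_coset_def torus_def)
qed

lemma coset_mult:
  assumes "y \<in> carrier torus" "z \<in> carrier torus"
  shows "coset y \<otimes>\<^bsub>abeloid_points \<Lambda>\<^esub> coset z = coset (y * z)"
  using normal.rcos_sum[OF normal_lat assms] by (simp add: abeloid_points_def torus_def)

lemma coset_one: "\<one>\<^bsub>abeloid_points \<Lambda>\<^esub> = coset 1"
proof -
  have "coset 1 = lat" by (auto simp: r_coset_def torus_def)
  thus ?thesis by (simp add: abeloid_points_def)
qed

lemma one_in_torus: "1 \<in> carrier torus"
  by (simp add: torus_def)

lemma coset_pow:
  assumes "y \<in> carrier torus"
  shows "coset y [^]\<^bsub>abeloid_points \<Lambda>\<^esub> k = coset (\<chi> j. (y $ j) ^ k)"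
proof (induction k)
  case 0
  have "(\<chi> j. (y $ j) ^ 0) = 1" by (simp add: vec_eq_iff)
  thus ?case by (simp add: coset_one)
next
  case (Suc k)
  have "(\<chi> j. (y $ j) ^ k) \<in> carrier torus" using assms by (simp add: torus_def)
  moreover have "(\<chi> j. (y $ j) ^ k) * y = (\<chi> j. (y $ j) ^ Suc k)" by (simp add: vec_eq_iff mult.commute)
  ultimately show ?case using assms Suc coset_mult by simp
qed

lemma carrier_abeloid_points: "carrier (abeloid_points \<Lambda>) = coset ` carrier torus"
  by (simp add: abeloid_points_def carrier_FactGroup)

text \<open>Representatives of the \<open>l ^ n\<close>-torsion of the quotient: \<open>u\<close> is
  the exponent of the root of unity in each coordinate, and \<open>a\<close> selects a product of
  the chosen \<open>l ^ n\<close>-th roots of the periods.\<close>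

definition level :: "nat \<Rightarrow> ('g \<Rightarrow> int) \<Rightarrow> ('g \<Rightarrow> int) \<Rightarrow> 'k alg_closure ^ 'g"
  where "level n u a = (\<chi> j. \<zeta> n powi u j * (\<Prod>i\<in>UNIV. r i j n powi a i))"

lemma r_nonzero [simp]: "r i j n \<noteq> 0"
  using root_system_nonzero[OF roots] .

lemma level_in_torus [simp]: "level n u a \<in> carrier torus"
  by (simp add: level_def torus_def power_int_eq_0_iff)

lemma level_add: "level n (\<lambda>j. u j + u' j) (\<lambda>i. a i + a' i) = level n u a * level n u' a'"
  by (simp add: level_def vec_eq_iff power_int_add prod.distrib)

lemma level_diff: "level n u a = level n (\<lambda>j. u j - u' j) (\<lambda>i. a i - a' i) * level n u' a'"
  using level_add[of n "\<lambda>j. u j - u' j" u' "\<lambda>i. a i - a' i" a'] by simp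

lemma level_power: "(\<chi> j. (level n u a $ j) ^ k) = level n (\<lambda>j. int k * u j) (\<lambda>i. int k * a i)"
proof -
  have "(x powi b) ^ k = x powi (int k * b)" for x :: "'k alg_closure" and b
    by (simp add: power_int_power_commute power_int_mult)
  thus ?thesis by (simp add: level_def vec_eq_iff power_mult_distrib prod_power_distrib)
qed

lemma level_Suc: "(\<chi> j. (level (Suc n) u a $ j) ^ CARD('l)) = level n u a"
proof -
  have "r i j (Suc n) ^ CARD('l) = r i j n" for i j using roots[of i j] by (simp add: root_system_def)
  thus ?thesis
    by (simp add: level_def vec_eq_iff power_mult_distrib prod_power_distrib power_int_power_commute \<zeta>_Suc)
qed

lemma r_power_int: "r i j n powi (int CARD('l) ^ n * k) = to_ac (Q $ i $ j) powi k"
proof -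
  have "r i j n powi (int CARD('l) ^ n * k) = (r i j n powi int (CARD('l) ^ n)) powi k"
    by (simp only: power_int_mult of_nat_power)
  thus ?thesis by (simp only: power_int_of_nat root_system_power[OF roots])
qed

text \<open>Raising to the power \<open>l ^ n\<close> removes the roots of unity and leaves periods.
  Independence of the rows then forces \<open>a\<close> to be \<open>l ^ n\<close> times the
  exponents of the lattice point, and what remains is \<open>\<zeta> n powi u j = 1\<close>.\<close>

lemma level_in_lat_iff:
  "level n u a \<in> lat \<longleftrightarrow> (\<forall>j. int CARD('l) ^ n dvd u j) \<and> (\<forall>i. int CARD('l) ^ n dvd a i)"
proof
  assume "level n u a \<in> lat"
  then obtain b where b: "level n u a = vmap to_ac (row_prod Q b)" by (auto simp: \<Lambda>_eq)
  have eq: "\<zeta> n powi u j * (\<Prod>i\<in>UNIV. r i j n powi a i) = to_ac (row_prod Q b $ j)" for j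
    using arg_cong[OF b, of "\<lambda>v. v $ j"] by (simp add: level_def)
  have "row_prod Q a = row_prod Q (\<lambda>i. int CARD('l) ^ n * b i)"
  proof (subst vec_eq_iff, intro allI)
    fix j
    have "to_ac (row_prod Q a $ j) = (\<zeta> n powi u j * (\<Prod>i\<in>UNIV. r i j n powi a i)) ^ (CARD('l) ^ n)"
      by (simp add: power_mult_distrib prod_power_distrib power_int_power_commute \<zeta>_power
          root_system_power[OF roots] to_ac_row_prod)
    also have "\<dots> = to_ac (row_prod Q (\<lambda>i. int CARD('l) ^ n * b i) $ j)"
      unfolding eq to_ac_row_prod prod_power_distrib
      by (simp add: power_int_power_commute power_int_mult flip: of_nat_power)
    finally show "row_prod Q a $ j = row_prod Q (\<lambda>i. int CARD('l) ^ n * b i) $ j"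
      by (simp only: to_ac_eq_iff)
  qed
  hence a: "a = (\<lambda>i. int CARD('l) ^ n * b i)" using inj_row_prod by (simp add: inj_eq)
  have "\<zeta> n powi u j = 1" for j
  proof -
    have "(\<Prod>i\<in>UNIV. r i j n powi a i) = to_ac (row_prod Q b $ j)"
      by (simp add: a r_power_int to_ac_row_prod)
    thus ?thesis using eq[of j] row_prod_neq_0[of b j] by simp
  qed
  with a show "(\<forall>j. int CARD('l) ^ n dvd u j) \<and> (\<forall>i. int CARD('l) ^ n dvd a i)"
    by (simp add: \<zeta>_power_int_eq_1_iff)
next
  assume *: "(\<forall>j. int CARD('l) ^ n dvd u j) \<and> (\<forall>i. int CARD('l) ^ n dvd a i)"
  then obtain b where b: "\<And>i. a i = int CARD('l) ^ n * b i" unfolding dvd_def by metis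
  have "level n u a = vmap to_ac (row_prod Q b)"
    using * by (simp add: level_def vec_eq_iff \<zeta>_power_int_eq_1 b r_power_int to_ac_row_prod)
  thus "level n u a \<in> lat" by (auto simp: \<Lambda>_eq)
qed

lemma coset_level_eq_iff:
  "coset (level n u a) = coset (level n u' a') \<longleftrightarrow>
    (\<forall>j. int CARD('l) ^ n dvd u j - u' j) \<and> (\<forall>i. int CARD('l) ^ n dvd a i - a' i)"
proof -
  let ?d = "level n (\<lambda>j. u j - u' j) (\<lambda>i. a i - a' i)"
  have "level n u a = h * level n u' a' \<longleftrightarrow> h = ?d" for h
    by (subst level_diff[of n u a u' a']) (auto simp: vec_eq_iff level_def power_int_eq_0_iff)
  hence "coset (level n u a) = coset (level n u' a') \<longleftrightarrow> ?d \<in> lat"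
    by (simp only: coset_eq_iff[OF level_in_torus level_in_torus] bex_triv_one_point1)
  thus ?thesis by (simp only: level_in_lat_iff)
qed

lemma ex_level:
  assumes y: "y \<in> carrier torus" and "(\<chi> j. (y $ j) ^ (CARD('l) ^ n)) \<in> lat"
  shows "\<exists>u a. y = level n u a"
proof -
  obtain a where a: "(\<chi> j. (y $ j) ^ (CARD('l) ^ n)) = vmap to_ac (row_prod Q a)"
    using assms by (auto simp: \<Lambda>_eq)
  have "\<exists>k. y $ j = \<zeta> n powi k * (\<Prod>i\<in>UNIV. r i j n powi a i)" for j
  proof -
    let ?p = "\<Prod>i\<in>UNIV. r i j n powi a i"
    have p: "?p \<noteq> 0" by (simp add: power_int_eq_0_iff)
    have "?p ^ (CARD('l) ^ n) = to_ac (row_prod Q a $ j)"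
      by (simp add: prod_power_distrib power_int_power_commute root_system_power[OF roots] to_ac_row_prod)
    also have "\<dots> = (y $ j) ^ (CARD('l) ^ n)"
      using arg_cong[OF a, of "\<lambda>v. v $ j"] by simp
    finally have "(y $ j / ?p) ^ (CARD('l) ^ n) = 1"
      using y by (simp add: power_divide torus_def)
    then obtain k where "y $ j / ?p = \<zeta> n powi k" by (rule root_of_unity)
    thus ?thesis using p by (auto simp: field_simps intro!: exI[of _ k])
  qed
  then obtain u where "\<And>j. y $ j = \<zeta> n powi u j * (\<Prod>i\<in>UNIV. r i j n powi a i)" by metis
  thus ?thesis by (intro exI[of _ u] exI[of _ a]) (simp add: level_def vec_eq_iff)
qed

text \<open>Coordinates on the Tate module: \<open>u\<close> describes the part coming from the
  torus, \<open>a\<close> the image in the quotient, which is the \<open>l\<close>-adic completion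
  of the group of exponents.\<close>

definition tate_point :: "'l padic_int ^ 'g \<Rightarrow> 'l padic_int ^ 'g \<Rightarrow> nat \<Rightarrow> ('k alg_closure ^ 'g) set"
  where "tate_point u a n = coset (level n (\<lambda>j. residue (u $ j) n) (\<lambda>i. residue (a $ i) n))"

abbreviation T :: "('l padic_int, nat \<Rightarrow> ('k alg_closure ^ 'g) set) module"
  where "T \<equiv> tate_module \<Lambda>"

lemma tate_simps:
  "carrier T = {x. \<forall>n. x n \<in> carrier (abeloid_points \<Lambda>)
     \<and> x n [^]\<^bsub>abeloid_points \<Lambda>\<^esub> (CARD('l) ^ n) = \<one>\<^bsub>abeloid_points \<Lambda>\<^esub>
     \<and> x (Suc n) [^]\<^bsub>abeloid_points \<Lambda>\<^esub> CARD('l) = x n}"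
  "\<zero>\<^bsub>T\<^esub> = (\<lambda>n. \<one>\<^bsub>abeloid_points \<Lambda>\<^esub>)"
  "x \<oplus>\<^bsub>T\<^esub> y = (\<lambda>n. x n \<otimes>\<^bsub>abeloid_points \<Lambda>\<^esub> y n)"
  "c \<odot>\<^bsub>T\<^esub> x = (\<lambda>n. x n [^]\<^bsub>abeloid_points \<Lambda>\<^esub> nat (residue c n))"
  by (simp_all add: tate_module_def Let_def)

lemma level_0: "level n (\<lambda>j. 0) (\<lambda>i. 0) = 1"
  by (simp add: level_def vec_eq_iff)

lemma tate_point_eq_iff: "tate_point u a = tate_point u' a' \<longleftrightarrow> u = u' \<and> a = a'"
proof
  assume "tate_point u a = tate_point u' a'"
  hence "tate_point u a n = tate_point u' a' n" for n by simp
  hence *: "(\<forall>j. int CARD('l) ^ n dvd residue (u $ j) n - residue (u' $ j) n) \<and>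
      (\<forall>i. int CARD('l) ^ n dvd residue (a $ i) n - residue (a' $ i) n)" for n
    unfolding tate_point_def coset_level_eq_iff .
  have "b = b'" if "\<And>n. int CARD('l) ^ n dvd residue b n - residue b' n" for b b' :: "'l padic_int"
    using that by (intro padic_int_eqI) (metis mod_eq_dvd_iff residue_mod_power)
  with * show "u = u' \<and> a = a'" by (simp add: vec_eq_iff)
qed simp

lemma tate_point_in_carrier [simp]: "tate_point u a \<in> carrier T"
proof -
  let ?A = "abeloid_points \<Lambda>"
  have "tate_point u a n \<in> carrier ?A" for n
    by (simp add: tate_point_def carrier_abeloid_points)
  moreover have "tate_point u a n [^]\<^bsub>?A\<^esub> (CARD('l) ^ n) = \<one>\<^bsub>?A\<^esub>" for n
    by (simp add: tate_point_def coset_pow level_power coset_one coset_level_eq_iff flip: level_0[of n])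
  moreover have "tate_point u a (Suc n) [^]\<^bsub>?A\<^esub> CARD('l) = tate_point u a n" for n
    using dvd_residue_diff[where 'p='l, of n "Suc n"]
    by (simp add: tate_point_def coset_pow level_Suc coset_level_eq_iff)
  ultimately show ?thesis by (simp add: tate_simps)
qed

lemma tate_point_zero: "tate_point 0 0 = \<zero>\<^bsub>T\<^esub>"
  by (simp add: tate_point_def tate_simps fun_eq_iff level_0 coset_one)

lemma tate_point_add: "tate_point u a \<oplus>\<^bsub>T\<^esub> tate_point u' a' = tate_point (u + u') (a + a')"
proof -
  have "int CARD('l) ^ n dvd residue b n + residue b' n - residue (b + b') n" for n and b b' :: "'l padic_int"
    by (simp add: plus_padic_int.rep_eq mod_eq_dvd_iff[symmetric])
  thus ?thesis
    by (simp add: tate_point_def tate_simps fun_eq_iff coset_mult coset_level_eq_iff flip: level_add)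
qed

lemma tate_point_smult: "c \<odot>\<^bsub>T\<^esub> tate_point u a = tate_point (c *s u) (c *s a)"
proof -
  have "int CARD('l) ^ n dvd residue c n * residue b n - residue (c * b) n" for n and b :: "'l padic_int"
    by (simp add: times_padic_int.rep_eq mod_eq_dvd_iff[symmetric])
  thus ?thesis using residue_bounds(1)[of c]
    by (simp add: tate_point_def tate_simps fun_eq_iff coset_pow level_power coset_level_eq_iff
        del: pow_nat)
qed

text \<open>Exponents at level \<open>n\<close> are unique modulo \<open>l ^ n\<close>, so
  compatibility of the torsion points makes them glue to \<open>l\<close>-adic integers.\<close>

lemma tate_point_surj:
  assumes "x \<in> carrier T"
  obtains u a where "x = tate_point u a"
proof -
  let ?A = "abeloid_points \<Lambda>"
  have x: "x n \<in> carrier ?A" "x n [^]\<^bsub>?A\<^esub> (CARD('l) ^ n) = \<one>\<^bsub>?A\<^esub>"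
      "x (Suc n) [^]\<^bsub>?A\<^esub> CARD('l) = x n" for n
    using assms by (auto simp: tate_simps)
  have "\<exists>u a. x n = coset (level n u a)" for n
  proof -
    obtain y where y: "y \<in> carrier torus" "x n = coset y"
      using x(1)[of n] by (auto simp: carrier_abeloid_points)
    let ?z = "\<chi> j. (y $ j) ^ (CARD('l) ^ n)"
    have "coset ?z = coset 1" using x(2)[of n] y by (simp add: coset_pow coset_one)
    moreover have "?z \<in> carrier torus" using y by (simp add: torus_def)
    ultimately have "?z \<in> lat" by (subst (asm) coset_eq_iff) (auto simp: one_in_torus)
    thus ?thesis using ex_level[OF y(1)] y(2) by blast
  qed
  then obtain u a where ua: "\<And>n. x n = coset (level n (u n) (a n))" by metis
  have "coset (level n (u (Suc n)) (a (Suc n))) = coset (level n (u n) (a n))" for n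
    using x(3)[of n] by (simp add: ua coset_pow level_Suc)
  hence dvd: "int CARD('l) ^ n dvd u (Suc n) j - u n j" "int CARD('l) ^ n dvd a (Suc n) j - a n j" for n j
    by (simp_all add: coset_level_eq_iff)
  have "\<exists>b :: 'l padic_int. \<forall>n. residue b n = u n j mod int CARD('l) ^ n" for j
    by (rule ex_padic_int) (rule dvd)
  then obtain u' :: "'g \<Rightarrow> 'l padic_int" where u': "\<And>j n. residue (u' j) n = u n j mod int CARD('l) ^ n"
    by metis
  have "\<exists>b :: 'l padic_int. \<forall>n. residue b n = a n j mod int CARD('l) ^ n" for j
    by (rule ex_padic_int) (rule dvd)
  then obtain a' :: "'g \<Rightarrow> 'l padic_int" where a': "\<And>j n. residue (a' j) n = a n j mod int CARD('l) ^ n"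
    by metis
  have "x = tate_point (\<chi> j. u' j) (\<chi> j. a' j)"
    by (simp add: fun_eq_iff ua tate_point_def coset_level_eq_iff u' a' mod_eq_dvd_iff[symmetric])
  thus ?thesis using that by blast
qed

definition cocycle :: "('k alg_closure \<Rightarrow> 'k alg_closure) \<Rightarrow> 'l padic_int ^ 'g ^ 'g"
  where "cocycle \<sigma> = (\<chi> i j. kummer_cocycle (r i j) \<sigma>)"

text \<open>The periods lie in the base field, so an automorphism changes their roots only by roots
  of unity. Hence \<open>a\<close> is fixed, while the Kummer cocycles contribute to
  \<open>u\<close>.\<close>

lemma tate_point_galois:
  assumes \<sigma>: "\<sigma> \<in> absolute_galois"
  shows "galois_act \<sigma> (tate_point u a) = tate_point (cyclo \<sigma> *s u + a v* cocycle \<sigma>) a"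
proof -
  have coset: "vmap \<sigma> ` coset y = coset (vmap \<sigma> y)" for y
  proof -
    have "vmap \<sigma> (vmap to_ac h * y) = vmap to_ac h * vmap \<sigma> y" for h
      by (simp add: vec_eq_iff galois_mult[OF \<sigma>] galois_const[OF \<sigma>])
    moreover have "coset y = (\<lambda>h. vmap to_ac h * y) ` \<Lambda>" for y by (auto simp: r_coset_def torus_def)
    ultimately show ?thesis by (simp add: image_image)
  qed
  have "vmap \<sigma> (level n (\<lambda>j. residue (u $ j) n) (\<lambda>i. residue (a $ i) n))
      = level n (\<lambda>j. residue ((cyclo \<sigma> *s u + a v* cocycle \<sigma>) $ j) n) (\<lambda>i. residue (a $ i) n)" for n
  proof (subst vec_eq_iff, intro allI)
    fix j
    have "vmap \<sigma> (level n (\<lambda>j. residue (u $ j) n) (\<lambda>i. residue (a $ i) n)) $ j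
        = \<sigma> (unity (u $ j) n * (\<Prod>i\<in>UNIV. r i j n powi residue (a $ i) n))"
      by (simp add: level_def unity_def)
    also have "\<dots> = unity (cyclo \<sigma> * u $ j) n *
        (\<Prod>i\<in>UNIV. (r i j n * unity (kummer_cocycle (r i j) \<sigma>) n) powi residue (a $ i) n)"
      by (simp add: galois_mult[OF \<sigma>] galois_prod[OF \<sigma>] galois_power_int[OF \<sigma>] galois_unity[OF \<sigma>]
          galois_root_system[OF \<sigma> roots])
    also have "\<dots> = unity (cyclo \<sigma> * u $ j + (\<Sum>i\<in>UNIV. a $ i * kummer_cocycle (r i j) \<sigma>)) n
        * (\<Prod>i\<in>UNIV. r i j n powi residue (a $ i) n)"
      by (simp add: power_int_mult_distrib prod.distrib unity_add unity_sum unity_mult)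
    also have "cyclo \<sigma> * u $ j + (\<Sum>i\<in>UNIV. a $ i * kummer_cocycle (r i j) \<sigma>)
        = (cyclo \<sigma> *s u + a v* cocycle \<sigma>) $ j"
      by (simp add: vector_matrix_mult_def cocycle_def mult.commute)
    finally show "vmap \<sigma> (level n (\<lambda>j. residue (u $ j) n) (\<lambda>i. residue (a $ i) n)) $ j
      = level n (\<lambda>j. residue ((cyclo \<sigma> *s u + a v* cocycle \<sigma>) $ j) n) (\<lambda>i. residue (a $ i) n) $ j"
      by (simp add: level_def unity_def)
  qed
  thus ?thesis by (simp add: fun_eq_iff galois_act_def tate_point_def coset)
qed

end

section \<open>Equivariant homomorphisms of Tate modules\<close>

text \<open>Supplies the module axioms for the equivariant homomorphisms by pulling them back along
  the bijection with matrices.\<close>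

lemma module_transport:
  fixes R (structure)
  assumes N: "Module.module R N"
    and f: "bij_betw f (carrier M) (carrier N)"
    and zero: "\<zero>\<^bsub>M\<^esub> \<in> carrier M"
    and add: "\<And>x y. x \<in> carrier M \<Longrightarrow> y \<in> carrier M \<Longrightarrow> x \<oplus>\<^bsub>M\<^esub> y \<in> carrier M"
    and smult: "\<And>a x. a \<in> carrier R \<Longrightarrow> x \<in> carrier M \<Longrightarrow> a \<odot>\<^bsub>M\<^esub> x \<in> carrier M"
    and f_zero: "f \<zero>\<^bsub>M\<^esub> = \<zero>\<^bsub>N\<^esub>"
    and f_add: "\<And>x y. x \<in> carrier M \<Longrightarrow> y \<in> carrier M \<Longrightarrow> f (x \<oplus>\<^bsub>M\<^esub> y) = f x \<oplus>\<^bsub>N\<^esub> f y"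
    and f_smult: "\<And>a x. a \<in> carrier R \<Longrightarrow> x \<in> carrier M \<Longrightarrow> f (a \<odot>\<^bsub>M\<^esub> x) = a \<odot>\<^bsub>N\<^esub> f x"
  shows "Module.module R M"
proof -
  interpret N: Module.module R N by (rule N)
  have inj: "x = y" if "f x = f y" "x \<in> carrier M" "y \<in> carrier M" for x y
    using f that by (auto simp: bij_betw_def inj_on_def)
  have im: "f x \<in> carrier N" if "x \<in> carrier M" for x
    using f that by (auto simp: bij_betw_def)
  show ?thesis
  proof (rule moduleI)
    show "cring R" by (rule N.R.is_cring)
    show "abelian_group M"
    proof (rule abelian_groupI)
      fix x y z assume xyz: "x \<in> carrier M" "y \<in> carrier M" "z \<in> carrier M"
      show "x \<oplus>\<^bsub>M\<^esub> y \<oplus>\<^bsub>M\<^esub> z = x \<oplus>\<^bsub>M\<^esub> (y \<oplus>\<^bsub>M\<^esub> z)"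
        by (rule inj) (simp_all add: xyz add f_add im N.M.a_assoc)
    next
      fix x y assume xy: "x \<in> carrier M" "y \<in> carrier M"
      show "x \<oplus>\<^bsub>M\<^esub> y = y \<oplus>\<^bsub>M\<^esub> x"
        by (rule inj) (simp_all add: xy add f_add im N.M.a_comm)
    next
      fix x assume x: "x \<in> carrier M"
      show "\<zero>\<^bsub>M\<^esub> \<oplus>\<^bsub>M\<^esub> x = x"
        by (rule inj) (simp_all add: x add zero f_add f_zero im)
      have "\<ominus>\<^bsub>N\<^esub> f x \<in> carrier N" using x im by simp
      then obtain y where y: "y \<in> carrier M" "f y = \<ominus>\<^bsub>N\<^esub> f x"
        using f unfolding bij_betw_def by (metis imageE)
      have "y \<oplus>\<^bsub>M\<^esub> x = \<zero>\<^bsub>M\<^esub>"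
        by (rule inj) (simp_all add: x y add zero f_add f_zero im N.M.l_neg)
      with y show "\<exists>y\<in>carrier M. y \<oplus>\<^bsub>M\<^esub> x = \<zero>\<^bsub>M\<^esub>" by blast
    qed (use add zero in auto)
  next
    fix a b x assume *: "a \<in> carrier R" "b \<in> carrier R" "x \<in> carrier M"
    show "(a \<oplus> b) \<odot>\<^bsub>M\<^esub> x = a \<odot>\<^bsub>M\<^esub> x \<oplus>\<^bsub>M\<^esub> b \<odot>\<^bsub>M\<^esub> x"
      by (rule inj) (simp_all add: * add smult f_add f_smult im N.smult_l_distr)
    show "(a \<otimes> b) \<odot>\<^bsub>M\<^esub> x = a \<odot>\<^bsub>M\<^esub> (b \<odot>\<^bsub>M\<^esub> x)"
      by (rule inj) (simp_all add: * add smult f_add f_smult im N.smult_assoc1)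
  next
    fix a x y assume *: "a \<in> carrier R" "x \<in> carrier M" "y \<in> carrier M"
    show "a \<odot>\<^bsub>M\<^esub> (x \<oplus>\<^bsub>M\<^esub> y) = a \<odot>\<^bsub>M\<^esub> x \<oplus>\<^bsub>M\<^esub> a \<odot>\<^bsub>M\<^esub> y"
      by (rule inj) (simp_all add: * add smult f_add f_smult im N.smult_r_distr)
  next
    fix x assume *: "x \<in> carrier M"
    show "\<one> \<odot>\<^bsub>M\<^esub> x = x"
      by (rule inj) (simp_all add: * add smult f_add f_smult im)
  qed (rule smult)
qed

lemma mmap_nth [simp]: "mmap f A $ i $ j = f (A $ i $ j)"
  by (simp add: mmap_def)

lemma module_matrix_module:
  fixes S :: "('r::comm_ring_1 ^ 'h ^ 'g) set"
  assumes "0 \<in> S" "\<And>x y. x \<in> S \<Longrightarrow> y \<in> S \<Longrightarrow> x + y \<in> S"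
    "\<And>a x. x \<in> S \<Longrightarrow> mmap ((*) a) x \<in> S"
  shows "Module.module (ring_of_type_algebra :: 'r ring) (matrix_module S)"
proof (rule moduleI)
  show "cring (ring_of_type_algebra :: 'r ring)" ..
  show "abelian_group (matrix_module S)"
  proof (rule abelian_groupI)
    fix x assume "x \<in> carrier (matrix_module S)"
    thus "\<exists>y\<in>carrier (matrix_module S). y \<oplus>\<^bsub>matrix_module S\<^esub> x = \<zero>\<^bsub>matrix_module S\<^esub>"
      using assms(3)[of x "- 1"]
      by (intro bexI[of _ "mmap ((*) (- 1)) x"]) (auto simp: matrix_module_def vec_eq_iff)
  qed (use assms in \<open>auto simp: matrix_module_def\<close>)
qed (use assms in \<open>auto simp: matrix_module_def ring_of_type_algebra_def vec_eq_iff algebra_simps\<close>)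

lemma additive_homogeneous_eq_vector_matrix_mult:
  fixes g :: "'r::comm_ring_1 ^ 'n \<Rightarrow> 'r ^ 'm"
  assumes add: "\<And>u v. g (u + v) = g u + g v" and scale: "\<And>c u. g (c *s u) = c *s g u"
  shows "g u = u v* (\<chi> i. g (axis i 1))"
proof -
  have g0: "g 0 = 0" using scale[of 0 0] by simp
  have "g (sum f I) = (\<Sum>i\<in>I. g (f i))" for f and I :: "'n set"
    by (induction I rule: infinite_finite_induct) (simp_all add: g0 add)
  hence "g (\<Sum>i\<in>UNIV. (u $ i) *s axis i 1) = (\<Sum>i\<in>UNIV. u $ i *s g (axis i 1))"
    by (simp add: scale)
  thus ?thesis by (simp add: basis_expansion vec_eq_iff vector_matrix_mult_def)
qed

lemma axis_vector_matrix_mult: "axis i (1 :: 'r::comm_ring_1) v* A = A $ i"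
proof -
  have "(\<Sum>k\<in>UNIV. axis i 1 $ k * A $ k $ j) = (\<Sum>k\<in>UNIV. if k = i then A $ k $ j else 0)" for j
    by (rule sum.cong) (auto simp: axis_def)
  thus ?thesis by (simp add: vec_eq_iff vector_matrix_mult_def)
qed

lemma matrix_mult_nth: "(A ** B) $ i = A $ i v* B"
  by (simp add: matrix_matrix_mult_def vector_matrix_mult_def)

locale period_lattice_pair =
  A: period_lattice \<zeta> l_type \<Lambda>\<^sub>A Q\<^sub>A r\<^sub>A + B: period_lattice \<zeta> l_type \<Lambda>\<^sub>B Q\<^sub>B r\<^sub>B
  for \<zeta> :: "nat \<Rightarrow> 'k::field alg_closure" and l_type :: "'l::prime_card itself"
    and \<Lambda>\<^sub>A :: "('k ^ 'g) set" and Q\<^sub>A r\<^sub>A and \<Lambda>\<^sub>B :: "('k ^ 'h) set" and Q\<^sub>B r\<^sub>B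
begin

definition kummer_compatible ::
  "'l padic_int ^ 'h ^ 'g \<Rightarrow> 'l padic_int ^ 'h ^ 'g \<Rightarrow> 'l padic_int ^ 'h ^ 'g \<Rightarrow> bool"
  where "kummer_compatible M N R \<longleftrightarrow> (\<forall>\<sigma>\<in>absolute_galois.
    A.cocycle \<sigma> ** M - N ** B.cocycle \<sigma> = mmap ((*) (A.cyclo \<sigma> - 1)) R)"

text \<open>Each entry of the matrix equation is one relation over the index type
  \<open>'g + 'h\<close>, with a column of \<open>M\<close> and the negative of a row of
  \<open>N\<close> as exponents. The entries of \<open>R\<close> can be chosen
  independently.\<close>

lemma matrix_kummer_criterion:
  "mat_rmult cscale (mmap compl_map Q\<^sub>A) M = mat_lmult cscale N (mmap compl_map Q\<^sub>B) \<longleftrightarrow>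
    (\<exists>R. kummer_compatible M N R)"
proof -
  let ?a = "\<lambda>i k s. case s of Inl j \<Rightarrow> M $ j $ k | Inr l \<Rightarrow> - N $ i $ l"
  let ?c = "\<lambda>i k s. case s of Inl j \<Rightarrow> Q\<^sub>A $ i $ j | Inr l \<Rightarrow> Q\<^sub>B $ l $ k"
  let ?r = "\<lambda>i k s. case s of Inl j \<Rightarrow> r\<^sub>A i j | Inr l \<Rightarrow> r\<^sub>B l k"
  have split: "sum f UNIV = (\<Sum>j\<in>UNIV. f (Inl j)) + (\<Sum>l\<in>UNIV. f (Inr l))"
    for f :: "'g + 'h \<Rightarrow> 'b::comm_monoid_add"
    by (simp add: sum.Plus UNIV_Plus_UNIV[symmetric] del: UNIV_Plus_UNIV)
  have "mat_rmult cscale (mmap compl_map Q\<^sub>A) M = mat_lmult cscale N (mmap compl_map Q\<^sub>B) \<longleftrightarrow>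
      (\<forall>i k. (\<Sum>s\<in>UNIV. cscale (?a i k s) (compl_map (?c i k s))) = (0 :: ('k, 'l) mult_completion))"
    by (simp add: split mat_rmult_def mat_lmult_def vec_eq_iff cscale.scale_minus_left sum_negf)
  also have "\<dots> \<longleftrightarrow> (\<forall>i k. \<exists>R. \<forall>\<sigma>\<in>absolute_galois.
      (\<Sum>s\<in>UNIV. ?a i k s * A.kummer_cocycle (?r i k s) \<sigma>) = (A.cyclo \<sigma> - 1) * R)"
    by (intro iff_allI A.kummer_criterion) (auto simp: A.roots B.roots split: sum.splits)
  also have "\<dots> \<longleftrightarrow> (\<forall>i k. \<exists>R. \<forall>\<sigma>\<in>absolute_galois.
      (A.cocycle \<sigma> ** M - N ** B.cocycle \<sigma>) $ i $ k = (A.cyclo \<sigma> - 1) * R)"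
    by (simp add: split matrix_matrix_mult_def A.cocycle_def B.cocycle_def sum_negf mult.commute)
  also have "\<dots> \<longleftrightarrow> (\<exists>R. \<forall>i k. \<forall>\<sigma>\<in>absolute_galois.
      (A.cocycle \<sigma> ** M - N ** B.cocycle \<sigma>) $ i $ k = (A.cyclo \<sigma> - 1) * R i k)"
    by metis
  also have "\<dots> \<longleftrightarrow> (\<exists>R. kummer_compatible M N R)"
  proof
    assume "\<exists>R. \<forall>i k. \<forall>\<sigma>\<in>absolute_galois.
      (A.cocycle \<sigma> ** M - N ** B.cocycle \<sigma>) $ i $ k = (A.cyclo \<sigma> - 1) * R i k"
    then obtain R where "\<forall>i k. \<forall>\<sigma>\<in>absolute_galois.
      (A.cocycle \<sigma> ** M - N ** B.cocycle \<sigma>) $ i $ k = (A.cyclo \<sigma> - 1) * R i k" ..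
    hence "kummer_compatible M N (\<chi> i k. R i k)" by (simp add: kummer_compatible_def vec_eq_iff)
    thus "\<exists>R. kummer_compatible M N R" ..
  next
    assume "\<exists>R. kummer_compatible M N R"
    then obtain R where "kummer_compatible M N R" ..
    thus "\<exists>R. \<forall>i k. \<forall>\<sigma>\<in>absolute_galois.
      (A.cocycle \<sigma> ** M - N ** B.cocycle \<sigma>) $ i $ k = (A.cyclo \<sigma> - 1) * R i k"
      by (intro exI[of _ "\<lambda>i k. R $ i $ k"]) (simp add: kummer_compatible_def vec_eq_iff)
  qed
  finally show ?thesis .
qed

abbreviation H :: "('l padic_int, (nat \<Rightarrow> ('k alg_closure ^ 'g) set) \<Rightarrow> nat \<Rightarrow> ('k alg_closure ^ 'h) set) module"
  where "H \<equiv> hom_galois \<Lambda>\<^sub>A \<Lambda>\<^sub>B"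

lemma hom_simps:
  "carrier H = {f \<in> carrier A.T \<rightarrow>\<^sub>E carrier B.T.
       (\<forall>x\<in>carrier A.T. \<forall>y\<in>carrier A.T. f (x \<oplus>\<^bsub>A.T\<^esub> y) = f x \<oplus>\<^bsub>B.T\<^esub> f y) \<and>
       (\<forall>a. \<forall>x\<in>carrier A.T. f (a \<odot>\<^bsub>A.T\<^esub> x) = a \<odot>\<^bsub>B.T\<^esub> f x) \<and>
       (\<forall>\<sigma>\<in>absolute_galois. \<forall>x\<in>carrier A.T. f (galois_act \<sigma> x) = galois_act \<sigma> (f x))}"
  "\<zero>\<^bsub>H\<^esub> = (\<lambda>x\<in>carrier A.T. \<zero>\<^bsub>B.T\<^esub>)"
  "f \<oplus>\<^bsub>H\<^esub> g = (\<lambda>x\<in>carrier A.T. f x \<oplus>\<^bsub>B.T\<^esub> g x)"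
  "a \<odot>\<^bsub>H\<^esub> f = (\<lambda>x\<in>carrier A.T. a \<odot>\<^bsub>B.T\<^esub> f x)"
  by (simp_all add: hom_galois_def Let_def)

text \<open>
  The homomorphism is given by the matrix \<open>M\<close> on the Tate modules of the tori, by \<open>N\<close> on the quotients
  by them, and \<open>R\<close> describes the dependence on the chosen root systems.
\<close>

definition represents ::
  "((nat \<Rightarrow> ('k alg_closure ^ 'g) set) \<Rightarrow> nat \<Rightarrow> ('k alg_closure ^ 'h) set) \<Rightarrow>
    'l padic_int ^ 'h ^ 'g \<Rightarrow> 'l padic_int ^ 'h ^ 'g \<Rightarrow> 'l padic_int ^ 'h ^ 'g \<Rightarrow> bool"
  where "represents f M N R \<longleftrightarrow> f \<in> extensional (carrier A.T) \<and>
    (\<forall>u a. f (A.tate_point u a) = B.tate_point (u v* M + a v* R) (a v* N))"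

lemma carrier_T: "x \<in> carrier A.T \<longleftrightarrow> (\<exists>u a. x = A.tate_point u a)"
  by (metis A.tate_point_in_carrier A.tate_point_surj)

lemma ball_T: "(\<forall>x\<in>carrier A.T. P x) \<longleftrightarrow> (\<forall>u a. P (A.tate_point u a))"
  by (metis A.tate_point_in_carrier A.tate_point_surj)

lemma scale_vector_matrix_mult: "(c *s u) v* M = c *s (u v* M :: 'l padic_int ^ 'n)"
  by (simp add: vec_eq_iff vector_matrix_mult_def sum_distrib_left mult.assoc)

lemma hom_represented:
  assumes f: "f \<in> carrier H"
  shows "\<exists>M N R. represents f M N R \<and> kummer_compatible M N R"
proof -
  have ext: "f \<in> extensional (carrier A.T)" using f by (auto simp: hom_simps PiE_def)
  have add: "f (A.tate_point u a \<oplus>\<^bsub>A.T\<^esub> A.tate_point v b) = f (A.tate_point u a) \<oplus>\<^bsub>B.T\<^esub> f (A.tate_point v b)"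
    and scale: "f (c \<odot>\<^bsub>A.T\<^esub> A.tate_point u a) = c \<odot>\<^bsub>B.T\<^esub> f (A.tate_point u a)" for u a v b c
    using f by (auto simp: hom_simps)
  have gal: "f (galois_act \<sigma> (A.tate_point u a)) = galois_act \<sigma> (f (A.tate_point u a))"
    if "\<sigma> \<in> absolute_galois" for \<sigma> u a using f that by (auto simp: hom_simps)
  have "\<exists>w b. f (A.tate_point u a) = B.tate_point w b" for u a
  proof -
    have "f (A.tate_point u a) \<in> carrier B.T" using f by (auto simp: hom_simps PiE_def)
    thus ?thesis by (metis B.tate_point_surj)
  qed
  then obtain p q where pq: "\<And>u a. f (A.tate_point u a) = B.tate_point (p u a) (q u a)" by metis
  have add': "p (u + v) (a + b) = p u a + p v b" "q (u + v) (a + b) = q u a + q v b" for u v a b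
    using add[of u a v b] by (simp_all add: A.tate_point_add B.tate_point_add pq B.tate_point_eq_iff)
  have scale': "p (c *s u) (c *s a) = c *s p u a" "q (c *s u) (c *s a) = c *s q u a" for c u a
    using scale[of c u a] by (simp_all add: A.tate_point_smult B.tate_point_smult pq B.tate_point_eq_iff)
  \<comment> \<open>The four blocks of the homomorphism; \<open>P\<close> is the one from the torus
    part to the quotient and has to vanish.\<close>
  define M where "M = (\<chi> i. p (axis i 1) 0)"
  define P where "P = (\<chi> i. q (axis i 1) 0)"
  define R where "R = (\<chi> i. p 0 (axis i 1))"
  define N where "N = (\<chi> i. q 0 (axis i 1))"
  have M: "p u 0 = u v* M" for u unfolding M_def
    by (rule additive_homogeneous_eq_vector_matrix_mult) (metis add'(1) add_0 scale'(1) vector_smult_rzero)+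
  have P: "q u 0 = u v* P" for u unfolding P_def
    by (rule additive_homogeneous_eq_vector_matrix_mult) (metis add'(2) add_0 scale'(2) vector_smult_rzero)+
  have R: "p 0 u = u v* R" for u unfolding R_def
    by (rule additive_homogeneous_eq_vector_matrix_mult) (metis add'(1) add_0 scale'(1) vector_smult_rzero)+
  have N: "q 0 u = u v* N" for u unfolding N_def
    by (rule additive_homogeneous_eq_vector_matrix_mult) (metis add'(2) add_0 scale'(2) vector_smult_rzero)+
  have p: "p u a = u v* M + a v* R" and q: "q u a = u v* P + a v* N" for u a
    using add'[of u 0 0 a] by (simp_all add: M P R N)
  have eq: "(A.cyclo \<sigma> *s u + a v* A.cocycle \<sigma>) v* M + a v* R
        = A.cyclo \<sigma> *s (u v* M + a v* R) + (u v* P + a v* N) v* B.cocycle \<sigma>"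
      "(A.cyclo \<sigma> *s u + a v* A.cocycle \<sigma>) v* P + a v* N = u v* P + a v* N"
    if "\<sigma> \<in> absolute_galois" for \<sigma> u a
    using gal[OF that, of u a]
    by (simp_all add: A.tate_point_galois[OF that] B.tate_point_galois[OF that] pq p q B.tate_point_eq_iff)
  \<comment> \<open>The automorphism \<tau> acts by its character on the torus part and trivially on
    the quotient, so the nonzero \<open>cyclo \<tau> - 1\<close> annihilates the block between
    them.\<close>
  have "P = 0"
  proof -
    obtain \<tau> where \<tau>: "\<tau> \<in> absolute_galois" "A.cyclo \<tau> \<noteq> 1" using A.ex_cyclo_neq_1 by blast
    have "A.cyclo \<tau> *s (P $ i) = P $ i" for i
      using eq(2)[OF \<tau>(1), of "axis i 1" 0] by (simp add: scale_vector_matrix_mult axis_vector_matrix_mult)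
    hence "A.cyclo \<tau> * P $ i $ j = P $ i $ j" for i j
      by (simp flip: vector_smult_component)
    hence "(A.cyclo \<tau> - 1) * P $ i $ j = 0" for i j
      by (simp add: left_diff_distrib)
    thus ?thesis using \<tau>(2) by (simp add: vec_eq_iff)
  qed
  have "kummer_compatible M N R"
    unfolding kummer_compatible_def
  proof
    fix \<sigma> :: "'k alg_closure \<Rightarrow> 'k alg_closure" assume \<sigma>: "\<sigma> \<in> absolute_galois"
    have "(A.cocycle \<sigma> ** M) $ i + R $ i = A.cyclo \<sigma> *s (R $ i) + (N ** B.cocycle \<sigma>) $ i" for i
      using eq(1)[OF \<sigma>, of 0 "axis i 1"] \<open>P = 0\<close>
      by (simp add: axis_vector_matrix_mult matrix_mult_nth)
    hence "(A.cocycle \<sigma> ** M) $ i $ k + R $ i $ k = A.cyclo \<sigma> * R $ i $ k + (N ** B.cocycle \<sigma>) $ i $ k" for i k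
      by (metis vector_add_component vector_smult_component)
    thus "A.cocycle \<sigma> ** M - N ** B.cocycle \<sigma> = mmap ((*) (A.cyclo \<sigma> - 1)) R"
      by (simp add: vec_eq_iff algebra_simps)
  qed
  moreover have "represents f M N R"
    using ext \<open>P = 0\<close> by (simp add: represents_def pq p q)
  ultimately show ?thesis by blast
qed

lemma represented_hom:
  assumes f: "represents f M N R" and MNR: "kummer_compatible M N R"
  shows "f \<in> carrier H"
proof -
  note rep = f[unfolded represents_def, THEN conjunct2, rule_format]
  have "f \<in> carrier A.T \<rightarrow>\<^sub>E carrier B.T"
    using f by (auto simp: PiE_def carrier_T represents_def)
  moreover have "f (A.tate_point u a \<oplus>\<^bsub>A.T\<^esub> A.tate_point v b)
      = f (A.tate_point u a) \<oplus>\<^bsub>B.T\<^esub> f (A.tate_point v b)" for u a v b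
    by (simp add: A.tate_point_add B.tate_point_add rep B.tate_point_eq_iff
        vector_matrix_left_distrib algebra_simps)
  moreover have "f (c \<odot>\<^bsub>A.T\<^esub> A.tate_point u a) = c \<odot>\<^bsub>B.T\<^esub> f (A.tate_point u a)" for c u a
    by (simp add: A.tate_point_smult B.tate_point_smult rep B.tate_point_eq_iff
        scale_vector_matrix_mult vector_add_ldistrib)
  moreover have "f (galois_act \<sigma> (A.tate_point u a)) = galois_act \<sigma> (f (A.tate_point u a))"
    if \<sigma>: "\<sigma> \<in> absolute_galois" for \<sigma> u a
  proof -
    have "a v* (A.cocycle \<sigma> ** M) - a v* (N ** B.cocycle \<sigma>) = a v* mmap ((*) (A.cyclo \<sigma> - 1)) R"
      using MNR \<sigma> by (simp add: kummer_compatible_def flip: vector_matrix_mult_diff_rdistrib)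
    also have "\<dots> = A.cyclo \<sigma> *s (a v* R) - a v* R"
      by (simp add: vec_eq_iff vector_matrix_mult_def algebra_simps sum_subtractf sum_distrib_left)
    finally have "a v* (A.cocycle \<sigma> ** M) + a v* R = A.cyclo \<sigma> *s (a v* R) + a v* (N ** B.cocycle \<sigma>)"
      by (simp add: algebra_simps)
    thus ?thesis
      by (simp add: A.tate_point_galois[OF \<sigma>] B.tate_point_galois[OF \<sigma>] rep B.tate_point_eq_iff
          vector_matrix_left_distrib scale_vector_matrix_mult vector_add_ldistrib vector_matrix_mul_assoc add.assoc)
  qed
  ultimately show ?thesis by (simp add: hom_simps ball_T)
qed

lemma ex_represented: "\<exists>f. represents f M N R"
proof -
  define f where "f x = (THE y. \<forall>u a. x = A.tate_point u a \<longrightarrow> y = B.tate_point (u v* M + a v* R) (a v* N))" for x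
  have "f (A.tate_point u a) = B.tate_point (u v* M + a v* R) (a v* N)" for u a
    unfolding f_def by (rule the_equality) (auto simp: A.tate_point_eq_iff)
  hence "represents (restrict f (carrier A.T)) M N R" by (simp add: represents_def)
  thus ?thesis by blast
qed

lemma represents_unique:
  assumes "represents f M N R" "represents f M' N' R'"
  shows "M = M'" "N = N'" "R = R'"
proof -
  have eq: "u v* M + a v* R = u v* M' + a v* R'" "a v* N = a v* N'" for u a
    using assms by (metis B.tate_point_eq_iff represents_def)+
  have "M $ i = M' $ i" "N $ i = N' $ i" "R $ i = R' $ i" for i
    using eq(1)[of "axis i 1" 0] eq(1)[of 0 "axis i 1"] eq(2)[of "axis i 1"]
    by (simp_all add: axis_vector_matrix_mult)
  thus "M = M'" "N = N'" "R = R'" by (simp_all add: vec_eq_iff)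
qed

lemma represents_inj:
  assumes "represents f M N R" "represents g M N R"
  shows "f = g"
  using assms by (intro extensionalityI[of f "carrier A.T" g]) (auto simp: represents_def carrier_T)

lemma kummer_compatible_unique:
  assumes "kummer_compatible M N R" "kummer_compatible M N R'"
  shows "R = R'"
proof -
  obtain \<tau> where \<tau>: "\<tau> \<in> absolute_galois" "A.cyclo \<tau> \<noteq> 1" using A.ex_cyclo_neq_1 by blast
  with assms have "mmap ((*) (A.cyclo \<tau> - 1)) R = mmap ((*) (A.cyclo \<tau> - 1)) R'"
    by (metis kummer_compatible_def)
  with \<tau>(2) show ?thesis by (simp add: vec_eq_iff)
qed

text \<open>Recording only \<open>M\<close> loses nothing: \<open>M\<close> determines
  \<open>N\<close> by assumption, and both determine \<open>R\<close> because the character is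
  nontrivial. No valuation is available in this locale, hence the uniqueness of \<open>N\<close>
  appears as an assumption.\<close>

theorem hom_iso_matrices:
  assumes unique: "\<And>M N N' :: 'l padic_int ^ 'h ^ 'g. mat_rmult cscale (mmap compl_map Q\<^sub>A) M = mat_lmult cscale N (mmap compl_map Q\<^sub>B) \<Longrightarrow>
      mat_rmult cscale (mmap compl_map Q\<^sub>A) M = mat_lmult cscale N' (mmap compl_map Q\<^sub>B) \<Longrightarrow> N = N'"
    and S: "S = {M. \<exists>N. mat_rmult cscale (mmap compl_map Q\<^sub>A) M = mat_lmult cscale N (mmap compl_map Q\<^sub>B)}"
    and module: "Module.module (ring_of_type_algebra :: 'l padic_int ring) (matrix_module S)"
  shows "H \<cong>\<^sub>M matrix_module S"
proof -
  define \<psi> where "\<psi> f = (SOME M. \<exists>N R. represents f M N R)" for f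
  have \<psi>: "\<psi> f = M" if "represents f M N R" for f M N R
    unfolding \<psi>_def by (rule some_equality) (use that represents_unique in blast)+
  have S': "M \<in> S \<longleftrightarrow> (\<exists>N R. kummer_compatible M N R)" for M
    by (simp add: S matrix_kummer_criterion)
  have "\<psi> ` carrier H = S"
  proof (intro equalityI subsetI)
    fix M assume "M \<in> \<psi> ` carrier H"
    thus "M \<in> S" using hom_represented \<psi> S' by blast
  next
    fix M assume "M \<in> S"
    then obtain N R where MNR: "kummer_compatible M N R" using S' by blast
    then obtain f where "represents f M N R" using ex_represented by blast
    thus "M \<in> \<psi> ` carrier H" using \<psi> represented_hom MNR by blast
  qed
  moreover have "inj_on \<psi> (carrier H)"
  proof (rule inj_onI)
    fix f g assume fg: "f \<in> carrier H" "g \<in> carrier H" "\<psi> f = \<psi> g"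
    obtain M N R where f: "represents f M N R" "kummer_compatible M N R" using hom_represented fg(1) by blast
    obtain M' N' R' where g: "represents g M' N' R'" "kummer_compatible M' N' R'" using hom_represented fg(2) by blast
    have "M' = M" using f(1) g(1) \<psi> fg(3) by metis
    moreover have "N' = N"
      by (rule unique[of M]) (use f(2) g(2) \<open>M' = M\<close> in \<open>auto simp: matrix_kummer_criterion\<close>)
    moreover from calculation have "R' = R" using f(2) g(2) kummer_compatible_unique by blast
    ultimately show "f = g" using f(1) g(1) represents_inj by blast
  qed
  ultimately have bij: "bij_betw \<psi> (carrier H) (carrier (matrix_module S))"
    by (simp add: bij_betw_def matrix_module_def)
  have add: "f \<oplus>\<^bsub>H\<^esub> g \<in> carrier H \<and> \<psi> (f \<oplus>\<^bsub>H\<^esub> g) = \<psi> f + \<psi> g"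
    if fg: "f \<in> carrier H" "g \<in> carrier H" for f g
  proof -
    obtain M N R where f: "represents f M N R" "kummer_compatible M N R" using hom_represented fg(1) by blast
    obtain M' N' R' where g: "represents g M' N' R'" "kummer_compatible M' N' R'" using hom_represented fg(2) by blast
    have 1: "represents (f \<oplus>\<^bsub>H\<^esub> g) (M + M') (N + N') (R + R')"
      using f(1) g(1)
      by (simp add: represents_def hom_simps B.tate_point_add vector_matrix_mult_add_rdistrib algebra_simps)
    have 2: "kummer_compatible (M + M') (N + N') (R + R')"
      unfolding kummer_compatible_def
    proof
      fix \<sigma> :: "'k alg_closure \<Rightarrow> 'k alg_closure" assume \<sigma>: "\<sigma> \<in> absolute_galois"
      have "A.cocycle \<sigma> ** (M + M') - (N + N') ** B.cocycle \<sigma>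
          = (A.cocycle \<sigma> ** M - N ** B.cocycle \<sigma>) + (A.cocycle \<sigma> ** M' - N' ** B.cocycle \<sigma>)"
        by (simp add: vec_eq_iff matrix_matrix_mult_def distrib_left distrib_right sum.distrib)
      also have "\<dots> = mmap ((*) (A.cyclo \<sigma> - 1)) (R + R')"
        using f(2) g(2) \<sigma> by (simp add: kummer_compatible_def vec_eq_iff distrib_left)
      finally show "A.cocycle \<sigma> ** (M + M') - (N + N') ** B.cocycle \<sigma>
          = mmap ((*) (A.cyclo \<sigma> - 1)) (R + R')" .
    qed
    show ?thesis using represented_hom[OF 1 2] \<psi>[OF 1] \<psi>[OF f(1)] \<psi>[OF g(1)] by simp
  qed
  have smult: "c \<odot>\<^bsub>H\<^esub> f \<in> carrier H \<and> \<psi> (c \<odot>\<^bsub>H\<^esub> f) = mmap ((*) c) (\<psi> f)"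
    if f: "f \<in> carrier H" for c f
  proof -
    obtain M N R where f: "represents f M N R" "kummer_compatible M N R" using hom_represented f by blast
    have v: "u v* mmap ((*) c) Y = c *s (u v* Y)" for u :: "'l padic_int ^ 'g" and Y :: "'l padic_int ^ 'h ^ 'g"
      by (simp add: vec_eq_iff vector_matrix_mult_def sum_distrib_left ac_simps)
    have 1: "represents (c \<odot>\<^bsub>H\<^esub> f) (mmap ((*) c) M) (mmap ((*) c) N) (mmap ((*) c) R)"
      using f(1) by (simp add: represents_def hom_simps B.tate_point_smult v vector_add_ldistrib)
    have 2: "kummer_compatible (mmap ((*) c) M) (mmap ((*) c) N) (mmap ((*) c) R)"
      unfolding kummer_compatible_def
    proof
      fix \<sigma> :: "'k alg_closure \<Rightarrow> 'k alg_closure" assume \<sigma>: "\<sigma> \<in> absolute_galois"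
      have "A.cocycle \<sigma> ** mmap ((*) c) M - mmap ((*) c) N ** B.cocycle \<sigma>
          = mmap ((*) c) (A.cocycle \<sigma> ** M - N ** B.cocycle \<sigma>)"
        by (simp add: vec_eq_iff matrix_matrix_mult_def sum_distrib_left right_diff_distrib ac_simps)
      also have "\<dots> = mmap ((*) (A.cyclo \<sigma> - 1)) (mmap ((*) c) R)"
        using f(2) \<sigma> by (simp add: kummer_compatible_def vec_eq_iff ac_simps)
      finally show "A.cocycle \<sigma> ** mmap ((*) c) M - mmap ((*) c) N ** B.cocycle \<sigma>
          = mmap ((*) (A.cyclo \<sigma> - 1)) (mmap ((*) c) R)" .
    qed
    show ?thesis using represented_hom[OF 1 2] \<psi>[OF 1] \<psi>[OF f(1)] by simp
  qed
  have zero: "\<zero>\<^bsub>H\<^esub> \<in> carrier H \<and> \<psi> \<zero>\<^bsub>H\<^esub> = 0"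
  proof -
    have 1: "represents \<zero>\<^bsub>H\<^esub> 0 0 0" by (simp add: represents_def hom_simps B.tate_point_zero)
    have 2: "kummer_compatible 0 0 0" by (simp add: kummer_compatible_def vec_eq_iff matrix_matrix_mult_def)
    show ?thesis using represented_hom[OF 1 2] \<psi>[OF 1] by simp
  qed
  have "Module.module (ring_of_type_algebra :: 'l padic_int ring) H"
    by (rule module_transport[OF module bij]) (use add smult zero in \<open>auto simp: matrix_module_def\<close>)
  with module bij add smult show ?thesis
    unfolding module_iso_def by (intro conjI exI[of _ \<psi>]) (auto simp: matrix_module_def)
qed

end

section \<open>Submodules of free modules over the p-adic integers\<close>

definition submod :: "(nat \<Rightarrow> 'r::comm_ring_1) set \<Rightarrow> bool"
  where "submod S \<longleftrightarrow> (\<lambda>i. 0) \<in> S \<and> (\<forall>x\<in>S. \<forall>y\<in>S. (\<lambda>i. x i + y i) \<in> S) \<and>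
    (\<forall>c. \<forall>x\<in>S. (\<lambda>i. c * x i) \<in> S)"

text \<open>Positions of last nonzero coordinates. Over an integral domain a nonzero multiple has
  the same position, so this set is an invariant of the submodule up to commensurability.\<close>

definition pivots :: "(nat \<Rightarrow> 'r::comm_ring_1) set \<Rightarrow> nat set"
  where "pivots S = {j. \<exists>x\<in>S. x j \<noteq> 0 \<and> (\<forall>i>j. x i = 0)}"

definition linear_on :: "(nat \<Rightarrow> 'r::comm_ring_1) set \<Rightarrow> ((nat \<Rightarrow> 'r) \<Rightarrow> nat \<Rightarrow> 'r) \<Rightarrow> bool"
  where "linear_on S f \<longleftrightarrow> (\<forall>x\<in>S. \<forall>y\<in>S. f (\<lambda>i. x i + y i) = (\<lambda>i. f x i + f y i)) \<and>
    (\<forall>c. \<forall>x\<in>S. f (\<lambda>i. c * x i) = (\<lambda>i. c * f x i))"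

definition supported :: "nat set \<Rightarrow> (nat \<Rightarrow> 'r::zero) set"
  where "supported J = {a. \<forall>i. i \<notin> J \<longrightarrow> a i = 0}"

lemma submod_supported: "submod (supported J)"
  by (auto simp: submod_def supported_def)

text \<open>An echelon basis: for every pivot one element whose leading coefficient has minimal valuation.\<close>

lemma echelon_basis:
  fixes S :: "(nat \<Rightarrow> 'p::prime_card padic_int) set"
  assumes "submod S" "S \<subseteq> supported {..<m}"
  shows "\<exists>F. bij_betw F (supported (pivots S)) S \<and> linear_on (supported (pivots S)) F"
  using assms
proof (induction m arbitrary: S)
  case 0
  hence S: "S = {\<lambda>i. 0}" by (auto simp: supported_def submod_def)
  hence "pivots S = {}" by (simp add: pivots_def)
  hence "supported (pivots S) = S" by (auto simp: supported_def S)
  thus ?case by (intro exI[of _ "\<lambda>x. x"]) (simp add: linear_on_def bij_betw_def)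
next
  case (Suc m)
  show ?case
  proof (cases "\<forall>x\<in>S. x m = 0")
    case True
    have "x i = 0" if "x \<in> S" "m \<le> i" for x i
      using True Suc.prems(2) that by (cases "i = m") (auto simp: supported_def)
    hence "S \<subseteq> supported {..<m}" by (auto simp: supported_def)
    thus ?thesis by (rule Suc.IH[OF Suc.prems(1)])
  next
    case False
    define S' where "S' = {x \<in> S. x m = 0}"
    have S: "(\<lambda>i. 0) \<in> S" "\<And>x y. x \<in> S \<Longrightarrow> y \<in> S \<Longrightarrow> (\<lambda>i. x i + y i) \<in> S"
        "\<And>c x. x \<in> S \<Longrightarrow> (\<lambda>i. c * x i) \<in> S"
      using Suc.prems(1) by (auto simp: submod_def)
    have supp: "x i = 0" if "x \<in> S" "i > m" for x i
      using Suc.prems(2) that by (auto simp: supported_def)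
    have "submod S'" using S by (auto simp: submod_def S'_def)
    moreover have "x i = 0" if "x \<in> S'" "m \<le> i" for x i
      using supp[of x i] that by (cases "i = m") (auto simp: S'_def)
    hence "S' \<subseteq> supported {..<m}" by (auto simp: supported_def)
    ultimately obtain F where bij: "bij_betw F (supported (pivots S')) S'"
      and lin: "linear_on (supported (pivots S')) F" using Suc.IH by blast
    obtain b where b: "b \<in> S" "b m \<noteq> 0"
      and min: "\<And>x. x \<in> S \<Longrightarrow> x m \<noteq> 0 \<Longrightarrow> padic_int_val (b m) \<le> padic_int_val (x m)"
    proof -
      from False have "\<exists>x. x \<in> S \<and> x m \<noteq> 0" by blast
      hence "\<exists>b. (b \<in> S \<and> b m \<noteq> 0) \<and>
          (\<forall>y. y \<in> S \<and> y m \<noteq> 0 \<longrightarrow> padic_int_val (b m) \<le> padic_int_val (y m))"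
        using arg_min_nat_lemma[of "\<lambda>x. x \<in> S \<and> x m \<noteq> 0" _ "\<lambda>x. padic_int_val (x m)"] by blast
      thus ?thesis using that by blast
    qed
    \<comment> \<open>By minimality of its valuation, \<open>b m\<close> generates the ideal of all
      \<open>m\<close>-th coordinates of elements of \<open>S\<close>.\<close>
    have dvd: "b m dvd x m" if "x \<in> S" for x
    proof (cases "x m = 0")
      case False
      thus ?thesis using min[OF that] residue_eq_0_iff[OF False] b(2) by (intro padic_int_dvdI) auto
    qed simp
    have m_notin: "m \<notin> pivots S'" by (auto simp: pivots_def S'_def)
    have piv: "pivots S = insert m (pivots S')"
    proof (intro equalityI subsetI)
      fix j assume "j \<in> pivots S"
      then obtain x where x: "x \<in> S" "x j \<noteq> 0" "\<forall>i>j. x i = 0" by (auto simp: pivots_def)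
      have "j \<le> m" using x supp[of x j] by (meson not_le)
      thus "j \<in> insert m (pivots S')" using x by (cases "j = m") (auto simp: pivots_def S'_def)
    next
      fix j assume "j \<in> insert m (pivots S')"
      thus "j \<in> pivots S" using b supp by (auto simp: pivots_def S'_def)
    qed
    have restr: "a(m := 0) \<in> supported (pivots S')" if "a \<in> supported (pivots S)" for a :: "nat \<Rightarrow> 'p padic_int"
      using that by (auto simp: supported_def piv)
    have FS': "F a \<in> S'" if "a \<in> supported (pivots S')" for a
      using bij that by (auto simp: bij_betw_def)
    \<comment> \<open>The coordinate at the new pivot \<open>m\<close> is the coefficient of
      \<open>b\<close>; the remaining ones go through the basis of the elements with vanishing
      \<open>m\<close>-th coordinate.\<close>
    define G where "G a = (\<lambda>i. F (a(m := 0)) i + a m * b i)" for a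
    have Gm: "G a m = a m * b m" if "a \<in> supported (pivots S)" for a
      using FS'[OF restr[OF that]] by (simp add: G_def S'_def)
    have "G a \<in> S" if "a \<in> supported (pivots S)" for a
      unfolding G_def using FS'[OF restr[OF that]] b by (intro S) (auto simp: S'_def)
    moreover have "\<exists>a\<in>supported (pivots S). x = G a" if x: "x \<in> S" for x
    proof -
      obtain q where q: "x m = b m * q" using dvd[OF x] by blast
      have "(\<lambda>i. x i + (- q) * b i) \<in> S'"
        unfolding S'_def by (intro CollectI conjI S x b) (simp add: q)
      then obtain a where a: "a \<in> supported (pivots S')" "F a = (\<lambda>i. x i + (- q) * b i)"
      proof -
        have "(\<lambda>i. x i + (- q) * b i) \<in> F ` supported (pivots S')"
          using bij_betw_imp_surj_on[OF bij] \<open>(\<lambda>i. x i + (- q) * b i) \<in> S'\<close> by simp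
        thus ?thesis using that by (elim imageE) metis
      qed
      have "a(m := 0) = a" using a(1) m_notin by (auto simp: supported_def)
      hence "x = G (a(m := q))" using a(2) by (simp add: G_def)
      moreover have "a(m := q) \<in> supported (pivots S)" using a(1) by (auto simp: supported_def piv)
      ultimately show ?thesis by blast
    qed
    ultimately have "G ` supported (pivots S) = S" by blast
    moreover have "inj_on G (supported (pivots S))"
    proof (rule inj_onI)
      fix a a' assume a: "a \<in> supported (pivots S)" "a' \<in> supported (pivots S)" "G a = G a'"
      have am: "a m = a' m" using Gm[OF a(1)] Gm[OF a(2)] a(3) b(2) by simp
      hence "F (a(m := 0)) = F (a'(m := 0))" using a(3) by (simp add: G_def fun_eq_iff)
      hence "a(m := 0) = a'(m := 0)"
        by (rule inj_onD[OF bij_betw_imp_inj_on[OF bij]]) (intro restr a)+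
      thus "a = a'" using am by (metis fun_upd_triv fun_upd_upd)
    qed
    moreover have "linear_on (supported (pivots S)) G"
      unfolding linear_on_def
    proof (intro conjI ballI allI)
      fix x y :: "nat \<Rightarrow> 'p padic_int"
      assume xy: "x \<in> supported (pivots S)" "y \<in> supported (pivots S)"
      have eq: "(\<lambda>i. x i + y i)(m := 0) = (\<lambda>i. (x(m := 0)) i + (y(m := 0)) i)" by auto
      have F: "F (\<lambda>i. (x(m := 0)) i + (y(m := 0)) i) = (\<lambda>i. F (x(m := 0)) i + F (y(m := 0)) i)"
        using lin restr[OF xy(1)] restr[OF xy(2)] unfolding linear_on_def by blast
      show "G (\<lambda>i. x i + y i) = (\<lambda>i. G x i + G y i)"
        unfolding G_def eq F by (simp add: algebra_simps)
    next
      fix c and x :: "nat \<Rightarrow> 'p padic_int"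
      assume x: "x \<in> supported (pivots S)"
      have eq: "(\<lambda>i. c * x i)(m := 0) = (\<lambda>i. c * (x(m := 0)) i)" by auto
      have F: "F (\<lambda>i. c * (x(m := 0)) i) = (\<lambda>i. c * F (x(m := 0)) i)"
        using lin restr[OF x] unfolding linear_on_def by blast
      show "G (\<lambda>i. c * x i) = (\<lambda>i. c * G x i)"
        unfolding G_def eq F by (simp add: algebra_simps)
    qed
    ultimately show ?thesis by (auto simp: bij_betw_def)
  qed
qed

text \<open>Commensurability makes the pivots coincide, so both submodules are free on the same
  coordinates.\<close>

lemma commensurable_submodules_iso:
  fixes S T :: "(nat \<Rightarrow> 'p::prime_card padic_int) set"
  assumes S: "submod S" and T: "submod T" "T \<subseteq> supported {..<m}" and "S \<subseteq> T"
    and comm: "\<And>x. x \<in> T \<Longrightarrow> \<exists>c. c \<noteq> 0 \<and> (\<lambda>i. c * x i) \<in> S"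
  shows "\<exists>F. bij_betw F S T \<and> linear_on S F"
proof -
  have "pivots S = pivots T"
  proof (intro equalityI subsetI)
    fix j assume "j \<in> pivots T"
    then obtain x where x: "x \<in> T" "x j \<noteq> 0" "\<forall>i>j. x i = 0" by (auto simp: pivots_def)
    then obtain c where "c \<noteq> 0" "(\<lambda>i. c * x i) \<in> S" using comm by blast
    thus "j \<in> pivots S" using x unfolding pivots_def
      by (intro CollectI bexI[of _ "\<lambda>i. c * x i"]) auto
  qed (use \<open>S \<subseteq> T\<close> in \<open>auto simp: pivots_def\<close>)
  define D where "D = (supported (pivots T) :: (nat \<Rightarrow> 'p padic_int) set)"
  obtain F where F: "bij_betw F D S" "linear_on D F"
    using echelon_basis[OF S, of m] \<open>S \<subseteq> T\<close> T(2) \<open>pivots S = pivots T\<close> by (auto simp: D_def)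
  obtain G where G: "bij_betw G D T" "linear_on D G"
    using echelon_basis[OF T] by (auto simp: D_def)
  define E where "E = the_inv_into D F"
  have E: "bij_betw E S D" "\<And>x. x \<in> S \<Longrightarrow> F (E x) = x" "\<And>a. a \<in> D \<Longrightarrow> E (F a) = a" "\<And>x. x \<in> S \<Longrightarrow> E x \<in> D"
    using F(1) unfolding E_def
    by (auto simp: bij_betw_def bij_betw_the_inv_into f_the_inv_into_f the_inv_into_f_f the_inv_into_into)
       (metis bij_betw_def bij_betw_the_inv_into)+
  have D: "submod D" by (simp add: D_def submod_supported)
  have "linear_on S (G \<circ> E)"
    unfolding linear_on_def
  proof (intro conjI ballI allI)
    fix x y assume xy: "x \<in> S" "y \<in> S"
    have mem: "(\<lambda>i. E x i + E y i) \<in> D" using D E(4) xy by (auto simp: submod_def)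
    have "F (\<lambda>i. E x i + E y i) = (\<lambda>i. x i + y i)" using F(2) E(2,4) xy by (simp add: linear_on_def)
    hence "E (\<lambda>i. x i + y i) = (\<lambda>i. E x i + E y i)" using E(3)[OF mem] by simp
    thus "(G \<circ> E) (\<lambda>i. x i + y i) = (\<lambda>i. (G \<circ> E) x i + (G \<circ> E) y i)"
      using G(2) E(4) xy by (simp add: linear_on_def)
  next
    fix c x assume x: "x \<in> S"
    have mem: "(\<lambda>i. c * E x i) \<in> D" using D E(4) x by (auto simp: submod_def)
    have "F (\<lambda>i. c * E x i) = (\<lambda>i. c * x i)" using F(2) E(2,4) x by (simp add: linear_on_def)
    hence "E (\<lambda>i. c * x i) = (\<lambda>i. c * E x i)" using E(3)[OF mem] by simp
    thus "(G \<circ> E) (\<lambda>i. c * x i) = (\<lambda>i. c * (G \<circ> E) x i)"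
      using G(2) E(4) x by (simp add: linear_on_def)
  qed
  thus ?thesis using bij_betw_trans[OF E(1) G(1)] by blast
qed

lemma commensurable_matrix_modules_iso:
  fixes S T :: "('p::prime_card padic_int ^ 'h ^ 'g) set"
  assumes S: "0 \<in> S" "\<And>x y. x \<in> S \<Longrightarrow> y \<in> S \<Longrightarrow> x + y \<in> S" "\<And>a x. x \<in> S \<Longrightarrow> mmap ((*) a) x \<in> S"
    and T: "0 \<in> T" "\<And>x y. x \<in> T \<Longrightarrow> y \<in> T \<Longrightarrow> x + y \<in> T" "\<And>a x. x \<in> T \<Longrightarrow> mmap ((*) a) x \<in> T"
    and sub: "S \<subseteq> T" and comm: "\<And>x. x \<in> T \<Longrightarrow> \<exists>c. c \<noteq> 0 \<and> mmap ((*) c) x \<in> S"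
  shows "matrix_module S \<cong>\<^sub>M matrix_module T"
proof -
  define m where "m = CARD('g \<times> 'h)"
  obtain e where e: "bij_betw e {..<m} (UNIV :: ('g \<times> 'h) set)"
    unfolding m_def using ex_bij_betw_nat_finite[of "UNIV :: ('g \<times> 'h) set"]
    by (auto simp: atLeast0LessThan)
  define \<phi> :: "'p padic_int ^ 'h ^ 'g \<Rightarrow> nat \<Rightarrow> 'p padic_int"
    where "\<phi> A i = (if i < m then A $ fst (e i) $ snd (e i) else 0)" for A i
  have \<phi>_add: "\<phi> (A + B) = (\<lambda>i. \<phi> A i + \<phi> B i)" and \<phi>_scale: "\<phi> (mmap ((*) c) A) = (\<lambda>i. c * \<phi> A i)" for A B c
    by (auto simp: \<phi>_def)
  have inj: "inj \<phi>"
  proof (rule injI)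
    fix A B assume eq: "\<phi> A = \<phi> B"
    have "A $ i $ j = B $ i $ j" for i j
    proof -
      have "(i, j) \<in> e ` {..<m}" using e by (simp add: bij_betw_def)
      then obtain k where "k < m" "e k = (i, j)" by auto
      thus ?thesis using fun_cong[OF eq, of k] by (simp add: \<phi>_def)
    qed
    thus "A = B" by (simp add: vec_eq_iff)
  qed
  have submod: "submod (\<phi> ` U)"
    if "0 \<in> U" "\<And>x y. x \<in> U \<Longrightarrow> y \<in> U \<Longrightarrow> x + y \<in> U" "\<And>a x. x \<in> U \<Longrightarrow> mmap ((*) a) x \<in> U" for U
    unfolding submod_def
  proof (intro conjI ballI allI)
    have "\<phi> 0 = (\<lambda>i. 0)" by (auto simp: \<phi>_def)
    thus "(\<lambda>i. 0) \<in> \<phi> ` U" using that(1) by (metis image_eqI)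
  qed (use that(2,3) in \<open>auto simp flip: \<phi>_add \<phi>_scale\<close>)
  have "\<exists>F. bij_betw F (\<phi> ` S) (\<phi> ` T) \<and> linear_on (\<phi> ` S) F"
  proof (rule commensurable_submodules_iso)
    show "submod (\<phi> ` S)" using S by (rule submod)
    show "submod (\<phi> ` T)" using T by (rule submod)
    show "\<phi> ` T \<subseteq> supported {..<m}" by (auto simp: supported_def \<phi>_def)
    show "\<phi> ` S \<subseteq> \<phi> ` T" using sub by blast
    show "\<exists>c. c \<noteq> 0 \<and> (\<lambda>i. c * x i) \<in> \<phi> ` S" if x: "x \<in> \<phi> ` T" for x
    proof -
      obtain A where A: "A \<in> T" "x = \<phi> A" using x by blast
      then obtain c where "c \<noteq> 0" "mmap ((*) c) A \<in> S" using comm by blast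
      thus ?thesis by (intro exI[of _ c]) (simp add: A(2) \<phi>_scale[symmetric])
    qed
  qed
  then obtain F where F: "bij_betw F (\<phi> ` S) (\<phi> ` T)" "linear_on (\<phi> ` S) F" by blast
  define f where "f = inv_into UNIV \<phi> \<circ> F \<circ> \<phi>"
  have \<phi>f: "\<phi> (f x) = F (\<phi> x)" if "x \<in> S" for x
  proof -
    have "F (\<phi> x) \<in> range \<phi>" using F(1) that by (auto simp: bij_betw_def)
    thus ?thesis by (simp add: f_def f_inv_into_f)
  qed
  have "bij_betw f S T"
    unfolding f_def
  proof (intro bij_betw_trans)
    show "bij_betw \<phi> S (\<phi> ` S)" using inj by (simp add: bij_betw_def inj_on_def)
    show "bij_betw (inv_into UNIV \<phi>) (\<phi> ` T) T"
      using inj by (auto simp: bij_betw_def inj_on_def image_image)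
  qed (rule F)
  moreover have "f (x + y) = f x + f y" if "x \<in> S" "y \<in> S" for x y
    using that F(2) S(2) by (intro injD[OF inj]) (simp add: \<phi>f \<phi>_add linear_on_def)
  moreover have "f (mmap ((*) c) x) = mmap ((*) c) (f x)" if "x \<in> S" for c x
    using that F(2) S(3) by (intro injD[OF inj]) (simp add: \<phi>f \<phi>_scale linear_on_def)
  moreover have "Module.module (ring_of_type_algebra :: 'p padic_int ring) (matrix_module S)"
    using S by (rule module_matrix_module)
  moreover have "Module.module (ring_of_type_algebra :: 'p padic_int ring) (matrix_module T)"
    using T by (rule module_matrix_module)
  ultimately show ?thesis
    unfolding module_iso_def by (intro conjI exI[of _ f]) (auto simp: matrix_module_def)
qed

section \<open>Matrices over a module\<close>

context Modules.module
begin

lemma mat_lmult_assoc: "mat_lmult scale A (mat_lmult scale B U) = mat_lmult scale (A ** B) U"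
proof -
  have "(\<Sum>k\<in>UNIV. \<Sum>l\<in>UNIV. scale (A $ i $ k * B $ k $ l) (U $ l $ j))
      = (\<Sum>l\<in>UNIV. \<Sum>k\<in>UNIV. scale (A $ i $ k * B $ k $ l) (U $ l $ j))" for i j
    by (rule sum.swap)
  thus ?thesis
    by (simp add: mat_lmult_def vec_eq_iff matrix_matrix_mult_def scale_sum_left scale_sum_right)
qed

lemma mat_rmult_lmult: "mat_rmult scale (mat_lmult scale A U) M = mat_lmult scale A (mat_rmult scale U M)"
proof -
  have "(\<Sum>k\<in>UNIV. \<Sum>l\<in>UNIV. scale (M $ k $ j * A $ i $ l) (U $ l $ k))
      = (\<Sum>l\<in>UNIV. \<Sum>k\<in>UNIV. scale (A $ i $ l * M $ k $ j) (U $ l $ k))" for i j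
    by (subst sum.swap) (simp add: mult.commute)
  thus ?thesis
    by (simp add: mat_lmult_def mat_rmult_def vec_eq_iff scale_sum_right)
qed

lemma mat_lmult_one: "mat_lmult scale (mat 1) U = U"
proof -
  have "(\<Sum>k\<in>UNIV. scale (if i = k then 1 else 0) (U $ k $ j)) = (\<Sum>k\<in>UNIV. if i = k then U $ k $ j else 0)" for i j
    by (rule sum.cong) auto
  thus ?thesis by (simp add: mat_lmult_def mat_def vec_eq_iff)
qed

lemma mat_rmult_add: "mat_rmult scale U (M + M') = mat_rmult scale U M + mat_rmult scale U M'"
  by (simp add: mat_rmult_def vec_eq_iff scale_left_distrib sum.distrib)

lemma mat_lmult_add: "mat_lmult scale (N + N') U = mat_lmult scale N U + mat_lmult scale N' U"
  by (simp add: mat_lmult_def vec_eq_iff scale_left_distrib sum.distrib)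

lemma mat_rmult_scale: "mat_rmult scale U (mmap ((*) c) M) = mmap (scale c) (mat_rmult scale U M)"
  by (simp add: mat_rmult_def vec_eq_iff scale_sum_right)

lemma mat_lmult_scale: "mat_lmult scale (mmap ((*) c) N) U = mmap (scale c) (mat_lmult scale N U)"
  by (simp add: mat_lmult_def vec_eq_iff scale_sum_right)

lemma mat_rmult_zero: "mat_rmult scale U 0 = 0"
  by (simp add: mat_rmult_def vec_eq_iff)

lemma mat_lmult_zero: "mat_lmult scale 0 U = 0"
  by (simp add: mat_lmult_def vec_eq_iff)

end

section \<open>Completed lattices\<close>

lemma mult_completion_eqI: "(\<And>n. component x n = component y n) \<Longrightarrow> x = y"
  by (auto simp flip: component_inject)

lemma component_compl_map: "x \<noteq> 0 \<Longrightarrow> component (compl_map x :: ('k::field, 'l::prime_card) mult_completion) n = pow_coset (CARD('l) ^ n) x"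
  by (simp add: compl_map.rep_eq flip: pow_coset_def)

text \<open>Scalars act through nonnegative residues, whereas \<open>k i\<close> may be negative;
  reducing it modulo \<open>l ^ n\<close> changes the power only by an \<open>l ^ n\<close>-th
  power.\<close>

lemma compl_map_prod_power_int:
  fixes c :: "'i \<Rightarrow> 'k::field"
  assumes "\<And>i. i \<in> I \<Longrightarrow> c i \<noteq> 0"
  shows "compl_map (\<Prod>i\<in>I. c i powi k i) =
    (\<Sum>i\<in>I. cscale (of_int (k i)) (compl_map (c i)) :: ('k, 'l::prime_card) mult_completion)"
proof (rule mult_completion_eqI)
  fix n
  let ?L = "CARD('l) ^ n"
  have nz: "(\<Prod>i\<in>I. c i powi k i) \<noteq> 0"
    using assms by (cases "finite I") (auto simp: power_int_eq_0_iff)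
  have "pow_coset ?L (c i powi k i) = pow_coset ?L (c i powi (k i mod int ?L))" if "i \<in> I" for i
  proof (rule pow_coset_eqI[symmetric])
    have "c i powi k i = c i powi (int ?L * (k i div int ?L) + k i mod int ?L)" by simp
    also have "\<dots> = (c i powi (k i div int ?L)) ^ ?L * c i powi (k i mod int ?L)"
      using assms[OF that]
      by (subst power_int_add) (auto simp: power_int_mult power_int_power_commute simp del: of_nat_power)
    finally show "c i powi k i = (c i powi (k i div int ?L)) ^ ?L * c i powi (k i mod int ?L)" .
    show "c i powi (k i div int ?L) \<noteq> 0" using assms[OF that] by (simp add: power_int_eq_0_iff)
  qed
  hence "component (\<Sum>i\<in>I. cscale (of_int (k i)) (compl_map (c i)) :: ('k, 'l) mult_completion) n
      = pow_coset ?L (\<Prod>i\<in>I. c i powi k i)"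
    using assms
    by (intro component_sum) (simp_all add: component_cscale_compl_map residue_of_int power_int_eq_0_iff)
  thus "component (compl_map (\<Prod>i\<in>I. c i powi k i) :: ('k, 'l) mult_completion) n
      = component (\<Sum>i\<in>I. cscale (of_int (k i)) (compl_map (c i)) :: ('k, 'l) mult_completion) n"
    using nz by (simp add: component_compl_map)
qed

lemma row_prod_delta: "row_prod Q (\<lambda>k. if k = i then 1 else 0) = Q $ i"
proof -
  have "(\<Prod>k\<in>UNIV. (Q $ k $ j) powi (if k = i then 1 else 0)) = (\<Prod>k\<in>UNIV. if k = i then Q $ k $ j else 1)" for j
    by (rule prod.cong) auto
  thus ?thesis by (simp add: row_prod_def vec_eq_iff)
qed

lemma module_vmap_cscale:
  "Modules.module (\<lambda>a. vmap (cscale a) :: ('k::field, 'l::prime_card) mult_completion ^ 'g \<Rightarrow> _)"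
  by unfold_locales (simp_all add: vec_eq_iff cscale.scale_left_distrib cscale.scale_right_distrib)

text \<open>The completion map turns the product of rows with integer exponents into an integral
  combination of rows, so the rows generate the span of the whole lattice.\<close>

lemma completed_lattice_eq:
  fixes Q :: "'k::field ^ 'g ^ 'g"
  assumes "is_period_matrix \<Lambda> Q"
  shows "completed_lattice \<Lambda> =
    (range (\<lambda>b. \<chi> j. \<Sum>i\<in>UNIV. cscale (b i) (compl_map (Q $ i $ j))) :: (('k, 'l::prime_card) mult_completion ^ 'g) set)"
    (is "_ = range ?lin")
proof -
  interpret V: Modules.module "\<lambda>a. vmap (cscale a) :: ('k, 'l) mult_completion ^ 'g \<Rightarrow> _"
    by (rule module_vmap_cscale)
  have nz: "Q $ i $ j \<noteq> 0" for i j using assms by (simp add: is_period_matrix_def)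
  have \<Lambda>: "\<Lambda> = range (row_prod Q)" using assms by (auto simp: is_period_matrix_def bij_betw_def)
  have lin_row: "vmap compl_map (row_prod Q k) = ?lin (\<lambda>i. of_int (k i))" for k
    by (simp add: vec_eq_iff row_prod_nth compl_map_prod_power_int nz)
  have sum_nth: "(\<Sum>i\<in>I. f i) $ j = (\<Sum>i\<in>I. f i $ j)" for f :: "'g \<Rightarrow> ('k, 'l) mult_completion ^ 'g" and I j
    by (induction I rule: infinite_finite_induct) simp_all
  show ?thesis
    unfolding completed_lattice_def
  proof (intro equalityI)
    show "V.span (vmap compl_map ` \<Lambda>) \<subseteq> range ?lin"
    proof (rule V.span_minimal)
      show "vmap compl_map ` \<Lambda> \<subseteq> range ?lin" by (auto simp: \<Lambda> lin_row)
      show "V.subspace (range ?lin)"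
      proof (rule V.subspaceI)
        have "0 = ?lin (\<lambda>i. 0)" by (simp add: vec_eq_iff)
        thus "0 \<in> range ?lin"
          by (rule image_eqI[where f = ?lin and x = "\<lambda>i. 0"]) simp
      next
        fix x y assume "x \<in> range ?lin" "y \<in> range ?lin"
        then obtain b d where "x = ?lin b" "y = ?lin d" by blast
        hence "x + y = ?lin (\<lambda>i. b i + d i)"
          by (simp add: vec_eq_iff cscale.scale_left_distrib sum.distrib)
        thus "x + y \<in> range ?lin"
          by (rule image_eqI[where f = ?lin and x = "\<lambda>i. b i + d i"]) simp
      next
        fix c x assume "x \<in> range ?lin"
        then obtain b where "x = ?lin b" by blast
        hence "vmap (cscale c) x = ?lin (\<lambda>i. c * b i)"
          by (simp add: vec_eq_iff cscale.scale_sum_right)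
        thus "vmap (cscale c) x \<in> range ?lin"
          by (rule image_eqI[where f = ?lin and x = "\<lambda>i. c * b i"]) simp
      qed
    qed
    show "range ?lin \<subseteq> V.span (vmap compl_map ` \<Lambda>)"
    proof clarify
      fix b
      have row: "Q $ i \<in> \<Lambda>" for i using row_prod_delta[of Q i] unfolding \<Lambda> by (metis rangeI)
      have "?lin b = (\<Sum>i\<in>UNIV. vmap (cscale (b i)) (vmap compl_map (Q $ i)))"
        by (simp add: vec_eq_iff sum_nth)
      also have "\<dots> \<in> V.span (vmap compl_map ` \<Lambda>)"
        by (intro V.span_sum V.span_scale V.span_base imageI row)
      finally show "?lin b \<in> V.span (vmap compl_map ` \<Lambda>)" .
    qed
  qed
qed

text \<open>It suffices to test the rows of the period matrix: row \<open>i\<close> of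
  \<open>N\<close> lists coefficients of the image of row \<open>i\<close>.\<close>

lemma completed_lattice_maps_iff:
  fixes Q\<^sub>A :: "'k::field ^ 'g ^ 'g" and Q\<^sub>B :: "'k ^ 'h ^ 'h" and M :: "'l::prime_card padic_int ^ 'h ^ 'g"
  assumes A: "is_period_matrix \<Lambda>\<^sub>A Q\<^sub>A" and B: "is_period_matrix \<Lambda>\<^sub>B Q\<^sub>B"
  shows "(\<lambda>x. vec_mat cscale x M) ` completed_lattice \<Lambda>\<^sub>A \<subseteq> completed_lattice \<Lambda>\<^sub>B \<longleftrightarrow>
    (\<exists>N. mat_rmult cscale (mmap compl_map Q\<^sub>A) M = mat_lmult cscale N (mmap compl_map Q\<^sub>B))"
    (is "?lhs \<longleftrightarrow> ?rhs")
proof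
  assume ?lhs
  have "\<exists>b. vec_mat cscale (vmap compl_map (Q\<^sub>A $ i)) M = (\<chi> k. \<Sum>l\<in>UNIV. cscale (b l) (compl_map (Q\<^sub>B $ l $ k)))" for i
  proof -
    have "(\<Sum>k\<in>UNIV. cscale (if k = i then 1 else 0) (compl_map (Q\<^sub>A $ k $ j)))
        = (\<Sum>k\<in>UNIV. if k = i then compl_map (Q\<^sub>A $ k $ j) else (0 :: ('k, 'l) mult_completion))" for j
      by (rule sum.cong) auto
    hence "vmap compl_map (Q\<^sub>A $ i) = ((\<chi> j. \<Sum>k\<in>UNIV. cscale (if k = i then 1 else 0) (compl_map (Q\<^sub>A $ k $ j)))
        :: ('k, 'l) mult_completion ^ 'g)"
      by (simp add: vec_eq_iff)
    hence "vmap compl_map (Q\<^sub>A $ i) \<in> (completed_lattice \<Lambda>\<^sub>A :: (('k, 'l) mult_completion ^ 'g) set)"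
      unfolding completed_lattice_eq[OF A]
      by (rule image_eqI[of _ _ "\<lambda>k. if k = i then 1 else 0"]) simp
    with \<open>?lhs\<close> have "vec_mat cscale (vmap compl_map (Q\<^sub>A $ i)) M \<in> completed_lattice \<Lambda>\<^sub>B" by blast
    thus ?thesis by (simp only: completed_lattice_eq[OF B] image_iff bex_UNIV)
  qed
  hence "\<forall>i. \<exists>b. vec_mat cscale (vmap compl_map (Q\<^sub>A $ i)) M
      = (\<chi> k. \<Sum>l\<in>UNIV. cscale (b l) (compl_map (Q\<^sub>B $ l $ k)))" ..
  from choice[OF this] obtain b where b: "\<forall>i. vec_mat cscale (vmap compl_map (Q\<^sub>A $ i)) M
      = (\<chi> k. \<Sum>l\<in>UNIV. cscale (b i l) (compl_map (Q\<^sub>B $ l $ k)))" ..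
  have "mat_rmult cscale (mmap compl_map Q\<^sub>A) M = mat_lmult cscale (\<chi> i l. b i l) (mmap compl_map Q\<^sub>B)"
    using b by (simp add: vec_eq_iff vec_mat_def mat_rmult_def mat_lmult_def)
  thus ?rhs by blast
next
  assume ?rhs
  then obtain N where N: "mat_rmult cscale (mmap compl_map Q\<^sub>A) M = mat_lmult cscale N (mmap compl_map Q\<^sub>B)" ..
  hence N': "(\<Sum>j\<in>UNIV. cscale (M $ j $ k) (compl_map (Q\<^sub>A $ i $ j)))
      = (\<Sum>l\<in>UNIV. cscale (N $ i $ l) (compl_map (Q\<^sub>B $ l $ k)))" for i k
    by (simp add: vec_eq_iff mat_rmult_def mat_lmult_def)
  show ?lhs
    unfolding completed_lattice_eq[OF A] completed_lattice_eq[OF B]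
  proof clarify
    fix b :: "'g \<Rightarrow> 'l padic_int"
    have "vec_mat cscale (\<chi> j. \<Sum>i\<in>UNIV. cscale (b i) (compl_map (Q\<^sub>A $ i $ j))) M
        = (\<chi> k. \<Sum>l\<in>UNIV. cscale (\<Sum>i\<in>UNIV. b i * N $ i $ l) (compl_map (Q\<^sub>B $ l $ k)))"
    proof (subst vec_eq_iff, intro allI)
      fix k
      have "(\<Sum>j\<in>UNIV. cscale (M $ j $ k) (\<Sum>i\<in>UNIV. cscale (b i) (compl_map (Q\<^sub>A $ i $ j))))
          = (\<Sum>j\<in>UNIV. \<Sum>i\<in>UNIV. cscale (b i) (cscale (M $ j $ k) (compl_map (Q\<^sub>A $ i $ j))))"
        by (simp add: cscale.scale_sum_right mult.commute)
      also have "\<dots> = (\<Sum>i\<in>UNIV. \<Sum>j\<in>UNIV. cscale (b i) (cscale (M $ j $ k) (compl_map (Q\<^sub>A $ i $ j))))"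
        by (rule sum.swap)
      also have "\<dots> = (\<Sum>i\<in>UNIV. cscale (b i) (\<Sum>l\<in>UNIV. cscale (N $ i $ l) (compl_map (Q\<^sub>B $ l $ k))))"
        by (simp only: cscale.scale_sum_right[symmetric] N')
      also have "\<dots> = (\<Sum>i\<in>UNIV. \<Sum>l\<in>UNIV. cscale (b i * N $ i $ l) (compl_map (Q\<^sub>B $ l $ k)))"
        by (simp add: cscale.scale_sum_right)
      also have "\<dots> = (\<Sum>l\<in>UNIV. \<Sum>i\<in>UNIV. cscale (b i * N $ i $ l) (compl_map (Q\<^sub>B $ l $ k)))"
        by (rule sum.swap)
      finally show "vec_mat cscale (\<chi> j. \<Sum>i\<in>UNIV. cscale (b i) (compl_map (Q\<^sub>A $ i $ j))) M $ k
          = (\<chi> k. \<Sum>l\<in>UNIV. cscale (\<Sum>i\<in>UNIV. b i * N $ i $ l) (compl_map (Q\<^sub>B $ l $ k))) $ k"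
        by (simp add: vec_mat_def cscale.scale_sum_left)
    qed
    thus "vec_mat cscale (\<chi> j. \<Sum>i\<in>UNIV. cscale (b i) (compl_map (Q\<^sub>A $ i $ j))) M
      \<in> range (\<lambda>b. \<chi> k. \<Sum>l\<in>UNIV. cscale (b l) (compl_map (Q\<^sub>B $ l $ k)))"
      by (rule image_eqI[where x = "\<lambda>l. \<Sum>i\<in>UNIV. b i * N $ i $ l"]) simp
  qed
qed

section \<open>Orders of period matrices\<close>

lemma padic_of_int_add: "padic_of_int (a + b) = padic_of_int a + padic_of_int b"
  and padic_of_int_mult: "padic_of_int (a * b) = padic_of_int a * padic_of_int b"
  and padic_of_int_0: "padic_of_int 0 = 0" and padic_of_int_1: "padic_of_int 1 = 1"
  by (simp_all add: Zero_fract_def One_fract_def)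

lemma padic_of_int_eq_iff: "padic_of_int a = padic_of_int b \<longleftrightarrow> a = b"
  by (simp add: eq_fract)

lemma padic_of_int_sum: "padic_of_int (sum f I) = (\<Sum>i\<in>I. padic_of_int (f i))"
  by (induction I rule: infinite_finite_induct) (simp_all add: padic_of_int_0 padic_of_int_add del: add_fract)

lemma padic_of_int_of_int: "padic_of_int (of_int k) = of_int k"
  by (cases k rule: int_cases2) (simp_all add: of_nat_fract)

lemma mmap_of_rat_mult: "mmap of_rat (A ** B) = mmap of_rat A ** (mmap of_rat B :: 'a::field_char_0 ^ 'n ^ 'm)"
  by (simp add: vec_eq_iff matrix_matrix_mult_def of_rat_sum of_rat_mult)

lemma mmap_of_rat_one: "mmap of_rat (mat 1) = (mat 1 :: 'a::field_char_0 ^ 'n ^ 'n)"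
  by (simp add: vec_eq_iff mat_def)

lemma matrix_inv_cancel:
  assumes "invertible A"
  shows "A ** matrix_inv A = mat 1" "matrix_inv A ** A = mat 1"
  using assms someI_ex[of "\<lambda>A'. A ** A' = mat 1 \<and> A' ** A = mat 1"]
  by (auto simp: invertible_def matrix_inv_def)

context padic_field
begin

text \<open>The definition of a lattice provides invertibility only for some basis
  \<open>Q0\<close>. Its rows are integral combinations of those of \<open>Q\<close>, which gives a
  left inverse of the order matrix of \<open>Q\<close>.\<close>

lemma invertible_ord:
  fixes Q :: "'k ^ 'g ^ 'g"
  assumes "is_lattice \<nu> \<Lambda>" and Q: "is_period_matrix \<Lambda> Q"
  shows "invertible (mmap \<nu> Q)"
proof -
  obtain Q0 :: "'k ^ 'g ^ 'g" where Q0: "invertible (mmap \<nu> Q0)" "\<Lambda> = range (row_prod Q0)"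
    using assms(1) by (auto simp: is_lattice_def)
  have \<Lambda>: "\<Lambda> = range (row_prod Q)" and nz: "Q $ i $ j \<noteq> 0" for i j
    using Q by (auto simp: is_period_matrix_def bij_betw_def)
  have "Q0 $ i \<in> range (row_prod Q)" for i
    using row_prod_delta[of Q0 i] unfolding \<Lambda>[symmetric] Q0(2) by (metis rangeI)
  hence "\<forall>i. \<exists>k. Q0 $ i = row_prod Q k" by blast
  then obtain k where k: "\<And>i. Q0 $ i = row_prod Q (k i)" by metis
  define V :: "rat ^ 'g ^ 'g" where "V = (\<chi> i l. of_int (k i l))"
  have "mmap \<nu> Q0 = V ** mmap \<nu> Q"
    by (simp add: vec_eq_iff k row_prod_nth V_def matrix_matrix_mult_def \<nu>_prod \<nu>_power_int nz power_int_eq_0_iff)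
  hence "(matrix_inv (mmap \<nu> Q0) ** V) ** mmap \<nu> Q = mat 1"
    using matrix_inv_cancel(2)[OF Q0(1)] by (simp add: matrix_mul_assoc)
  thus ?thesis unfolding invertible_left_inverse by blast
qed

text \<open>Each entry is a relation in the completion whose valuations, made integral by the common
  denominator \<open>D\<close>, satisfy an \<open>l\<close>-adic linear equation. In the fraction
  field \<open>D\<close> is cancelled.\<close>

lemma ord_relation:
  fixes Q\<^sub>A :: "'k ^ 'g ^ 'g" and Q\<^sub>B :: "'k ^ 'h ^ 'h" and M N :: "'l::prime_card padic_int ^ 'h ^ 'g"
  assumes nz: "\<And>i j. Q\<^sub>A $ i $ j \<noteq> 0" "\<And>i j. Q\<^sub>B $ i $ j \<noteq> 0"
    and eq: "mat_rmult cscale (mmap compl_map Q\<^sub>A) M = mat_lmult cscale N (mmap compl_map Q\<^sub>B)"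
  shows "mmap of_rat (mmap \<nu> Q\<^sub>A) ** mmap padic_of_int M = mmap padic_of_int N ** mmap of_rat (mmap \<nu> Q\<^sub>B)"
proof -
  obtain D where D: "D > 0" "\<And>x. x \<noteq> 0 \<Longrightarrow> of_nat D * \<nu> x \<in> \<int>" using valuation_discrete by blast
  \<comment> \<open>Rounding is exact on nonzero arguments; the value at \<open>0\<close> is a
    default.\<close>
  define v where "v x = \<lfloor>of_nat D * \<nu> x\<rfloor>" for x
  have v: "of_nat D * \<nu> x = of_int (v x)" if "x \<noteq> 0" for x
    using D(2)[OF that] by (auto simp: v_def elim: Ints_cases)
  have split: "sum f UNIV = (\<Sum>j\<in>UNIV. f (Inl j)) + (\<Sum>l\<in>UNIV. f (Inr l))"
    for f :: "'g + 'h \<Rightarrow> 'b::comm_monoid_add"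
    by (simp add: sum.Plus UNIV_Plus_UNIV[symmetric] del: UNIV_Plus_UNIV)
  have "(\<Sum>j\<in>UNIV. of_rat (\<nu> (Q\<^sub>A $ i $ j)) * padic_of_int (M $ j $ k))
      = (\<Sum>l\<in>UNIV. padic_of_int (N $ i $ l) * of_rat (\<nu> (Q\<^sub>B $ l $ k)))" for i k
  proof -
    let ?a = "\<lambda>s. case s of Inl j \<Rightarrow> M $ j $ k | Inr l \<Rightarrow> - N $ i $ l"
    let ?c = "\<lambda>s. case s of Inl j \<Rightarrow> Q\<^sub>A $ i $ j | Inr l \<Rightarrow> Q\<^sub>B $ l $ k"
    have "(\<Sum>s\<in>UNIV. ?a s * of_int (v (?c s))) = 0"
    proof (rule valuation_relation[OF _ v])
      show "(\<Sum>s\<in>UNIV. cscale (?a s) (compl_map (?c s))) = (0 :: ('k, 'l) mult_completion)"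
        using eq by (simp add: split mat_rmult_def mat_lmult_def vec_eq_iff cscale.scale_minus_left sum_negf)
    qed (use nz in \<open>auto split: sum.splits\<close>)
    hence "(\<Sum>j\<in>UNIV. M $ j $ k * of_int (v (Q\<^sub>A $ i $ j))) = (\<Sum>l\<in>UNIV. N $ i $ l * of_int (v (Q\<^sub>B $ l $ k)))"
      by (simp add: split sum_negf)
    hence "padic_of_int (\<Sum>j\<in>UNIV. M $ j $ k * of_int (v (Q\<^sub>A $ i $ j)))
        = padic_of_int (\<Sum>l\<in>UNIV. N $ i $ l * of_int (v (Q\<^sub>B $ l $ k)))" by simp
    hence *: "(\<Sum>j\<in>UNIV. padic_of_int (M $ j $ k) * of_int (v (Q\<^sub>A $ i $ j)))
        = (\<Sum>l\<in>UNIV. padic_of_int (N $ i $ l) * of_int (v (Q\<^sub>B $ l $ k)))"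
      by (simp only: padic_of_int_sum padic_of_int_mult padic_of_int_of_int)
    have "of_int (v x) = of_nat D * (of_rat (\<nu> x) :: 'l padic)" if "x \<noteq> 0" for x
      using arg_cong[OF v[OF that], of "of_rat :: rat \<Rightarrow> 'l padic"] by (simp add: of_rat_mult)
    hence "of_nat D * (\<Sum>j\<in>UNIV. of_rat (\<nu> (Q\<^sub>A $ i $ j)) * padic_of_int (M $ j $ k))
        = of_nat D * (\<Sum>l\<in>UNIV. padic_of_int (N $ i $ l) * of_rat (\<nu> (Q\<^sub>B $ l $ k)))"
      using * by (simp add: nz sum_distrib_left ac_simps del: mult_fract)
    moreover have "(of_nat D :: 'l padic) \<noteq> 0" using D(1) by simp
    ultimately show ?thesis using mult_left_cancel by blast
  qed
  thus ?thesis by (simp add: vec_eq_iff matrix_matrix_mult_def)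
qed

end

section \<open>Rational coefficients\<close>

lemma to_Q_add: "to_Q (x + y) = to_Q x + to_Q y"
  by transfer (simp add: loc_rel_refl_iff)

lemma to_Q_cscale: "to_Q (cscale a x) = qscale (padic_of_int a) (to_Q x)"
proof -
  have "to_Q (cscale a x) = frac_scale a 1 (to_Q x)" by transfer (simp add: loc_rel_refl_iff)
  thus ?thesis by (simp add: qscale_Fract)
qed

lemma to_Q_eq_iff: "to_Q x = to_Q y \<longleftrightarrow> (\<exists>c. c \<noteq> 0 \<and> cscale c x = cscale c y)"
  by transfer (simp add: loc_rel_def)

lemma to_Q_0: "to_Q 0 = 0"
  using to_Q_add[of 0 0] by simp

lemma to_Q_sum: "to_Q (sum f I) = (\<Sum>i\<in>I. to_Q (f i))"
  by (induction I rule: infinite_finite_induct) (simp_all add: to_Q_0 to_Q_add)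

lemma mmap_to_Q_mat_rmult:
  "mmap to_Q (mat_rmult cscale U M) = mat_rmult qscale (mmap to_Q U) (mmap padic_of_int M)"
  by (simp add: vec_eq_iff mat_rmult_def to_Q_sum to_Q_cscale)

lemma mmap_to_Q_mat_lmult:
  "mmap to_Q (mat_lmult cscale N U) = mat_lmult qscale (mmap padic_of_int N) (mmap to_Q U)"
  by (simp add: vec_eq_iff mat_lmult_def to_Q_sum to_Q_cscale)

lemma prod_of_others:
  fixes b :: "'i \<Rightarrow> 'r::comm_monoid_mult"
  assumes "finite I" "i \<in> I"
  shows "prod b I = prod b (I - {i}) * b i"
  using prod.remove[OF assms, of b] by (simp add: mult.commute)

lemma common_denominator:
  fixes U :: "'a::idom fract ^ 'n ^ 'm"
  shows "\<exists>c N. c \<noteq> 0 \<and> mmap ((*) (Fract c 1)) U = mmap (\<lambda>a. Fract a 1) N"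
proof -
  have "\<exists>a b. b \<noteq> 0 \<and> U $ i $ j = Fract a b" for i j by (cases "U $ i $ j") auto
  then obtain a b where ab: "\<And>i j. b i j \<noteq> 0" "\<And>i j. U $ i $ j = Fract (a i j) (b i j)" by metis
  define p where "p = (\<lambda>(i, j). b i j)"
  define c where "c = prod p UNIV"
  have "c \<noteq> 0" using ab(1) by (auto simp: c_def p_def)
  have "c = prod p (UNIV - {(i, j)}) * b i j" for i j
    unfolding c_def using prod_of_others[of UNIV "(i, j)" p] by (simp add: p_def)
  hence "Fract c 1 * U $ i $ j = Fract (prod p (UNIV - {(i, j)}) * a i j) 1" for i j
    using ab(1)[of i j] by (simp add: ab(2) eq_fract ac_simps)
  hence "mmap ((*) (Fract c 1)) U = mmap (\<lambda>a. Fract a 1) (\<chi> i j. prod p (UNIV - {(i, j)}) * a i j)"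
    by (simp add: vec_eq_iff del: mult_fract)
  with \<open>c \<noteq> 0\<close> show ?thesis by blast
qed

text \<open>Passing to rational coefficients identifies elements differing by torsion. The product
  of the annihilators of all entries works for the matrix at once.\<close>

lemma mmap_to_Q_eqD:
  fixes U V :: "('k::field, 'l::prime_card) mult_completion ^ 'n ^ 'm"
  assumes "mmap to_Q U = mmap to_Q V"
  shows "\<exists>d. d \<noteq> 0 \<and> mmap (cscale d) U = mmap (cscale d) V"
proof -
  have "\<exists>d. d \<noteq> 0 \<and> cscale d (U $ i $ j) = cscale d (V $ i $ j)" for i j
    using assms by (simp add: vec_eq_iff to_Q_eq_iff)
  then obtain d where d: "\<And>i j. d i j \<noteq> 0" "\<And>i j. cscale (d i j) (U $ i $ j) = cscale (d i j) (V $ i $ j)"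
    by metis
  define p where "p = (\<lambda>(i, j). d i j)"
  have "prod p UNIV = prod p (UNIV - {(i, j)}) * d i j" for i j
    using prod_of_others[of UNIV "(i, j)" p] by (simp add: p_def)
  hence "cscale (prod p UNIV) (U $ i $ j) = cscale (prod p UNIV) (V $ i $ j)" for i j
    using d(2)[of i j] by (metis cscale.scale_scale)
  moreover have "prod p UNIV \<noteq> 0" using d(1) by (auto simp: p_def)
  ultimately show ?thesis by (intro exI[of _ "prod p UNIV"]) (simp add: vec_eq_iff)
qed

theorem proposition4p11:
  fixes \<iota> :: "'p::prime_card padic \<Rightarrow> 'k::field" and \<nu> :: "'k \<Rightarrow> rat"
    and \<Lambda>\<^sub>A :: "('k ^ 'g) set" and \<Lambda>\<^sub>B :: "('k ^ 'h) set"
    and Q\<^sub>A :: "'k ^ 'g ^ 'g" and Q\<^sub>B :: "'k ^ 'h ^ 'h"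
  assumes "padic_field \<iota> \<nu>"
    and "is_lattice \<nu> \<Lambda>\<^sub>A" and "is_lattice \<nu> \<Lambda>\<^sub>B"
    and "is_period_matrix \<Lambda>\<^sub>A Q\<^sub>A" and "is_period_matrix \<Lambda>\<^sub>B Q\<^sub>B"
  shows "let
      H = (hom_galois \<Lambda>\<^sub>A \<Lambda>\<^sub>B :: ('l::prime_card padic_int, _) module);
      S1 = {M :: 'l padic_int ^ 'h ^ 'g.
        (\<lambda>x. vec_mat cscale x M) ` completed_lattice \<Lambda>\<^sub>A \<subseteq> completed_lattice \<Lambda>\<^sub>B};
      S2 = {M :: 'l padic_int ^ 'h ^ 'g. \<exists>N :: 'l padic_int ^ 'h ^ 'g.
        mat_rmult cscale (mmap compl_map Q\<^sub>A) M = mat_lmult cscale N (mmap compl_map Q\<^sub>B)};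
      S3 = {M :: 'l padic_int ^ 'h ^ 'g.
        mat_rmult qscale (normalized_period \<nu> Q\<^sub>A) (mmap padic_of_int M) =
        mat_lmult qscale (mmap padic_of_int M) (normalized_period \<nu> Q\<^sub>B)}
    in H \<cong>\<^sub>M matrix_module S1 \<and>
       matrix_module S1 \<cong>\<^sub>M matrix_module S2 \<and>
       matrix_module S2 \<cong>\<^sub>M matrix_module S3"
proof -
  interpret K: padic_field \<iota> \<nu> by fact
  interpret qscale: Modules.module "qscale :: 'l padic \<Rightarrow> ('k, 'l) mult_completion_Q \<Rightarrow> _"
    by (rule module_qscale)
  let ?UA = "mmap compl_map Q\<^sub>A :: ('k, 'l) mult_completion ^ 'g ^ 'g"
  let ?UB = "mmap compl_map Q\<^sub>B :: ('k, 'l) mult_completion ^ 'h ^ 'h"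
  have nz: "Q\<^sub>A $ i $ j \<noteq> 0" "Q\<^sub>B $ i' $ j' \<noteq> 0" for i j i' j'
    using assms(4,5) by (auto simp: is_period_matrix_def)
  define S where "S = {M :: 'l padic_int ^ 'h ^ 'g. \<exists>N. mat_rmult cscale ?UA M = mat_lmult cscale N ?UB}"
  define S3 where "S3 = {M :: 'l padic_int ^ 'h ^ 'g.
    mat_rmult qscale (normalized_period \<nu> Q\<^sub>A) (mmap padic_of_int M) =
    mat_lmult qscale (mmap padic_of_int M) (normalized_period \<nu> Q\<^sub>B)}"

  have S: "0 \<in> S" "\<And>x y. x \<in> S \<Longrightarrow> y \<in> S \<Longrightarrow> x + y \<in> S" "\<And>a x. x \<in> S \<Longrightarrow> mmap ((*) a) x \<in> S"
  proof -
    show "0 \<in> S" unfolding S_def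
      by (intro CollectI exI[of _ 0]) (simp add: cscale.mat_rmult_zero cscale.mat_lmult_zero)
    show "x + y \<in> S" if "x \<in> S" "y \<in> S" for x y
      using that unfolding S_def by (auto simp: cscale.mat_rmult_add simp flip: cscale.mat_lmult_add)
    show "mmap ((*) a) x \<in> S" if "x \<in> S" for a x
      using that unfolding S_def by (auto simp: cscale.mat_rmult_scale simp flip: cscale.mat_lmult_scale)
  qed
  have of_int_add: "mmap padic_of_int (M + M') = mmap padic_of_int M + mmap padic_of_int M'"
    and of_int_scale: "mmap padic_of_int (mmap ((*) c) M) = mmap ((*) (padic_of_int c)) (mmap padic_of_int M)"
    and of_int_0: "mmap padic_of_int 0 = 0"
    for M M' :: "'l padic_int ^ 'h ^ 'g" and c
    by (simp_all add: vec_eq_iff padic_of_int_add padic_of_int_mult padic_of_int_0 del: mult_fract add_fract)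
  have S3: "0 \<in> S3" "\<And>x y. x \<in> S3 \<Longrightarrow> y \<in> S3 \<Longrightarrow> x + y \<in> S3" "\<And>a x. x \<in> S3 \<Longrightarrow> mmap ((*) a) x \<in> S3"
    unfolding S3_def
    by (simp_all add: of_int_add of_int_scale of_int_0 qscale.mat_rmult_add qscale.mat_lmult_add
        qscale.mat_rmult_scale qscale.mat_lmult_scale qscale.mat_rmult_zero qscale.mat_lmult_zero)

  define oA :: "'l padic ^ 'g ^ 'g" where "oA = mmap of_rat (mmap \<nu> Q\<^sub>A)"
  define oB :: "'l padic ^ 'h ^ 'h" where "oB = mmap of_rat (mmap \<nu> Q\<^sub>B)"
  define iA :: "'l padic ^ 'g ^ 'g" where "iA = mmap of_rat (matrix_inv (mmap \<nu> Q\<^sub>A))"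
  define iB :: "'l padic ^ 'h ^ 'h" where "iB = mmap of_rat (matrix_inv (mmap \<nu> Q\<^sub>B))"
  have inv: "oA ** iA = mat 1" "iA ** oA = mat 1" "oB ** iB = mat 1" "iB ** oB = mat 1"
    using matrix_inv_cancel[OF K.invertible_ord[OF assms(2,4)]] matrix_inv_cancel[OF K.invertible_ord[OF assms(3,5)]]
    by (simp_all add: oA_def oB_def iA_def iB_def mmap_of_rat_one flip: mmap_of_rat_mult)
  \<comment> \<open>Valuations leave only one candidate for \<open>N\<close>, a priori with
    \<open>l\<close>-adic denominators.\<close>
  have N_eq: "mmap padic_of_int N = oA ** mmap padic_of_int M ** iB"
    if "mat_rmult cscale ?UA M = mat_lmult cscale N ?UB" for M N :: "'l padic_int ^ 'h ^ 'g"
  proof -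
    have "oA ** mmap padic_of_int M = mmap padic_of_int N ** oB"
      unfolding oA_def oB_def by (rule K.ord_relation[OF nz that])
    hence "oA ** mmap padic_of_int M ** iB = mmap padic_of_int N ** (oB ** iB)"
      by (simp add: matrix_mul_assoc)
    thus ?thesis by (simp add: inv)
  qed
  \<comment> \<open>Multiplication by the order matrix of \<open>Q\<^sub>A\<close> turns the third
    condition into the second one with rational coefficients, where \<open>N\<close> has the value
    forced by the valuations.\<close>
  have S3_iff: "M \<in> S3 \<longleftrightarrow> mat_rmult qscale (mmap to_Q ?UA) (mmap padic_of_int M)
      = mat_lmult qscale (oA ** mmap padic_of_int M ** iB) (mmap to_Q ?UB)" (is "_ \<longleftrightarrow> ?x = ?y") for M
  proof -
    let ?M = "mmap padic_of_int M"
    have np: "normalized_period \<nu> Q\<^sub>A = mat_lmult qscale iA (mmap to_Q ?UA)"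
      "normalized_period \<nu> Q\<^sub>B = mat_lmult qscale iB (mmap to_Q ?UB)"
      by (simp_all add: normalized_period_def iA_def iB_def mmap_def)
    have "M \<in> S3 \<longleftrightarrow> mat_lmult qscale iA ?x = mat_lmult qscale (?M ** iB) (mmap to_Q ?UB)"
      by (simp add: S3_def np qscale.mat_rmult_lmult qscale.mat_lmult_assoc)
    also have "\<dots> \<longleftrightarrow> ?x = ?y"
    proof
      assume "mat_lmult qscale iA ?x = mat_lmult qscale (?M ** iB) (mmap to_Q ?UB)"
      from arg_cong[OF this, of "mat_lmult qscale oA"] show "?x = ?y"
        by (simp add: qscale.mat_lmult_assoc inv qscale.mat_lmult_one matrix_mul_assoc)
    next
      assume "?x = ?y"
      moreover have "iA ** (oA ** ?M ** iB) = ?M ** iB"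
        by (simp add: matrix_mul_assoc inv)
      ultimately show "mat_lmult qscale iA ?x = mat_lmult qscale (?M ** iB) (mmap to_Q ?UB)"
        by (simp add: qscale.mat_lmult_assoc)
    qed
    finally show ?thesis .
  qed
  have "S \<subseteq> S3"
  proof
    fix M assume "M \<in> S"
    then obtain N where N: "mat_rmult cscale ?UA M = mat_lmult cscale N ?UB" by (auto simp: S_def)
    from arg_cong[OF this, of "mmap to_Q"] show "M \<in> S3"
      by (simp add: S3_iff mmap_to_Q_mat_rmult mmap_to_Q_mat_lmult N_eq[OF N])
  qed
  \<comment> \<open>The scalar \<open>c\<close> clears the denominators of the forced
    \<open>N\<close>, and \<open>d\<close> kills the torsion by which the two sides may still differ
    in the completion itself.\<close>
  moreover have "\<exists>c. c \<noteq> 0 \<and> mmap ((*) c) M \<in> S" if "M \<in> S3" for M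
  proof -
    obtain c N where cN: "c \<noteq> 0" "mmap ((*) (padic_of_int c)) (oA ** mmap padic_of_int M ** iB) = mmap padic_of_int N"
      using common_denominator by blast
    have "mmap to_Q (mat_rmult cscale ?UA (mmap ((*) c) M))
        = mmap (qscale (padic_of_int c)) (mat_rmult qscale (mmap to_Q ?UA) (mmap padic_of_int M))"
      by (simp add: mmap_to_Q_mat_rmult of_int_scale qscale.mat_rmult_scale)
    also have "\<dots> = mat_lmult qscale (mmap padic_of_int N) (mmap to_Q ?UB)"
      using that by (simp add: S3_iff flip: cN(2) qscale.mat_lmult_scale)
    also have "\<dots> = mmap to_Q (mat_lmult cscale N ?UB)"
      by (rule mmap_to_Q_mat_lmult[symmetric])
    finally obtain d where d: "d \<noteq> 0"
      "mmap (cscale d) (mat_rmult cscale ?UA (mmap ((*) c) M)) = mmap (cscale d) (mat_lmult cscale N ?UB)"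
      using mmap_to_Q_eqD by blast
    have "mat_rmult cscale ?UA (mmap ((*) d) (mmap ((*) c) M)) = mat_lmult cscale (mmap ((*) d) N) ?UB"
      using d(2) by (simp add: cscale.mat_rmult_scale cscale.mat_lmult_scale)
    moreover have "mmap ((*) d) (mmap ((*) c) M) = mmap ((*) (d * c)) M" by (simp add: vec_eq_iff mult.assoc)
    ultimately have "mmap ((*) (d * c)) M \<in> S" by (auto simp: S_def)
    with cN(1) d(1) show ?thesis by (intro exI[of _ "d * c"]) simp
  qed
  ultimately have iso23: "matrix_module S \<cong>\<^sub>M matrix_module S3"
    using S S3 by (intro commensurable_matrix_modules_iso)

  \<comment> \<open>The first two sets of matrices coincide by
    \<open>completed_lattice_maps_iff\<close>, so the identity serves as isomorphism.\<close>
  have iso12: "matrix_module S \<cong>\<^sub>M matrix_module S"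
    using module_matrix_module[OF S] unfolding module_iso_def by (intro conjI exI[of _ id]) auto

  obtain \<zeta> :: "nat \<Rightarrow> 'k alg_closure" where "kummer TYPE('l) \<zeta>" using K.ex_kummer by blast
  then interpret kummer \<zeta> "TYPE('l)" .
  obtain r\<^sub>A where rA: "\<And>i j. root_system (Q\<^sub>A $ i $ j) (r\<^sub>A i j)" using ex_root_system[OF nz(1)] by metis
  obtain r\<^sub>B where rB: "\<And>i j. root_system (Q\<^sub>B $ i $ j) (r\<^sub>B i j)" using ex_root_system[OF nz(2)] by metis
  interpret period_lattice_pair \<zeta> "TYPE('l)" \<Lambda>\<^sub>A Q\<^sub>A r\<^sub>A \<Lambda>\<^sub>B Q\<^sub>B r\<^sub>B
    by unfold_locales (fact assms rA rB)+
  have "(hom_galois \<Lambda>\<^sub>A \<Lambda>\<^sub>B :: ('l padic_int, _) module) \<cong>\<^sub>M matrix_module S"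
  proof (rule hom_iso_matrices[OF _ S_def module_matrix_module[OF S]])
    fix M N N' :: "'l padic_int ^ 'h ^ 'g"
    assume "mat_rmult cscale ?UA M = mat_lmult cscale N ?UB" "mat_rmult cscale ?UA M = mat_lmult cscale N' ?UB"
    hence "mmap padic_of_int N = mmap padic_of_int N'" by (simp add: N_eq)
    thus "N = N'" by (simp add: vec_eq_iff padic_of_int_eq_iff)
  qed
  moreover have "{M :: 'l padic_int ^ 'h ^ 'g.
      (\<lambda>x. vec_mat cscale x M) ` completed_lattice \<Lambda>\<^sub>A \<subseteq> completed_lattice \<Lambda>\<^sub>B} = S"
    unfolding S_def completed_lattice_maps_iff[OF assms(4,5)] ..
  ultimately show ?thesis
    using iso12 iso23 by (simp add: Let_def S_def[symmetric] S3_def[symmetric])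
qed

end
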